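(* 1) Let $1<p<\infty$ and $1/p+1/q=1$. The Markov-Stieltjes transform $S$, given by $Sf(z)=\int_0^1\frac{f(t)}{1-tz}\,dt$ for $f\in L^p(0,1)$, $z\in(0,1)$, is a bounded non-compact operator on $L^p(0,1)$. Moreover, $$\frac{\pi}{\sin\frac{\pi}{p}}\leq\|S\|_{L^p\to L^p}\leq\pi\cot\frac{\pi}{2\max\{p,q\}}.$$ 2) The Markov-Stieltjes transform on $L^2(0,1)$ is unitarily equivalent to the Markov-Stieltjes transform on $H^2(\mathbb{D})$. In particular, the norm and the essential norm of $S$ on $L^2(0,1)$ are equal to $\pi$, and the spectrum and the essential spectrum of $S$ on $L^2(0,1)$ are equal to $[0,\pi]$.
   Context: $\mathbb{D}$ is the open unit disk and $H^2(\mathbb{D})$ the Hardy space. The Markov-Stieltjes transform on $L^p(0,1)$ is the operator $Sf(z)=\int_0^1\frac{f(t)}{1-tz}\,dt$, $f\in L^p(0,1)$, $z\in(0,1)$. The Markov-Stieltjes transform on $H^2(\mathbb{D})$ is the operator $Sf(z)=\int_0^1\frac{f(t)}{1-tz}\,dt$, $f\in H^2(\mathbb{D})$, $z\in\mathbb{D}$ (where $f$ under the integral is restricted to $(0,1)\subset\mathbb{D}$). *)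

theory Defs
  imports "HOL-Analysis.Analysis" "HOL-Complex_Analysis.Complex_Analysis"
begin

text \<open>
  A complex function space is given by a set of functions (closed under the pointwise
  vector space operations) together with a seminorm. The normed space meant is the quotient
  by the functions of seminorm zero, so two elements are identified when the seminorm of
  their difference vanishes; all notions below (linearity, inverses, limits) are understood
  up to this identification. Thus \<open>L^p\<close> functions are identified when equal almost everywhere,
  and functions of the Hardy space when equal on the open unit disk.
\<close>

record 'a fun_space =
  elems :: "('a \<Rightarrow> complex) set"
  snorm :: "('a \<Rightarrow> complex) \<Rightarrow> real"

definition eq_in :: "'a fun_space \<Rightarrow> ('a \<Rightarrow> complex) \<Rightarrow> ('a \<Rightarrow> complex) \<Rightarrow> bool" where
  "eq_in X f g \<longleftrightarrow> snorm X (\<lambda>x. f x - g x) = 0"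

definition linear_op ::
    "'a fun_space \<Rightarrow> 'b fun_space \<Rightarrow> (('a \<Rightarrow> complex) \<Rightarrow> ('b \<Rightarrow> complex)) \<Rightarrow> bool" where
  "linear_op X Y T \<longleftrightarrow>
     (\<forall>f\<in>elems X. T f \<in> elems Y) \<and>
     (\<forall>f\<in>elems X. \<forall>g\<in>elems X. eq_in Y (T (\<lambda>x. f x + g x)) (\<lambda>y. T f y + T g y)) \<and>
     (\<forall>c. \<forall>f\<in>elems X. eq_in Y (T (\<lambda>x. c * f x)) (\<lambda>y. c * T f y))"

text \<open>A bounded linear operator maps functions of seminorm zero to functions of seminorm
  zero, hence is well defined on the quotients.\<close>

definition bounded_op ::
    "'a fun_space \<Rightarrow> 'b fun_space \<Rightarrow> (('a \<Rightarrow> complex) \<Rightarrow> ('b \<Rightarrow> complex)) \<Rightarrow> bool" where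
  "bounded_op X Y T \<longleftrightarrow>
     linear_op X Y T \<and> (\<exists>C. \<forall>f\<in>elems X. snorm Y (T f) \<le> C * snorm X f)"

definition compact_op ::
    "'a fun_space \<Rightarrow> 'b fun_space \<Rightarrow> (('a \<Rightarrow> complex) \<Rightarrow> ('b \<Rightarrow> complex)) \<Rightarrow> bool" where
  "compact_op X Y T \<longleftrightarrow>
     bounded_op X Y T \<and>
     (\<forall>F :: nat \<Rightarrow> 'a \<Rightarrow> complex. \<forall>C.
        (\<forall>n. F n \<in> elems X \<and> snorm X (F n) \<le> C) \<longrightarrow>
        (\<exists>g\<in>elems Y. \<exists>r :: nat \<Rightarrow> nat. strict_mono r \<and>
           (\<lambda>n. snorm Y (\<lambda>y. T (F (r n)) y - g y)) \<longlonglongrightarrow> 0))"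

definition op_norm ::
    "'a fun_space \<Rightarrow> 'b fun_space \<Rightarrow> (('a \<Rightarrow> complex) \<Rightarrow> ('b \<Rightarrow> complex)) \<Rightarrow> real" where
  "op_norm X Y T = (SUP f\<in>{f\<in>elems X. snorm X f \<le> 1}. snorm Y (T f))"

definition ess_norm ::
    "'a fun_space \<Rightarrow> (('a \<Rightarrow> complex) \<Rightarrow> ('a \<Rightarrow> complex)) \<Rightarrow> real" where
  "ess_norm X T = (INF K\<in>{K. compact_op X X K}. op_norm X X (\<lambda>f x. T f x - K f x))"

definition spectrum_op ::
    "'a fun_space \<Rightarrow> (('a \<Rightarrow> complex) \<Rightarrow> ('a \<Rightarrow> complex)) \<Rightarrow> complex set" where
  "spectrum_op X T = {c. \<not> (\<exists>R. bounded_op X X R \<and>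
     (\<forall>f\<in>elems X. eq_in X (R (\<lambda>x. c * f x - T f x)) f) \<and>
     (\<forall>f\<in>elems X. eq_in X (\<lambda>x. c * R f x - T (R f) x) f))}"

text \<open>The essential spectrum is the spectrum of the class of \<open>T\<close> in the Calkin algebra of
  bounded operators modulo compact ones; just as the essential norm is the norm there.\<close>

definition ess_spectrum_op ::
    "'a fun_space \<Rightarrow> (('a \<Rightarrow> complex) \<Rightarrow> ('a \<Rightarrow> complex)) \<Rightarrow> complex set" where
  "ess_spectrum_op X T = {c. \<not> (\<exists>R. bounded_op X X R \<and>
     compact_op X X (\<lambda>f x. R (\<lambda>y. c * f y - T f y) x - f x) \<and>
     compact_op X X (\<lambda>f x. (c * R f x - T (R f) x) - f x))}"

text \<open>Unitary operators between Hilbert spaces are the surjective linear isometries (the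
  inner products are then preserved, by polarization).\<close>

definition unitary_op ::
    "'a fun_space \<Rightarrow> 'b fun_space \<Rightarrow> (('a \<Rightarrow> complex) \<Rightarrow> ('b \<Rightarrow> complex)) \<Rightarrow> bool" where
  "unitary_op X Y U \<longleftrightarrow>
     linear_op X Y U \<and>
     (\<forall>f\<in>elems X. snorm Y (U f) = snorm X f) \<and>
     (\<forall>g\<in>elems Y. \<exists>f\<in>elems X. eq_in Y (U f) g)"

definition unitarily_equivalent ::
    "'a fun_space \<Rightarrow> (('a \<Rightarrow> complex) \<Rightarrow> ('a \<Rightarrow> complex)) \<Rightarrow>
     'b fun_space \<Rightarrow> (('b \<Rightarrow> complex) \<Rightarrow> ('b \<Rightarrow> complex)) \<Rightarrow> bool" where
  "unitarily_equivalent X S Y T \<longleftrightarrow>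
     bounded_op X X S \<and> bounded_op Y Y T \<and>
     (\<exists>U. unitary_op X Y U \<and> (\<forall>f\<in>elems X. eq_in Y (U (S f)) (T (U f))))"

definition Lp01 :: "real \<Rightarrow> real fun_space" where
  "Lp01 p = \<lparr>
     elems = {f. f \<in> borel_measurable (lebesgue_on {0<..<1}) \<and>
                 integrable (lebesgue_on {0<..<1}) (\<lambda>t. cmod (f t) powr p)},
     snorm = (\<lambda>f. (LINT t|lebesgue_on {0<..<1}. cmod (f t) powr p) powr (1 / p)) \<rparr>"

definition hardy2_mean :: "(complex \<Rightarrow> complex) \<Rightarrow> real \<Rightarrow> real" where
  "hardy2_mean f r = (LINT t|lebesgue_on {0..2 * pi}. (cmod (f (rcis r t)))\<^sup>2) / (2 * pi)"

definition H2 :: "complex fun_space" where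
  "H2 = \<lparr>
     elems = {f. f holomorphic_on ball 0 1 \<and> bdd_above (hardy2_mean f ` {0..<1})},
     snorm = (\<lambda>f. sqrt (SUP r\<in>{0..<1}. hardy2_mean f r)) \<rparr>"

definition markov_stieltjes :: "(real \<Rightarrow> complex) \<Rightarrow> complex \<Rightarrow> complex" where
  "markov_stieltjes f z = (LINT t|lebesgue_on {0<..<1}. f t / (1 - of_real t * z))"

text \<open>Values outside \<open>(0,1)\<close>, respectively outside the unit disk, are irrelevant: they do not
  affect membership or the seminorm.\<close>

definition MS_Lp :: "(real \<Rightarrow> complex) \<Rightarrow> (real \<Rightarrow> complex)" where
  "MS_Lp f = (\<lambda>x. markov_stieltjes f (of_real x))"

definition MS_H2 :: "(complex \<Rightarrow> complex) \<Rightarrow> (complex \<Rightarrow> complex)" where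
  "MS_H2 f = markov_stieltjes (\<lambda>t. f (of_real t))"

end

theory Submission
  imports Defs
begin

text \<open>The kernel \<open>1 / (1 - t z)\<close> maps the weight \<open>t powr (a - 1) * (1 - t) powr (- a)\<close> to
  \<open>\<pi> / sin (\<pi> a) * (1 - z) powr (- a)\<close>; with \<open>a = 1 / p\<close> the Schur test gives \<open>\<parallel>S\<parallel> \<le> \<pi> / sin (\<pi> / p)\<close>, which is
  at most the cotangent bound. Near the corner \<open>t = z = 1\<close> the kernel behaves like the Carleman kernel
  \<open>1 / (u + v)\<close> with \<open>u = 1 - t\<close>, which has the generalized eigenfunctions \<open>u powr (- 1 / p + \<i> \<xi>)\<close>. Cut off to
  windows approaching the corner, they are approximate eigenfunctions with disjoint supports, which
  yields the lower bounds for the norm and the essential norm, and non-compactness. For \<open>p = 2\<close> the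
  eigenvalues vary continuously with \<open>\<xi>\<close> from \<open>\<pi>\<close> down to \<open>0\<close>, so that \<open>[0, \<pi>]\<close> is in the essential spectrum,
  while \<open>0 \<le> S \<le> \<pi>\<close> excludes any other spectrum.

  Identify \<open>H\<^sup>2\<close> with \<open>l\<^sup>2\<close> by Taylor coefficients. The operator \<open>V\<close> taking a function on \<open>(0,1)\<close> to its moments has
  as adjoint the restriction \<open>A\<close> of a power series to \<open>(0,1)\<close>, and \<open>S\<close> is \<open>A V\<close> on \<open>L\<^sup>2(0,1)\<close> and \<open>V A\<close> on \<open>H\<^sup>2\<close>. Both
  \<open>V\<close> and \<open>A\<close> are injective, so the partial isometry in the polar decomposition of \<open>V\<close> is a unitary
  equivalence. It is the strong limit of \<open>V q\<^sub>n(B) / sqrt \<pi>\<close>, where \<open>B = 1 - A V / \<pi>\<close> and \<open>q\<^sub>n\<close> is the \<open>n\<close>-th partial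
  sum of the binomial series of \<open>1 / sqrt (1 - b)\<close>.\<close>

section \<open>Complete seminormed function spaces\<close>

text \<open>All estimates grow out of the constant of the Schur test. At p = 2 it says ||S|| <= pi;
  applied to |f| it bounds the squared moments by the integral of |f| S|f|, so ||V||^2 <= pi, and 0
  <= S <= pi follows as an inequality of quadratic forms. The obstacle to the lower bounds is that
  the generalized eigenfunctions are not in L^p. With the critical exponent 1/p their truncations
  have norms that grow without bound with the logarithmic length of the window, while the error made
  at the two edges stays bounded by scaling, so the relative error tends to 0. The polar factor is V
  S^(-1/2), and S^(-1/2) is unbounded because 0 lies in the spectrum; the series converges only
  strongly and only after composition with V. It is manageable because its coefficients are
  nonnegative with convolution square constantly 1, which turns inner products into sums that nearly
  telescope. Surjectivity comes from the same construction with V and A exchanged. That the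
  eigenvalues at p = 2 are real is read off from the inclusion of the spectrum in [0, pi].\<close>

text \<open>In contrast to \<^const>\<open>linear_op\<close> the identities hold at every point, so that polynomials in an
  operator can be rewritten without passing to the quotient by null functions.\<close>

definition exact_linear ::
    "'a fun_space \<Rightarrow> 'b fun_space \<Rightarrow> (('a \<Rightarrow> complex) \<Rightarrow> ('b \<Rightarrow> complex)) \<Rightarrow> bool" where
  "exact_linear X Y T \<longleftrightarrow>
     (\<forall>f\<in>elems X. T f \<in> elems Y) \<and>
     (\<forall>f\<in>elems X. \<forall>g\<in>elems X. T (\<lambda>x. f x + g x) = (\<lambda>y. T f y + T g y)) \<and>
     (\<forall>c. \<forall>f\<in>elems X. T (\<lambda>x. c * f x) = (\<lambda>y. c * T f y))"

lemma exact_linearI: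
  assumes "\<And>f. f \<in> elems X \<Longrightarrow> T f \<in> elems Y"
    and "\<And>f g. f \<in> elems X \<Longrightarrow> g \<in> elems X \<Longrightarrow> T (\<lambda>x. f x + g x) = (\<lambda>y. T f y + T g y)"
    and "\<And>c f. f \<in> elems X \<Longrightarrow> T (\<lambda>x. c * f x) = (\<lambda>y. c * T f y)"
  shows "exact_linear X Y T"
  using assms by (auto simp: exact_linear_def)

lemma exact_linear_in: "exact_linear X Y T \<Longrightarrow> f \<in> elems X \<Longrightarrow> T f \<in> elems Y"
  by (simp add: exact_linear_def)

lemma exact_linear_add:
  "exact_linear X Y T \<Longrightarrow> f \<in> elems X \<Longrightarrow> g \<in> elems X \<Longrightarrow> T (\<lambda>x. f x + g x) = (\<lambda>y. T f y + T g y)"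
  by (simp add: exact_linear_def)

lemma exact_linear_scale:
  "exact_linear X Y T \<Longrightarrow> f \<in> elems X \<Longrightarrow> T (\<lambda>x. c * f x) = (\<lambda>y. c * T f y)"
  by (simp add: exact_linear_def)

lemma exact_linear_compose:
  "exact_linear X Y T \<Longrightarrow> exact_linear Y Z S \<Longrightarrow> exact_linear X Z (\<lambda>f. S (T f))"
  by (simp add: exact_linear_def)

lemma exact_linear_funpow:
  "exact_linear X X T \<Longrightarrow> exact_linear X X (T ^^ k)"
  by (induction k) (auto simp: exact_linear_def)

lemma tendsto_zero_le:
  fixes u v :: "nat \<Rightarrow> real"
  assumes "v \<longlonglongrightarrow> 0" "\<And>n. 0 \<le> u n" "\<And>n. u n \<le> v n"
  shows "u \<longlonglongrightarrow> 0"
  by (rule tendsto_sandwich[OF _ _ tendsto_const assms(1)]) (use assms in auto)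

text \<open>The Cauchy condition compares only indices \<open>m \<le> n\<close>, the form in which
  tail estimates arise; by symmetry nothing is lost. Nonnegativity of the seminorm is a consequence
  of the triangle inequality and homogeneity.\<close>

locale complete_fun_space =
  fixes X :: "'a fun_space"
  assumes zero_in [simp]: "(\<lambda>x. 0) \<in> elems X"
    and add_in [simp]: "\<And>f g. f \<in> elems X \<Longrightarrow> g \<in> elems X \<Longrightarrow> (\<lambda>x. f x + g x) \<in> elems X"
    and scale_in [simp]: "\<And>c f. f \<in> elems X \<Longrightarrow> (\<lambda>x. c * f x) \<in> elems X"
    and norm_triangle: "\<And>f g. f \<in> elems X \<Longrightarrow> g \<in> elems X \<Longrightarrow>
           snorm X (\<lambda>x. f x + g x) \<le> snorm X f + snorm X g"
    and norm_scale: "\<And>c f. f \<in> elems X \<Longrightarrow> snorm X (\<lambda>x. c * f x) = cmod c * snorm X f"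
    and complete: "\<And>F. (\<And>n. F n \<in> elems X) \<Longrightarrow>
           (\<And>e. e > 0 \<Longrightarrow> \<exists>N. \<forall>m\<ge>N. \<forall>n\<ge>m. snorm X (\<lambda>x. F m x - F n x) < e) \<Longrightarrow>
           \<exists>g\<in>elems X. (\<lambda>n. snorm X (\<lambda>x. F n x - g x)) \<longlonglongrightarrow> 0"
begin

lemma minus_in [simp]: "f \<in> elems X \<Longrightarrow> (\<lambda>x. - f x) \<in> elems X"
  using scale_in[of f "-1"] by simp

lemma diff_in [simp]: "f \<in> elems X \<Longrightarrow> g \<in> elems X \<Longrightarrow> (\<lambda>x. f x - g x) \<in> elems X"
  using add_in[OF _ minus_in, of f g] by simp

lemma sum_in [simp]: "(\<And>i. i \<in> I \<Longrightarrow> F i \<in> elems X) \<Longrightarrow> (\<lambda>x. \<Sum>i\<in>I. F i x) \<in> elems X"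
  by (induction I rule: infinite_finite_induct) auto

lemma norm_zero [simp]: "snorm X (\<lambda>x. 0) = 0"
  using norm_scale[OF zero_in, of 0] by simp

lemma norm_minus: "f \<in> elems X \<Longrightarrow> snorm X (\<lambda>x. - f x) = snorm X f"
  using norm_scale[of f "-1"] by simp

lemma norm_nonneg [simp]: "f \<in> elems X \<Longrightarrow> 0 \<le> snorm X f"
  using norm_triangle[OF _ minus_in, of f f] by (simp add: norm_minus)

lemma norm_diff_commute:
  "f \<in> elems X \<Longrightarrow> g \<in> elems X \<Longrightarrow> snorm X (\<lambda>x. f x - g x) = snorm X (\<lambda>x. g x - f x)"
  using norm_minus[of "\<lambda>x. f x - g x"] by simp

lemma norm_diff_triangle:
  "f \<in> elems X \<Longrightarrow> g \<in> elems X \<Longrightarrow> h \<in> elems X \<Longrightarrow>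
     snorm X (\<lambda>x. f x - h x) \<le> snorm X (\<lambda>x. f x - g x) + snorm X (\<lambda>x. g x - h x)"
  using norm_triangle[of "\<lambda>x. f x - g x" "\<lambda>x. g x - h x"] by simp

lemma norm_diff_le:
  "f \<in> elems X \<Longrightarrow> g \<in> elems X \<Longrightarrow> snorm X (\<lambda>x. f x - g x) \<le> snorm X f + snorm X g"
  using norm_triangle[OF _ minus_in, of f g] by (simp add: norm_minus)

lemma norm_diff_ge:
  assumes "f \<in> elems X" "g \<in> elems X"
  shows "\<bar>snorm X f - snorm X g\<bar> \<le> snorm X (\<lambda>x. f x - g x)"
  using norm_triangle[of "\<lambda>x. f x - g x" g] norm_triangle[of "\<lambda>x. g x - f x" f] assms
  by (simp add: norm_diff_commute[of f g])

lemma norm_eq_in: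
  "f \<in> elems X \<Longrightarrow> g \<in> elems X \<Longrightarrow> eq_in X f g \<Longrightarrow> snorm X f = snorm X g"
  using norm_diff_ge[of f g] by (simp add: eq_in_def)

lemma eq_in_sym: "f \<in> elems X \<Longrightarrow> g \<in> elems X \<Longrightarrow> eq_in X f g \<Longrightarrow> eq_in X g f"
  using norm_diff_commute[of f g] by (simp add: eq_in_def)

lemma eq_in_refl [simp]: "eq_in X f f"
  by (simp add: eq_in_def)

lemma eq_in_trans:
  assumes "f \<in> elems X" "g \<in> elems X" "h \<in> elems X" "eq_in X f g" "eq_in X g h"
  shows "eq_in X f h"
  using norm_diff_triangle[of f g h] norm_nonneg[of "\<lambda>x. f x - h x"] assms
  by (simp add: eq_in_def del: norm_nonneg)

lemma norm_sum:
  "(\<And>i. i \<in> I \<Longrightarrow> F i \<in> elems X) \<Longrightarrow> snorm X (\<lambda>x. \<Sum>i\<in>I. F i x) \<le> (\<Sum>i\<in>I. snorm X (F i))"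
proof (induction I rule: infinite_finite_induct)
  case (insert i I)
  have "snorm X (\<lambda>x. F i x + (\<Sum>i\<in>I. F i x)) \<le> snorm X (F i) + snorm X (\<lambda>x. \<Sum>i\<in>I. F i x)"
    using insert.prems by (intro norm_triangle sum_in) auto
  then show ?case using insert by fastforce
qed auto

lemma exact_linear_diff:
  assumes "exact_linear X Y T" "f \<in> elems X" "g \<in> elems X"
  shows "T (\<lambda>x. f x - g x) = (\<lambda>y. T f y - T g y)"
  using exact_linear_add[OF assms(1,2) minus_in[OF assms(3)]]
    exact_linear_scale[OF assms(1) assms(3), of "-1"] by simp

lemma exact_linear_sum:
  assumes "exact_linear X Y T" "\<And>i. i \<in> I \<Longrightarrow> F i \<in> elems X"
  shows "T (\<lambda>x. \<Sum>i\<in>I. F i x) = (\<lambda>y. \<Sum>i\<in>I. T (F i) y)"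
  using assms(2)
proof (induction I rule: infinite_finite_induct)
  case (insert i I)
  have "T (\<lambda>x. F i x + (\<Sum>i\<in>I. F i x)) = (\<lambda>y. T (F i) y + T (\<lambda>x. \<Sum>i\<in>I. F i x) y)"
    using insert.prems by (intro exact_linear_add[OF assms(1)] sum_in) auto
  moreover have "T (\<lambda>x. \<Sum>i\<in>I. F i x) = (\<lambda>y. \<Sum>i\<in>I. T (F i) y)"
    using insert.prems by (intro insert.IH) auto
  ultimately show ?case using insert.hyps by simp
qed (use exact_linear_scale[OF assms(1) zero_in, of 0] in auto)

section \<open>Limits of sequences and strong limits of operators\<close>

lemma limit_unique:
  assumes "\<And>n. F n \<in> elems X" "g \<in> elems X" "h \<in> elems X"
    and "(\<lambda>n. snorm X (\<lambda>x. F n x - g x)) \<longlonglongrightarrow> 0"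
    and "(\<lambda>n. snorm X (\<lambda>x. F n x - h x)) \<longlonglongrightarrow> 0"
  shows "eq_in X g h"
proof -
  have "snorm X (\<lambda>x. g x - h x) \<le> snorm X (\<lambda>x. F n x - g x) + snorm X (\<lambda>x. F n x - h x)" for n
    using norm_diff_triangle[of g "F n" h] norm_diff_commute[of g "F n"] assms by simp
  moreover have "(\<lambda>n. snorm X (\<lambda>x. F n x - g x) + snorm X (\<lambda>x. F n x - h x)) \<longlonglongrightarrow> 0"
    using tendsto_add[OF assms(4,5)] by simp
  ultimately have "snorm X (\<lambda>x. g x - h x) \<le> 0"
    by (intro tendsto_lowerbound[of _ 0 sequentially]) auto
  then show ?thesis
    using norm_nonneg[of "\<lambda>x. g x - h x"] assms by (simp add: eq_in_def del: norm_nonneg)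
qed

lemma limit_add:
  assumes "\<And>n. F n \<in> elems X" "\<And>n. G n \<in> elems X" "g \<in> elems X" "h \<in> elems X"
    and "(\<lambda>n. snorm X (\<lambda>x. F n x - g x)) \<longlonglongrightarrow> 0"
    and "(\<lambda>n. snorm X (\<lambda>x. G n x - h x)) \<longlonglongrightarrow> 0"
  shows "(\<lambda>n. snorm X (\<lambda>x. (F n x + G n x) - (g x + h x))) \<longlonglongrightarrow> 0"
proof (rule tendsto_zero_le)
  show "(\<lambda>n. snorm X (\<lambda>x. F n x - g x) + snorm X (\<lambda>x. G n x - h x)) \<longlonglongrightarrow> 0"
    using tendsto_add[OF assms(5,6)] by simp
  fix n
  show "0 \<le> snorm X (\<lambda>x. (F n x + G n x) - (g x + h x))"
    using assms by simp
  show "snorm X (\<lambda>x. (F n x + G n x) - (g x + h x)) \<le>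
      snorm X (\<lambda>x. F n x - g x) + snorm X (\<lambda>x. G n x - h x)"
    using norm_triangle[of "\<lambda>x. F n x - g x" "\<lambda>x. G n x - h x"] assms
    by (simp add: algebra_simps)
qed

lemma limit_scale:
  assumes "\<And>n. F n \<in> elems X" "g \<in> elems X"
    and "(\<lambda>n. snorm X (\<lambda>x. F n x - g x)) \<longlonglongrightarrow> 0"
  shows "(\<lambda>n. snorm X (\<lambda>x. c * F n x - c * g x)) \<longlonglongrightarrow> 0"
proof -
  have "(\<lambda>n. snorm X (\<lambda>x. c * F n x - c * g x)) = (\<lambda>n. cmod c * snorm X (\<lambda>x. F n x - g x))"
    using assms norm_scale[of "\<lambda>x. F _ x - g x" c] by (simp add: algebra_simps)
  then show ?thesis using tendsto_mult_left[OF assms(3), of "cmod c"] by simp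
qed

lemma limit_norm:
  assumes "\<And>n. F n \<in> elems X" "g \<in> elems X"
    and "(\<lambda>n. snorm X (\<lambda>x. F n x - g x)) \<longlonglongrightarrow> 0"
  shows "(\<lambda>n. snorm X (F n)) \<longlonglongrightarrow> snorm X g"
proof -
  have "(\<lambda>n. \<bar>snorm X (F n) - snorm X g\<bar>) \<longlonglongrightarrow> 0"
    by (rule tendsto_zero_le[OF assms(3)]) (use norm_diff_ge assms in auto)
  then show ?thesis
    using LIM_zero_cancel tendsto_rabs_zero_iff by blast
qed

text \<open>The value \<open>R f\<close> is chosen for each \<open>f\<close> separately among the
  limits of \<open>T n f\<close>. Limits are unique only up to null functions, so the strong limit
  of exactly linear operators is linear merely in the sense of \<open>eq_in\<close>.\<close>

lemma limit_operator:
  fixes Y :: "'b fun_space" and T :: "nat \<Rightarrow> ('b \<Rightarrow> complex) \<Rightarrow> ('a \<Rightarrow> complex)"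
  assumes Y: "complete_fun_space Y" and T: "\<And>n. exact_linear Y X (T n)"
    and C: "\<And>n f. f \<in> elems Y \<Longrightarrow> snorm X (T n f) \<le> C * snorm Y f"
    and Cauchy: "\<And>f e. f \<in> elems Y \<Longrightarrow> e > 0 \<Longrightarrow>
           \<exists>N. \<forall>m\<ge>N. \<forall>n\<ge>m. snorm X (\<lambda>x. T m f x - T n f x) < e"
  obtains R where "bounded_op Y X R" "\<And>f. f \<in> elems Y \<Longrightarrow> R f \<in> elems X"
    "\<And>f. f \<in> elems Y \<Longrightarrow> (\<lambda>n. snorm X (\<lambda>x. T n f x - R f x)) \<longlonglongrightarrow> 0"
proof -
  interpret Y: complete_fun_space Y by fact
  have Tin: "T n f \<in> elems X" if "f \<in> elems Y" for n f
    using exact_linear_in[OF T that] .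
  have "\<forall>f. \<exists>g. f \<in> elems Y \<longrightarrow> g \<in> elems X \<and> (\<lambda>n. snorm X (\<lambda>x. T n f x - g x)) \<longlonglongrightarrow> 0"
    using complete[OF Tin Cauchy] by blast
  then obtain R where R: "\<And>f. f \<in> elems Y \<Longrightarrow> R f \<in> elems X"
    "\<And>f. f \<in> elems Y \<Longrightarrow> (\<lambda>n. snorm X (\<lambda>x. T n f x - R f x)) \<longlonglongrightarrow> 0"
    by metis
  have "eq_in X (R (\<lambda>x. f x + g x)) (\<lambda>y. R f y + R g y)" if "f \<in> elems Y" "g \<in> elems Y" for f g
  proof (rule limit_unique[where F = "\<lambda>n. T n (\<lambda>x. f x + g x)"])
    show "(\<lambda>n. snorm X (\<lambda>x. T n (\<lambda>x. f x + g x) x - (R f x + R g x))) \<longlonglongrightarrow> 0"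
      using limit_add[OF Tin Tin R(1) R(1) R(2) R(2), OF that(1,2,1,2,1,2)]
      by (simp add: exact_linear_add[OF T that])
  qed (use R Tin that in auto)
  moreover have "eq_in X (R (\<lambda>x. c * f x)) (\<lambda>y. c * R f y)" if "f \<in> elems Y" for f c
  proof (rule limit_unique[where F = "\<lambda>n. T n (\<lambda>x. c * f x)"])
    show "(\<lambda>n. snorm X (\<lambda>x. T n (\<lambda>x. c * f x) x - c * R f x)) \<longlonglongrightarrow> 0"
      using limit_scale[OF Tin R(1) R(2), OF that that that]
      by (simp add: exact_linear_scale[OF T that])
  qed (use R Tin that in auto)
  moreover have "snorm X (R f) \<le> C * snorm Y f" if "f \<in> elems Y" for f
    using limit_norm[OF Tin R(1) R(2), OF that that that] C[OF that]
    by (intro tendsto_upperbound[of _ "snorm X (R f)" sequentially]) auto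
  ultimately have "bounded_op Y X R"
    using R(1) unfolding bounded_op_def linear_op_def by blast
  with that R show thesis by blast
qed

section \<open>Geometric series of a contraction\<close>

lemma funpow_contraction:
  assumes T: "exact_linear X X T" and c: "\<And>f. f \<in> elems X \<Longrightarrow> snorm X (T f) \<le> \<rho> * snorm X f"
    and "0 \<le> \<rho>" "f \<in> elems X"
  shows "snorm X ((T ^^ k) f) \<le> \<rho> ^ k * snorm X f"
proof (induction k)
  case (Suc k)
  have "snorm X (T ((T ^^ k) f)) \<le> \<rho> * snorm X ((T ^^ k) f)"
    by (rule c[OF exact_linear_in[OF exact_linear_funpow[OF T] \<open>f \<in> elems X\<close>]])
  also have "\<dots> \<le> \<rho> * (\<rho> ^ k * snorm X f)"
    using Suc \<open>0 \<le> \<rho>\<close> by (intro mult_left_mono) auto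
  finally show ?case by simp
qed auto

text \<open>\<open>R\<close> is the strong limit of the partial sums of the powers of
  \<open>T\<close>, a two-sided inverse of \<open>1 - T\<close> up to null functions. Exact
  linearity of \<open>T\<close> makes both telescoping identities hold at every point.\<close>

lemma neumann_series:
  assumes T: "exact_linear X X T" and c: "\<And>f. f \<in> elems X \<Longrightarrow> snorm X (T f) \<le> \<rho> * snorm X f"
    and \<rho>: "0 \<le> \<rho>" "\<rho> < 1"
  obtains R where "bounded_op X X R" "\<And>f. f \<in> elems X \<Longrightarrow> R f \<in> elems X"
    "\<And>f. f \<in> elems X \<Longrightarrow> eq_in X (R (\<lambda>x. f x - T f x)) f"
    "\<And>f. f \<in> elems X \<Longrightarrow> eq_in X (\<lambda>x. R f x - T (R f) x) f"
proof -
  define N where "N n f = (\<lambda>x. \<Sum>k<n. (T ^^ k) f x)" for n f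
  have Tk: "(T ^^ k) f \<in> elems X" if "f \<in> elems X" for k f
    using exact_linear_in[OF exact_linear_funpow[OF T] that] .
  have N: "exact_linear X X (N n)" for n
    unfolding N_def using Tk
    by (intro exact_linearI)
       (auto simp: exact_linear_add[OF exact_linear_funpow[OF T]]
          exact_linear_scale[OF exact_linear_funpow[OF T]] sum.distrib sum_distrib_left)
  have geo: "(\<Sum>k\<in>{m..<n}. \<rho> ^ k) \<le> \<rho> ^ m / (1 - \<rho>)" for m n
  proof (cases "m \<le> n")
    case True
    then have "(\<Sum>k\<in>{m..<n}. \<rho> ^ k) * (1 - \<rho>) = \<rho> ^ m - \<rho> ^ n"
    proof (induction n rule: dec_induct)
      case (step n)
      then have "(\<Sum>k\<in>{m..<Suc n}. \<rho> ^ k) = (\<Sum>k\<in>{m..<n}. \<rho> ^ k) + \<rho> ^ n"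
        by simp
      then show ?case using step.IH by (simp only: algebra_simps power_Suc)
    qed simp
    then have "(\<Sum>k\<in>{m..<n}. \<rho> ^ k) * (1 - \<rho>) \<le> \<rho> ^ m"
      using \<rho> by simp
    then show ?thesis using \<rho> by (subst pos_le_divide_eq) auto
  qed (use \<rho> in auto)
  have diffN: "snorm X (\<lambda>x. N m f x - N n f x) \<le> \<rho> ^ m / (1 - \<rho>) * snorm X f"
    if f: "f \<in> elems X" and mn: "m \<le> n" for f m n
  proof -
    have "(\<lambda>x. N n f x - N m f x) = (\<lambda>x. \<Sum>k\<in>{m..<n}. (T ^^ k) f x)"
      unfolding N_def using mn
      by (simp add: sum_diff_nat_ivl flip: atLeast0LessThan)
    then have "snorm X (\<lambda>x. N m f x - N n f x) \<le> (\<Sum>k\<in>{m..<n}. snorm X ((T ^^ k) f))"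
      using norm_sum[of "{m..<n}" "\<lambda>k. (T ^^ k) f"] norm_diff_commute[of "N m f" "N n f"]
        Tk[OF f] exact_linear_in[OF N f] by simp
    also have "\<dots> \<le> (\<Sum>k\<in>{m..<n}. \<rho> ^ k * snorm X f)"
      by (intro sum_mono funpow_contraction[OF T c \<rho>(1) f])
    also have "\<dots> \<le> \<rho> ^ m / (1 - \<rho>) * snorm X f"
      unfolding sum_distrib_right[symmetric] using geo[of m n] f by (intro mult_right_mono) auto
    finally show ?thesis .
  qed
  have pow0: "(\<lambda>n. \<rho> ^ n * c) \<longlonglongrightarrow> 0" for c
    using tendsto_mult_left_zero[OF LIMSEQ_realpow_zero[OF \<rho>]] by auto
  obtain R where R: "bounded_op X X R" "\<And>f. f \<in> elems X \<Longrightarrow> R f \<in> elems X"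
    "\<And>f. f \<in> elems X \<Longrightarrow> (\<lambda>n. snorm X (\<lambda>x. N n f x - R f x)) \<longlonglongrightarrow> 0"
  proof (rule limit_operator[OF complete_fun_space_axioms N, where C = "1 / (1 - \<rho>)"])
    \<comment> \<open>The case \<open>m = 0\<close> of \<open>diffN\<close>, since the empty sum
      \<open>N 0 f\<close> vanishes.\<close>
    show "snorm X (N n f) \<le> 1 / (1 - \<rho>) * snorm X f" if "f \<in> elems X" for n f
      using diffN[OF that, of 0 n] norm_minus[OF exact_linear_in[OF N that]] by (simp add: N_def)
    show "\<exists>M. \<forall>m\<ge>M. \<forall>n\<ge>m. snorm X (\<lambda>x. N m f x - N n f x) < e"
      if f: "f \<in> elems X" and e: "e > 0" for f e
    proof -
      obtain M where M: "\<And>m. m \<ge> M \<Longrightarrow> \<rho> ^ m * (snorm X f / (1 - \<rho>)) < e"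
        using order_tendstoD(2)[OF pow0 e] unfolding eventually_sequentially by blast
      have "snorm X (\<lambda>x. N m f x - N n f x) < e" if "m \<ge> M" "n \<ge> m" for m n
        using le_less_trans[OF _ M[OF that(1)]] diffN[OF f that(2)] by simp
      then show ?thesis by blast
    qed
  qed blast
  have NT: "(\<lambda>x. N n f x - T (N n f) x) = (\<lambda>x. f x - (T ^^ n) f x)" if "f \<in> elems X" for f n
  proof -
    have "T (N n f) = (\<lambda>x. \<Sum>k<n. (T ^^ Suc k) f x)"
      unfolding N_def using exact_linear_sum[OF T Tk[OF that]] by simp
    then show ?thesis
      unfolding N_def using sum_lessThan_telescope'[of "\<lambda>k. (T ^^ k) f _" n]
      by (simp add: sum_subtractf fun_eq_iff)
  qed
  have NT': "N n (\<lambda>x. f x - T f x) = (\<lambda>x. f x - (T ^^ n) f x)" if "f \<in> elems X" for f n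
  proof -
    have "(T ^^ k) (\<lambda>x. f x - T f x) = (\<lambda>x. (T ^^ k) f x - (T ^^ Suc k) f x)" for k
      using exact_linear_diff[OF exact_linear_funpow[OF T] that exact_linear_in[OF T that]]
      by (simp add: funpow_swap1)
    then show ?thesis
      unfolding N_def using sum_lessThan_telescope'[of "\<lambda>k. (T ^^ k) f _" n]
      by (simp add: fun_eq_iff)
  qed
  have Tn0: "(\<lambda>n. snorm X ((T ^^ n) f)) \<longlonglongrightarrow> 0" if "f \<in> elems X" for f
    by (rule tendsto_zero_le[OF pow0]) (use Tk that funpow_contraction[OF T c \<rho>(1) that] in auto)
  have lim: "(\<lambda>n. snorm X (\<lambda>x. (f x - (T ^^ n) f x) - f x)) \<longlonglongrightarrow> 0" if "f \<in> elems X" for f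
    using Tn0[OF that] norm_minus[OF Tk[OF that]] by simp
  have "eq_in X (R (\<lambda>x. f x - T f x)) f" if f: "f \<in> elems X" for f
  proof (rule limit_unique)
    have g: "(\<lambda>x. f x - T f x) \<in> elems X" using f exact_linear_in[OF T f] by simp
    show "N n (\<lambda>x. f x - T f x) \<in> elems X" for n using exact_linear_in[OF N g] .
    show "(\<lambda>n. snorm X (\<lambda>x. N n (\<lambda>x. f x - T f x) x - R (\<lambda>x. f x - T f x) x)) \<longlonglongrightarrow> 0"
      by (rule R(3)[OF g])
    show "R (\<lambda>x. f x - T f x) \<in> elems X" by (rule R(2)[OF g])
    show "(\<lambda>n. snorm X (\<lambda>x. N n (\<lambda>x. f x - T f x) x - f x)) \<longlonglongrightarrow> 0"
      using lim[OF f] by (simp add: NT'[OF f])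
  qed fact
  moreover have "eq_in X (\<lambda>x. R f x - T (R f) x) f" if f: "f \<in> elems X" for f
  proof (rule limit_unique)
    have Nf: "N n f \<in> elems X" for n using exact_linear_in[OF N f] .
    have Rf: "R f \<in> elems X" by (rule R(2)[OF f])
    note TN = exact_linear_in[OF T Nf] and TR = exact_linear_in[OF T Rf]
    show "(\<lambda>x. N n f x - T (N n f) x) \<in> elems X" for n using Nf TN by simp
    show "(\<lambda>x. R f x - T (R f) x) \<in> elems X" using Rf TR by simp
    show "(\<lambda>n. snorm X (\<lambda>x. N n f x - T (N n f) x - f x)) \<longlonglongrightarrow> 0"
      using lim[OF f] by (simp add: fun_cong[OF NT[OF f]])
    \<comment> \<open>The operator \<open>1 - T\<close> has norm at most \<open>1 + \<rho>\<close>,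
      so it may be applied to the convergence of \<open>N n f\<close>.\<close>
    show "(\<lambda>n. snorm X (\<lambda>x. N n f x - T (N n f) x - (R f x - T (R f) x))) \<longlonglongrightarrow> 0"
    proof (rule tendsto_zero_le)
      show "(\<lambda>n. (1 + \<rho>) * snorm X (\<lambda>x. N n f x - R f x)) \<longlonglongrightarrow> 0"
        using tendsto_mult_left[OF R(3)[OF f], of "1 + \<rho>"] by simp
      fix n
      show "0 \<le> snorm X (\<lambda>x. N n f x - T (N n f) x - (R f x - T (R f) x))"
        using Nf TN TR Rf by simp
      have "(\<lambda>x. N n f x - T (N n f) x - (R f x - T (R f) x)) =
            (\<lambda>x. (N n f x - R f x) - T (\<lambda>x. N n f x - R f x) x)"
        by (simp add: exact_linear_diff[OF T Nf Rf] fun_eq_iff)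
      then show "snorm X (\<lambda>x. N n f x - T (N n f) x - (R f x - T (R f) x)) \<le>
          (1 + \<rho>) * snorm X (\<lambda>x. N n f x - R f x)"
        using norm_diff_le[of "\<lambda>x. N n f x - R f x" "T (\<lambda>x. N n f x - R f x)"]
          c[of "\<lambda>x. N n f x - R f x"] Nf Rf exact_linear_in[OF T, of "\<lambda>x. N n f x - R f x"]
        by (simp add: algebra_simps)
    qed
  qed fact
  ultimately show thesis using that R by blast
qed

end

section \<open>Polar decomposition by a binomial series\<close>

locale semi_hilbert = complete_fun_space X for X :: "'a fun_space" +
  fixes ip :: "('a \<Rightarrow> complex) \<Rightarrow> ('a \<Rightarrow> complex) \<Rightarrow> complex"
  assumes ip_add_left: "\<And>f g h. f \<in> elems X \<Longrightarrow> g \<in> elems X \<Longrightarrow> h \<in> elems X \<Longrightarrow>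
            ip (\<lambda>x. f x + g x) h = ip f h + ip g h"
    and ip_scale_left: "\<And>c f h. f \<in> elems X \<Longrightarrow> h \<in> elems X \<Longrightarrow> ip (\<lambda>x. c * f x) h = c * ip f h"
    and ip_cnj: "\<And>f g. f \<in> elems X \<Longrightarrow> g \<in> elems X \<Longrightarrow> ip g f = cnj (ip f g)"
    and ip_self: "\<And>f. f \<in> elems X \<Longrightarrow> ip f f = of_real ((snorm X f)\<^sup>2)"
begin

lemma ip_minus_left:
  "f \<in> elems X \<Longrightarrow> h \<in> elems X \<Longrightarrow> ip (\<lambda>x. - f x) h = - ip f h"
  using ip_scale_left[of f h "-1"] by simp

lemma ip_diff_left:
  "f \<in> elems X \<Longrightarrow> g \<in> elems X \<Longrightarrow> h \<in> elems X \<Longrightarrow> ip (\<lambda>x. f x - g x) h = ip f h - ip g h"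
  using ip_add_left[of f "\<lambda>x. - g x" h] by (simp add: ip_minus_left)

lemma ip_add_right:
  "f \<in> elems X \<Longrightarrow> g \<in> elems X \<Longrightarrow> h \<in> elems X \<Longrightarrow> ip h (\<lambda>x. f x + g x) = ip h f + ip h g"
  using ip_cnj[of "\<lambda>x. f x + g x" h] ip_cnj[of f h] ip_cnj[of g h] by (simp add: ip_add_left)

lemma ip_scale_right:
  "f \<in> elems X \<Longrightarrow> h \<in> elems X \<Longrightarrow> ip h (\<lambda>x. c * f x) = cnj c * ip h f"
  using ip_cnj[of "\<lambda>x. c * f x" h] ip_cnj[of f h] by (simp add: ip_scale_left)

lemma ip_diff_right:
  "f \<in> elems X \<Longrightarrow> g \<in> elems X \<Longrightarrow> h \<in> elems X \<Longrightarrow> ip h (\<lambda>x. f x - g x) = ip h f - ip h g"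
  using ip_cnj[of "\<lambda>x. f x - g x" h] ip_cnj[of f h] ip_cnj[of g h] by (simp add: ip_diff_left)

lemma ip_zero_left [simp]: "h \<in> elems X \<Longrightarrow> ip (\<lambda>x. 0) h = 0"
  using ip_scale_left[OF zero_in, of h 0] by simp

lemma ip_sum_left:
  "(\<And>i. i \<in> I \<Longrightarrow> F i \<in> elems X) \<Longrightarrow> h \<in> elems X \<Longrightarrow>
     ip (\<lambda>x. \<Sum>i\<in>I. F i x) h = (\<Sum>i\<in>I. ip (F i) h)"
  by (induction I rule: infinite_finite_induct) (simp_all add: ip_add_left)

lemma ip_sum_right:
  assumes "\<And>i. i \<in> I \<Longrightarrow> F i \<in> elems X" "h \<in> elems X"
  shows "ip h (\<lambda>x. \<Sum>i\<in>I. F i x) = (\<Sum>i\<in>I. ip h (F i))"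
proof -
  have "ip h (\<lambda>x. \<Sum>i\<in>I. F i x) = cnj (\<Sum>i\<in>I. ip (F i) h)"
    using assms ip_cnj[of "\<lambda>x. \<Sum>i\<in>I. F i x" h] by (simp add: ip_sum_left)
  also have "\<dots> = (\<Sum>i\<in>I. ip h (F i))"
    unfolding cnj_sum by (intro sum.cong refl ip_cnj[symmetric]) (use assms in auto)
  finally show ?thesis .
qed

lemma Re_ip_self: "f \<in> elems X \<Longrightarrow> Re (ip f f) = (snorm X f)\<^sup>2"
  by (simp add: ip_self)

lemma norm_add_sq:
  assumes "f \<in> elems X" "g \<in> elems X"
  shows "(snorm X (\<lambda>x. f x + g x))\<^sup>2 = (snorm X f)\<^sup>2 + 2 * Re (ip f g) + (snorm X g)\<^sup>2"
  using assms ip_cnj[of f g]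
  by (simp add: Re_ip_self[symmetric] ip_add_left ip_add_right del: of_real_power)

lemma norm_diff_sq:
  assumes "f \<in> elems X" "g \<in> elems X"
  shows "(snorm X (\<lambda>x. f x - g x))\<^sup>2 = (snorm X f)\<^sup>2 - 2 * Re (ip f g) + (snorm X g)\<^sup>2"
  using assms ip_cnj[of f g]
  by (simp add: Re_ip_self[symmetric] ip_diff_left ip_diff_right del: of_real_power)

text \<open>Expand the squared norm of \<open>f - t <f, g> g\<close> for real \<open>t\<close>. The
  choice \<open>t = 1 / ||g||^2\<close> gives the inequality; for a null function \<open>g\<close>,
  letting \<open>t\<close> grow forces \<open><f, g> = 0\<close>.\<close>

lemma Cauchy_Schwarz:
  assumes f: "f \<in> elems X" and g: "g \<in> elems X"
  shows "cmod (ip f g) \<le> snorm X f * snorm X g"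
proof -
  have *: "2 * t * (cmod (ip f g))\<^sup>2 \<le> (snorm X f)\<^sup>2 + t\<^sup>2 * (cmod (ip f g))\<^sup>2 * (snorm X g)\<^sup>2" for t
  proof -
    define c where "c = of_real t * ip f g"
    have "0 \<le> (snorm X (\<lambda>x. f x - c * g x))\<^sup>2" by simp
    also have "\<dots> = (snorm X f)\<^sup>2 - 2 * Re (cnj c * ip f g) + (cmod c * snorm X g)\<^sup>2"
      using f g by (simp add: norm_diff_sq ip_scale_right norm_scale)
    also have "Re (cnj c * ip f g) = t * (cmod (ip f g))\<^sup>2"
      unfolding c_def cmod_power2 by (simp add: power2_eq_square algebra_simps)
    finally show ?thesis
      by (simp add: c_def norm_mult power_mult_distrib)
  qed
  have sq: "(cmod (ip f g))\<^sup>2 \<le> (snorm X f * snorm X g)\<^sup>2"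
  proof (cases "snorm X g = 0")
    case True
    have "(cmod (ip f g))\<^sup>2 \<le> 0"
    proof (rule ccontr)
      assume pos: "\<not> (cmod (ip f g))\<^sup>2 \<le> 0"
      \<comment> \<open>Chosen so that \<open>t * (cmod (ip f g))\<^sup>2\<close> exceeds the
        squared norm of \<open>f\<close> by 1.\<close>
      define t where "t = ((snorm X f)\<^sup>2 + 1) / (cmod (ip f g))\<^sup>2"
      have "2 * (t * (cmod (ip f g))\<^sup>2) \<le> (snorm X f)\<^sup>2"
        using *[of t] True by (simp add: mult.assoc)
      moreover have "t * (cmod (ip f g))\<^sup>2 = (snorm X f)\<^sup>2 + 1"
        using pos by (simp add: t_def)
      ultimately show False using zero_le_power2[of "snorm X f"] by linarith
    qed
    then show ?thesis using True by simp
  next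
    case False
    define G where "G = (snorm X g)\<^sup>2"
    have G: "G > 0" using False by (simp add: G_def)
    have "(1 / G)\<^sup>2 * (cmod (ip f g))\<^sup>2 * G = (cmod (ip f g))\<^sup>2 / G"
      using G by (simp add: power2_eq_square)
    then have "(cmod (ip f g))\<^sup>2 / G \<le> (snorm X f)\<^sup>2"
      using *[of "1 / G"] unfolding G_def[symmetric] by simp
    then show ?thesis using G by (simp add: pos_divide_le_eq power_mult_distrib G_def)
  qed
  show ?thesis using power2_le_imp_le[OF sq] f g by simp
qed

lemma limit_ip:
  assumes "\<And>n. F n \<in> elems X" "f \<in> elems X" "g \<in> elems X"
    and "(\<lambda>n. snorm X (\<lambda>x. F n x - f x)) \<longlonglongrightarrow> 0"
  shows "(\<lambda>n. ip (F n) g) \<longlonglongrightarrow> ip f g"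
proof -
  have "(\<lambda>n. cmod (ip (F n) g - ip f g)) \<longlonglongrightarrow> 0"
  proof (rule tendsto_zero_le)
    show "(\<lambda>n. snorm X (\<lambda>x. F n x - f x) * snorm X g) \<longlonglongrightarrow> 0"
      using tendsto_mult_left_zero[OF assms(4)] .
    show "cmod (ip (F n) g - ip f g) \<le> snorm X (\<lambda>x. F n x - f x) * snorm X g" for n
      using Cauchy_Schwarz[of "\<lambda>x. F n x - f x" g] assms by (simp add: ip_diff_left)
  qed auto
  then show ?thesis
    using LIM_zero_cancel tendsto_norm_zero_iff by blast
qed

end

section \<open>Coefficients of the binomial series of (1 - b)^(-1/2)\<close>

definition isqrt_coeff :: "nat \<Rightarrow> real" where
  "isqrt_coeff k = (-1) ^ k * ((- 1 / 2) gchoose k)"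

lemma isqrt_coeff_nonneg: "0 \<le> isqrt_coeff k"
proof -
  have "(-1) ^ k * (\<Prod>i<k. - 1 / 2 - real i) = (\<Prod>i<k. 1 / 2 + real i)"
    by (induction k) (auto simp: algebra_simps)
  then have "isqrt_coeff k = (\<Prod>i<k. 1 / 2 + real i) / fact k"
    by (simp add: isqrt_coeff_def gbinomial_prod_rev atLeast0LessThan)
  then show ?thesis by (simp add: prod_nonneg)
qed

text \<open>The square of the series of (1 - b)^(-1/2) is the geometric series; in coefficients this
  is Vandermonde's identity for -1/2 + -1/2 = -1.\<close>

lemma isqrt_coeff_convolution: "(\<Sum>i\<le>k. isqrt_coeff i * isqrt_coeff (k - i)) = 1"
proof -
  have "(\<Sum>i\<le>k. isqrt_coeff i * isqrt_coeff (k - i)) =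
        (\<Sum>i\<le>k. (-1) ^ k * (((- 1 / 2) gchoose i) * ((- 1 / 2 :: real) gchoose (k - i))))"
    unfolding isqrt_coeff_def
    by (intro sum.cong refl) (simp add: algebra_simps flip: power_add)
  also have "\<dots> = (-1) ^ k * ((- 1 / 2 + - 1 / 2 :: real) gchoose k)"
    unfolding sum_distrib_left[symmetric]
    by (subst gbinomial_Vandermonde[symmetric]) (simp add: atMost_atLeast0)
  also have "\<dots> = 1"
    using gbinomial_minus[of "1 :: real" k] by (simp add: gbinomial_of_nat_symmetric flip: power_mult_distrib)
  finally show ?thesis .
qed

text \<open>With \<open>\<mu> k = \<langle>B\<^sup>k g, g\<rangle>\<close> the double sum is \<open>\<langle>(1 - B) q\<^sub>m(B) q\<^sub>n(B) g, g\<rangle>\<close>, where \<open>q\<^sub>n(b)\<close>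
  is the \<open>n\<close>-th partial sum of the series of \<open>(1 - b)\<^sup>-\<^sup>1\<^sup>/\<^sup>2\<close>.\<close>

lemma isqrt_double_sum_bounds:
  fixes \<mu> :: "nat \<Rightarrow> real"
  assumes dec: "\<And>k. \<mu> (Suc k) \<le> \<mu> k" and pos: "\<And>k. 0 \<le> \<mu> k" and mn: "m \<le> n"
  defines "D \<equiv> (\<Sum>i<m. \<Sum>j<n. isqrt_coeff i * isqrt_coeff j * (\<mu> (i + j) - \<mu> (i + j + 1)))"
  shows "\<mu> 0 - \<mu> m \<le> D" "D \<le> \<mu> 0"
proof -
  define G where "G = (\<lambda>(i, j). isqrt_coeff i * isqrt_coeff j * (\<mu> (i + j) - \<mu> (i + j + 1)))"
  have G: "0 \<le> G p" for p
    using dec by (auto simp: G_def isqrt_coeff_nonneg split: prod.split)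
  \<comment> \<open>On a triangle, summing along the diagonals brings in the convolution, which is
    1, and the differences of \<open>\<mu>\<close> telescope.\<close>
  have tri: "(\<Sum>p\<in>{(i, j). i + j < N}. G p) = \<mu> 0 - \<mu> N" for N
  proof -
    have "(\<Sum>p\<in>{(i, j). i + j < N}. G p) = (\<Sum>k<N. \<Sum>i\<le>k. G (i, k - i))"
      using sum.triangle_reindex[of "\<lambda>i j. G (i, j)" N] by simp
    also have "\<dots> = (\<Sum>k<N. (\<Sum>i\<le>k. isqrt_coeff i * isqrt_coeff (k - i)) * (\<mu> k - \<mu> (Suc k)))"
      unfolding G_def by (intro sum.cong refl) (auto simp: sum_distrib_right)
    also have "\<dots> = \<mu> 0 - \<mu> N"
      by (simp add: isqrt_coeff_convolution sum_lessThan_telescope')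
    finally show ?thesis .
  qed
  have D: "D = (\<Sum>p\<in>{..<m} \<times> {..<n}. G p)"
    by (simp add: D_def G_def sum.cartesian_product)
  have fin: "finite {(i, j). i + j < (N :: nat)}" for N
    by (rule finite_subset[of _ "{..<N} \<times> {..<N}"]) auto
  \<comment> \<open>As \<open>m \<le> n\<close>, the rectangle of indices lies between the triangles
    of sides \<open>m\<close> and \<open>m + n\<close>, and all entries are nonnegative.\<close>
  have "(\<Sum>p\<in>{(i, j). i + j < m}. G p) \<le> D"
    unfolding D by (rule sum_mono2) (use G mn in auto)
  then show "\<mu> 0 - \<mu> m \<le> D" by (simp add: tri)
  have "D \<le> (\<Sum>p\<in>{(i, j). i + j < m + n}. G p)"
    unfolding D by (rule sum_mono2[OF fin]) (use G in auto)
  then show "D \<le> \<mu> 0" using pos[of "m + n"] by (simp add: tri)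
qed

text \<open>Injectivity of the adjoint \<open>A\<close> expresses that the range of \<open>V\<close>
  is dense; it is what makes the polar isometry of \<open>V\<close> surjective. \<open>K\<close>
  bounds the squared norm of \<open>V\<close>, and so the norm of \<open>A V\<close>.\<close>

locale adjoint_pair = X: semi_hilbert X ipX + Y: semi_hilbert Y ipY
  for X :: "'a fun_space" and ipX and Y :: "'b fun_space" and ipY +
  fixes V :: "('a \<Rightarrow> complex) \<Rightarrow> ('b \<Rightarrow> complex)" and A :: "('b \<Rightarrow> complex) \<Rightarrow> ('a \<Rightarrow> complex)"
    and K :: real
  assumes V: "exact_linear X Y V" and A: "exact_linear Y X A"
    and adjoint: "\<And>f h. f \<in> elems X \<Longrightarrow> h \<in> elems Y \<Longrightarrow> ipY (V f) h = ipX f (A h)"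
    and K: "K > 0" and V_bound: "\<And>f. f \<in> elems X \<Longrightarrow> (snorm Y (V f))\<^sup>2 \<le> K * (snorm X f)\<^sup>2"
    and V_inj: "\<And>f. f \<in> elems X \<Longrightarrow> snorm Y (V f) = 0 \<Longrightarrow> snorm X f = 0"
    and A_inj: "\<And>h. h \<in> elems Y \<Longrightarrow> snorm X (A h) = 0 \<Longrightarrow> snorm Y h = 0"
begin

lemmas V_in [simp] = exact_linear_in[OF V]
lemmas A_in [simp] = exact_linear_in[OF A]

text \<open>The squared norm of \<open>A h\<close> is \<open><V A h, h>\<close>. Cauchy-Schwarz and
  the bound of \<open>V\<close> at \<open>A h\<close> leave one factor \<open>||A h||^2\<close> to
  cancel.\<close>

lemma A_bound: "h \<in> elems Y \<Longrightarrow> (snorm X (A h))\<^sup>2 \<le> K * (snorm Y h)\<^sup>2"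
proof -
  assume h: "h \<in> elems Y"
  let ?a = "snorm X (A h)"
  have "?a\<^sup>2 = Re (ipY (V (A h)) h)"
    using h by (simp add: adjoint X.Re_ip_self)
  also have "\<dots> \<le> snorm Y (V (A h)) * snorm Y h"
    using Y.Cauchy_Schwarz[of "V (A h)" h] complex_Re_le_cmod[of "ipY (V (A h)) h"] h by simp
  finally have le: "?a\<^sup>2 \<le> snorm Y (V (A h)) * snorm Y h" .
  have "?a\<^sup>2 * ?a\<^sup>2 \<le> (snorm Y (V (A h)) * snorm Y h) * (snorm Y (V (A h)) * snorm Y h)"
    by (rule mult_mono[OF le le]) (use h in auto)
  also have "\<dots> = (snorm Y (V (A h)))\<^sup>2 * (snorm Y h)\<^sup>2"
    by (simp add: power2_eq_square)
  also have "\<dots> \<le> (K * ?a\<^sup>2) * (snorm Y h)\<^sup>2"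
    using V_bound[of "A h"] h by (intro mult_right_mono) auto
  finally have le: "?a\<^sup>2 * ?a\<^sup>2 \<le> ?a\<^sup>2 * (K * (snorm Y h)\<^sup>2)"
    by (simp add: mult_ac)
  show ?thesis
  proof (cases "?a = 0")
    case False
    then have "0 < ?a\<^sup>2" by simp
    then show ?thesis using le by (rule mult_le_cancel_left_pos[THEN iffD1])
  qed (use K in auto)
qed

text \<open>By this symmetry every statement about the approximants of the polar factor of
  \<open>V\<close> also holds for \<open>A\<close>, which supplies the inverse of the polar
  factor.\<close>

lemma adjoint_pair_swap: "adjoint_pair Y ipY X ipX A V K"
proof (unfold_locales)
  show "ipX (A f) h = ipY f (V h)" if "f \<in> elems Y" "h \<in> elems X" for f h
    using that adjoint[of h f] X.ip_cnj[of "A f" h] Y.ip_cnj[of f "V h"]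
    by (metis A_in V_in complex_cnj_cnj)
qed (use A V K A_bound V_inj A_inj in auto)

definition S where "S f = A (V f)"

lemma S: "exact_linear X X S"
  unfolding S_def by (rule exact_linear_compose[OF V A])

lemmas S_in [simp] = exact_linear_in[OF S]

lemma ip_S: "f \<in> elems X \<Longrightarrow> g \<in> elems X \<Longrightarrow> ipX (S f) g = ipY (V f) (V g)"
  using adjoint[of g "V f"] X.ip_cnj[of g "S f"] Y.ip_cnj[of "V g" "V f"] by (simp add: S_def)

lemma S_selfadjoint: "f \<in> elems X \<Longrightarrow> g \<in> elems X \<Longrightarrow> ipX (S f) g = ipX f (S g)"
  using adjoint[of f "V g"] by (simp add: ip_S) (simp add: S_def)

lemma Re_ip_S: "f \<in> elems X \<Longrightarrow> Re (ipX (S f) f) = (snorm Y (V f))\<^sup>2"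
  by (simp add: ip_S Y.Re_ip_self)

text \<open>This is the operator inequality S^2 <= K S in terms of quadratic forms, as
  \<open>||V f||^2 = <S f, f>\<close>.\<close>

lemma norm_S_sq: "f \<in> elems X \<Longrightarrow> (snorm X (S f))\<^sup>2 \<le> K * (snorm Y (V f))\<^sup>2"
  unfolding S_def using A_bound by simp

definition B where "B f = (\<lambda>x. f x - complex_of_real (1 / K) * S f x)"

lemma B: "exact_linear X X B"
  unfolding B_def
  by (intro exact_linearI)
     (auto simp: exact_linear_add[OF S] exact_linear_scale[OF S] algebra_simps fun_eq_iff
       simp del: of_real_divide)

lemma Bk: "exact_linear X X (B ^^ k)"
  by (rule exact_linear_funpow[OF B])

lemmas B_in [simp] = exact_linear_in[OF B]
lemmas Bk_in [simp] = exact_linear_in[OF Bk]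

lemma B_selfadjoint: "f \<in> elems X \<Longrightarrow> g \<in> elems X \<Longrightarrow> ipX (B f) g = ipX f (B g)"
  unfolding B_def
  by (simp add: X.ip_diff_left X.ip_diff_right X.ip_scale_left X.ip_scale_right S_selfadjoint
      del: of_real_divide)

lemma ip_Bk: "f \<in> elems X \<Longrightarrow> g \<in> elems X \<Longrightarrow> ipX ((B ^^ i) f) ((B ^^ j) g) = ipX ((B ^^ (i + j)) f) g"
proof (induction j arbitrary: i)
  case (Suc j)
  then have "ipX ((B ^^ i) f) ((B ^^ Suc j) g) = ipX ((B ^^ Suc i) f) ((B ^^ j) g)"
    by (simp flip: B_selfadjoint)
  also have "\<dots> = ipX ((B ^^ (i + Suc j)) f) g"
    using Suc.IH[of "Suc i"] Suc.prems by (simp del: funpow.simps)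
  finally show ?case .
qed auto

lemma S_eq_B: "f \<in> elems X \<Longrightarrow> S f = (\<lambda>x. complex_of_real K * (f x - B f x))"
  using K by (simp add: B_def fun_eq_iff)

lemma S_B_commute: "f \<in> elems X \<Longrightarrow> S (B f) = B (S f)"
  unfolding B_def
  by (simp add: X.exact_linear_diff[OF S] exact_linear_scale[OF S] del: of_real_divide)

lemma S_Bk_commute: "f \<in> elems X \<Longrightarrow> S ((B ^^ k) f) = (B ^^ k) (S f)"
  by (induction k) (auto simp: S_B_commute)

text \<open>The moments of the spectral measure of \<open>g\<close> with respect to
  \<open>B\<close>, a measure on [0, 1]; this explains why they decrease and are
  nonnegative.\<close>

definition \<mu> where "\<mu> g k = Re (ipX ((B ^^ k) g) g)"

lemma \<mu>_even: "g \<in> elems X \<Longrightarrow> \<mu> g (2 * j) = (snorm X ((B ^^ j) g))\<^sup>2"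
  unfolding \<mu>_def using ip_Bk[of g g j j, symmetric] by (simp add: X.Re_ip_self mult_2)

lemma Re_ip_B: "f \<in> elems X \<Longrightarrow> Re (ipX (B f) f) = (snorm X f)\<^sup>2 - (snorm Y (V f))\<^sup>2 / K"
  unfolding B_def by (simp add: X.ip_diff_left X.ip_scale_left X.Re_ip_self Re_ip_S del: of_real_divide)

lemma \<mu>_odd:
  assumes g: "g \<in> elems X"
  shows "\<mu> g (Suc (2 * j)) = (snorm X ((B ^^ j) g))\<^sup>2 - (snorm Y (V ((B ^^ j) g)))\<^sup>2 / K"
proof -
  have "\<mu> g (Suc (2 * j)) = Re (ipX (B ((B ^^ j) g)) ((B ^^ j) g))"
    unfolding \<mu>_def using ip_Bk[OF g g, of "Suc j" j] by (simp add: mult_2)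
  then show ?thesis using g by (simp add: Re_ip_B)
qed

text \<open>The right-hand side is \<open><B f, f>\<close>, so this is the inequality B^2 <= B; it
  follows from S^2 <= K S.\<close>

lemma norm_B_sq:
  assumes f: "f \<in> elems X"
  shows "(snorm X (B f))\<^sup>2 \<le> (snorm X f)\<^sup>2 - (snorm Y (V f))\<^sup>2 / K"
proof -
  have "(snorm X (B f))\<^sup>2 = (snorm X f)\<^sup>2 - 2 * ((snorm Y (V f))\<^sup>2 / K) + (snorm X (S f))\<^sup>2 / K\<^sup>2"
    unfolding B_def using f K S_selfadjoint[OF f f, symmetric]
    by (simp add: X.norm_diff_sq X.ip_scale_right X.norm_scale Re_ip_S power_divide norm_mult
        del: of_real_divide)
  also have "(snorm X (S f))\<^sup>2 / K\<^sup>2 \<le> (snorm Y (V f))\<^sup>2 / K"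
    using norm_S_sq[OF f] K by (simp add: field_simps power2_eq_square)
  finally show ?thesis by simp
qed

text \<open>With \<open>j = k div 2\<close>, the drop from an even index is
  \<open>||V (B^j g)||^2 / K\<close>; the drop from an odd index is nonnegative by B^2 <= B at
  \<open>B^j g\<close>.\<close>

lemma \<mu>_dec: "g \<in> elems X \<Longrightarrow> \<mu> g (Suc k) \<le> \<mu> g k"
proof -
  assume g: "g \<in> elems X"
  show ?thesis
  proof (cases "even k")
    case True
    then obtain j where "k = 2 * j" by blast
    then show ?thesis using \<mu>_even[OF g, of j] \<mu>_odd[OF g, of j] K by simp
  next
    case False
    then obtain j where k: "k = Suc (2 * j)" by (metis oddE Suc_eq_plus1)
    have "\<mu> g (Suc k) = (snorm X (B ((B ^^ j) g)))\<^sup>2"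
      using \<mu>_even[OF g, of "Suc j"] k by simp
    then show ?thesis
      using norm_B_sq[of "(B ^^ j) g"] \<mu>_odd[OF g, of j] g k by simp
  qed
qed

text \<open>The moment of index \<open>2 * k\<close> is a squared norm and lies below that of index
  \<open>k\<close>.\<close>

lemma \<mu>_nonneg: "g \<in> elems X \<Longrightarrow> 0 \<le> \<mu> g k"
proof -
  assume g: "g \<in> elems X"
  have "\<mu> g (2 * k) \<le> \<mu> g k"
    using lift_Suc_antimono_le[of "\<mu> g" k "2 * k"] \<mu>_dec[OF g] by simp
  then show ?thesis using \<mu>_even[OF g, of k] zero_le_power2[of "snorm X ((B ^^ k) g)"] by linarith
qed

lemma \<mu>_antimono: "g \<in> elems X \<Longrightarrow> m \<le> n \<Longrightarrow> \<mu> g n \<le> \<mu> g m"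
  using lift_Suc_antimono_le[of "\<mu> g" m n] \<mu>_dec by simp

lemma norm_Bk_diff_sq:
  assumes g: "g \<in> elems X"
  shows "(snorm X (\<lambda>x. (B ^^ m) g x - (B ^^ n) g x))\<^sup>2 = \<mu> g (2 * m) - 2 * \<mu> g (m + n) + \<mu> g (2 * n)"
  using g by (simp add: X.norm_diff_sq \<mu>_even ip_Bk) (simp add: \<mu>_def)

text \<open>The limit of \<open>B\<^sup>n g\<close> is fixed by \<open>B\<close>, hence killed by \<open>V\<close>.\<close>

lemma \<mu>_tendsto_0:
  assumes g: "g \<in> elems X"
  shows "\<mu> g \<longlonglongrightarrow> 0"
proof -
  have "\<exists>l. \<mu> g \<longlonglongrightarrow> l"
    using decseq_convergent[of "\<mu> g" 0] \<mu>_dec[OF g] \<mu>_nonneg[OF g] decseq_SucI by metis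
  then obtain l where l: "\<mu> g \<longlonglongrightarrow> l" by blast
  have le: "l \<le> \<mu> g n" for n
    using decseq_ge[OF _ l] \<mu>_dec[OF g] decseq_SucI by blast
  \<comment> \<open>In the expansion the two squares are at most \<open>\<mu> g m\<close> and the
    mixed term is at least the limit \<open>l\<close>, so the powers of \<open>B\<close> form a
    Cauchy sequence at \<open>g\<close>.\<close>
  have diff: "(snorm X (\<lambda>x. (B ^^ m) g x - (B ^^ n) g x))\<^sup>2 \<le> 2 * (\<mu> g m - l)" if "m \<le> n" for m n
  proof -
    have "\<mu> g (2 * m) \<le> \<mu> g m" "\<mu> g (2 * n) \<le> \<mu> g m"
      using that by (auto intro!: \<mu>_antimono[OF g])
    then show ?thesis
      unfolding norm_Bk_diff_sq[OF g, of m n] using le[of "m + n"] by argo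
  qed
  obtain f where f: "f \<in> elems X" and lim: "(\<lambda>n. snorm X (\<lambda>x. (B ^^ n) g x - f x)) \<longlonglongrightarrow> 0"
  proof (rule bexE[OF X.complete])
    fix e :: real assume "e > 0"
    then have "eventually (\<lambda>n. \<mu> g n < l + e\<^sup>2 / 2) sequentially"
      by (intro order_tendstoD(2)[OF l]) auto
    then obtain N where N: "\<And>n. n \<ge> N \<Longrightarrow> \<mu> g n < l + e\<^sup>2 / 2"
      by (auto simp: eventually_sequentially)
    have "snorm X (\<lambda>x. (B ^^ m) g x - (B ^^ n) g x) < e" if "m \<ge> N" "n \<ge> m" for m n
    proof (rule power2_less_imp_less)
      show "(snorm X (\<lambda>x. (B ^^ m) g x - (B ^^ n) g x))\<^sup>2 < e\<^sup>2"
        using le_less_trans[OF diff[OF that(2)]] N[OF that(1)] by simp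
    qed (use \<open>e > 0\<close> in auto)
    then show "\<exists>N. \<forall>m\<ge>N. \<forall>n\<ge>m. snorm X (\<lambda>x. (B ^^ m) g x - (B ^^ n) g x) < e" by blast
  qed (use g in auto)
  \<comment> \<open>A drop of a convergent sequence, hence it tends to 0; this gives
    \<open>V f = 0\<close> for the limit \<open>f\<close>, and injectivity of \<open>V\<close> makes
    \<open>f\<close> null.\<close>
  have VB: "(snorm Y (V ((B ^^ n) g)))\<^sup>2 = K * (\<mu> g (2 * n) - \<mu> g (Suc (2 * n)))" for n
    using \<mu>_odd[OF g, of n] \<mu>_even[OF g, of n] K by simp
  have sub: "(\<lambda>n. \<mu> g (2 * n)) \<longlonglongrightarrow> l" "(\<lambda>n. \<mu> g (Suc (2 * n))) \<longlonglongrightarrow> l"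
    by (rule LIMSEQ_subseq_LIMSEQ[OF l, unfolded comp_def], auto simp: strict_mono_def)+
  have "(\<lambda>n. (snorm Y (V ((B ^^ n) g)))\<^sup>2) \<longlonglongrightarrow> K * (l - l)"
    unfolding VB by (intro tendsto_intros sub)
  then have V0: "(\<lambda>n. (snorm Y (V ((B ^^ n) g)))\<^sup>2) \<longlonglongrightarrow> 0" by simp
  have "(\<lambda>n. (snorm Y (\<lambda>y. V ((B ^^ n) g) y - V f y))\<^sup>2) \<longlonglongrightarrow> 0"
  proof (rule tendsto_zero_le)
    show "(\<lambda>n. K * (snorm X (\<lambda>x. (B ^^ n) g x - f x))\<^sup>2) \<longlonglongrightarrow> 0"
      using tendsto_mult_left[OF tendsto_power[OF lim, of 2], of K] by simp
    show "(snorm Y (\<lambda>y. V ((B ^^ n) g) y - V f y))\<^sup>2 \<le> K * (snorm X (\<lambda>x. (B ^^ n) g x - f x))\<^sup>2" for n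
      using V_bound[of "\<lambda>x. (B ^^ n) g x - f x"] g f by (simp add: X.exact_linear_diff[OF V])
  qed auto
  then have "(\<lambda>n. snorm Y (\<lambda>y. V ((B ^^ n) g) y - V f y)) \<longlonglongrightarrow> 0"
    by simp
  then have "(\<lambda>n. snorm Y (V ((B ^^ n) g))) \<longlonglongrightarrow> snorm Y (V f)"
    using f g by (intro Y.limit_norm) auto
  moreover have "(\<lambda>n. snorm Y (V ((B ^^ n) g))) \<longlonglongrightarrow> 0" using V0 by simp
  ultimately have "snorm Y (V f) = 0" using LIMSEQ_unique by blast
  then have f0: "snorm X f = 0" using V_inj f by blast
  have "(\<lambda>n. snorm X ((B ^^ n) g)) \<longlonglongrightarrow> 0"
    using X.limit_norm[OF _ f lim] g f0 by simp
  then have "(\<lambda>n. \<mu> g (2 * n)) \<longlonglongrightarrow> 0"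
    using tendsto_power[of "\<lambda>n. snorm X ((B ^^ n) g)" 0 sequentially 2] g by (simp add: \<mu>_even)
  then show ?thesis using sub(1) l LIMSEQ_unique by blast
qed

definition Q where "Q n g = (\<lambda>x. \<Sum>k<n. complex_of_real (isqrt_coeff k) * (B ^^ k) g x)"

lemma Q: "exact_linear X X (Q n)"
  unfolding Q_def
  by (intro exact_linearI)
     (auto simp: exact_linear_add[OF Bk] exact_linear_scale[OF Bk] sum.distrib sum_distrib_left
       algebra_simps)

lemmas Q_in [simp] = exact_linear_in[OF Q]

lemma S_Q_commute: "f \<in> elems X \<Longrightarrow> S (Q n f) = Q n (S f)"
  unfolding Q_def
  by (subst X.exact_linear_sum[OF S]) (simp_all add: exact_linear_scale[OF S] S_Bk_commute)

text \<open>Since \<open>S = K (1 - B)\<close>, each entry \<open><S B^i g, B^j g>\<close> is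
  \<open>K\<close> times a difference of consecutive moments; this is the double sum bounded in
  \<open>isqrt_double_sum_bounds\<close>.\<close>

lemma Re_ip_SQ:
  assumes g: "g \<in> elems X"
  shows "Re (ipY (V (Q m g)) (V (Q n g))) = K * (\<Sum>i<m. \<Sum>j<n.
           isqrt_coeff i * isqrt_coeff j * (\<mu> g (i + j) - \<mu> g (i + j + 1)))"
proof -
  have SQ: "S (Q m g) = (\<lambda>x. \<Sum>i<m. complex_of_real (isqrt_coeff i) * S ((B ^^ i) g) x)"
    unfolding Q_def using g
    by (subst X.exact_linear_sum[OF S]) (simp_all add: exact_linear_scale[OF S])
  have SB: "Re (ipX (S ((B ^^ i) g)) ((B ^^ j) g)) = K * (\<mu> g (i + j) - \<mu> g (i + j + 1))" for i j
  proof -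
    have "ipX (S ((B ^^ i) g)) ((B ^^ j) g)
        = of_real K * (ipX ((B ^^ i) g) ((B ^^ j) g) - ipX ((B ^^ Suc i) g) ((B ^^ j) g))"
      using g by (simp add: S_eq_B X.ip_scale_left X.ip_diff_left)
    then show ?thesis
      using ip_Bk[OF g g, of i j] ip_Bk[OF g g, of "Suc i" j] by (simp add: \<mu>_def)
  qed
  have "ipY (V (Q m g)) (V (Q n g)) = ipX (S (Q m g)) (Q n g)"
    using g by (simp add: ip_S)
  also have "\<dots> = (\<Sum>i<m. \<Sum>j<n. of_real (isqrt_coeff i * isqrt_coeff j) *
               ipX (S ((B ^^ i) g)) ((B ^^ j) g))"
    unfolding SQ unfolding Q_def using g
    by (simp add: X.ip_sum_left X.ip_sum_right X.ip_scale_left X.ip_scale_right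
        sum_distrib_left mult_ac)
  finally have "Re (ipY (V (Q m g)) (V (Q n g))) = (\<Sum>i<m. \<Sum>j<n. (isqrt_coeff i * isqrt_coeff j) *
               Re (ipX (S ((B ^^ i) g)) ((B ^^ j) g)))"
    by (simp del: of_real_mult)
  then show ?thesis by (simp only: SB sum_distrib_left mult_ac)
qed

lemma Re_ip_SQ_bounds:
  assumes "g \<in> elems X" "m \<le> n"
  shows "K * (\<mu> g 0 - \<mu> g m) \<le> Re (ipY (V (Q m g)) (V (Q n g)))"
    "Re (ipY (V (Q m g)) (V (Q n g))) \<le> K * \<mu> g 0"
  unfolding Re_ip_SQ[OF assms(1)]
  using isqrt_double_sum_bounds[of "\<mu> g" m n] \<mu>_dec[OF assms(1)] \<mu>_nonneg[OF assms(1)] assms(2) K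
  by (auto intro!: mult_left_mono)

text \<open>\<open>W n\<close> converges strongly to the unitary factor of the polar decomposition of \<open>V\<close>.\<close>

definition W where "W n g = (\<lambda>y. complex_of_real (1 / sqrt K) * V (Q n g) y)"

lemma W: "exact_linear X Y (W n)"
  unfolding W_def using exact_linear_compose[OF Q V]
  by (intro exact_linearI)
     (auto simp: exact_linear_def algebra_simps simp del: of_real_divide)

lemmas W_in [simp] = exact_linear_in[OF W]

text \<open>In the expanded square both diagonal terms are at most \<open>K * \<mu> g 0\<close>,
  while the mixed term is at least \<open>K * (\<mu> g 0 - \<mu> g m)\<close>; the factor
  \<open>1 / sqrt K\<close> in \<open>W\<close> removes \<open>K\<close>.\<close>

lemma norm_W_diff_sq:
  assumes g: "g \<in> elems X" and mn: "m \<le> n"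
  shows "(snorm Y (\<lambda>y. W m g y - W n g y))\<^sup>2 \<le> 2 * \<mu> g m"
proof -
  let ?D = "snorm Y (\<lambda>y. V (Q m g) y - V (Q n g) y)"
  have "?D\<^sup>2 = Re (ipY (V (Q m g)) (V (Q m g))) - 2 * Re (ipY (V (Q m g)) (V (Q n g)))
              + Re (ipY (V (Q n g)) (V (Q n g)))"
    using g by (simp add: Y.norm_diff_sq Y.Re_ip_self)
  then have D: "?D\<^sup>2 \<le> K * (2 * \<mu> g m)"
    using Re_ip_SQ_bounds[OF g, of m m] Re_ip_SQ_bounds[OF g, of n n]
      Re_ip_SQ_bounds[OF g mn] by (simp add: algebra_simps)
  have "(\<lambda>y. W m g y - W n g y) = (\<lambda>y. complex_of_real (1 / sqrt K) * (V (Q m g) y - V (Q n g) y))"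
    by (simp add: W_def algebra_simps)
  then have "snorm Y (\<lambda>y. W m g y - W n g y) = 1 / sqrt K * ?D"
    using Y.norm_scale[of "\<lambda>y. V (Q m g) y - V (Q n g) y" "complex_of_real (1 / sqrt K)"] g K
    by (simp del: of_real_divide)
  then have "(snorm Y (\<lambda>y. W m g y - W n g y))\<^sup>2 = ?D\<^sup>2 / K"
    using K by (simp add: power_divide)
  then show ?thesis using D K by (simp add: pos_divide_le_eq mult_ac)
qed

lemma norm_W_sq:
  assumes g: "g \<in> elems X"
  shows "(snorm X g)\<^sup>2 - \<mu> g n \<le> (snorm Y (W n g))\<^sup>2" "(snorm Y (W n g))\<^sup>2 \<le> (snorm X g)\<^sup>2"
proof -
  have "(snorm Y (W n g))\<^sup>2 = Re (ipY (V (Q n g)) (V (Q n g))) / K"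
    unfolding W_def using g K
    by (simp add: Y.norm_scale Y.Re_ip_self power_divide power_mult_distrib del: of_real_divide)
  moreover have "\<mu> g 0 = (snorm X g)\<^sup>2" using \<mu>_even[OF g, of 0] by simp
  ultimately show "(snorm X g)\<^sup>2 - \<mu> g n \<le> (snorm Y (W n g))\<^sup>2" "(snorm Y (W n g))\<^sup>2 \<le> (snorm X g)\<^sup>2"
    using Re_ip_SQ_bounds[OF g, of n n] K
    by (simp_all add: pos_le_divide_eq pos_divide_le_eq mult.commute[of _ K])
qed

text \<open>Convergence and the isometry property both reduce to
  \<open>\<mu> g \<longlonglongrightarrow> 0\<close>: this limit bounds the Cauchy differences and
  the defect of \<open>||W n g||\<close> from \<open>||g||\<close>.\<close>

lemma polar_isometry:
  obtains U where "bounded_op X Y U" "\<And>f. f \<in> elems X \<Longrightarrow> U f \<in> elems Y"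
    "\<And>f. f \<in> elems X \<Longrightarrow> (\<lambda>n. snorm Y (\<lambda>y. W n f y - U f y)) \<longlonglongrightarrow> 0"
    "\<And>f. f \<in> elems X \<Longrightarrow> snorm Y (U f) = snorm X f"
proof -
  obtain U where U: "bounded_op X Y U" "\<And>f. f \<in> elems X \<Longrightarrow> U f \<in> elems Y"
    "\<And>f. f \<in> elems X \<Longrightarrow> (\<lambda>n. snorm Y (\<lambda>y. W n f y - U f y)) \<longlonglongrightarrow> 0"
  proof (rule Y.limit_operator[OF X.complete_fun_space_axioms W, where C = 1])
    show "snorm Y (W n f) \<le> 1 * snorm X f" if "f \<in> elems X" for n f
      using power2_le_imp_le[OF norm_W_sq(2)[OF that]] that by simp
    show "\<exists>N. \<forall>m\<ge>N. \<forall>n\<ge>m. snorm Y (\<lambda>x. W m f x - W n f x) < e"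
      if f: "f \<in> elems X" and e: "e > 0" for f e
    proof -
      have "eventually (\<lambda>n. \<mu> f n < e\<^sup>2 / 2) sequentially"
        using e by (intro order_tendstoD(2)[OF \<mu>_tendsto_0[OF f]]) auto
      then obtain N where N: "\<And>n. n \<ge> N \<Longrightarrow> \<mu> f n < e\<^sup>2 / 2"
        by (auto simp: eventually_sequentially)
      have "snorm Y (\<lambda>x. W m f x - W n f x) < e" if "m \<ge> N" "n \<ge> m" for m n
      proof (rule power2_less_imp_less)
        show "(snorm Y (\<lambda>x. W m f x - W n f x))\<^sup>2 < e\<^sup>2"
          using norm_W_diff_sq[OF f that(2)] N[OF that(1)] by linarith
      qed (use e in auto)
      then show ?thesis by blast
    qed
  qed blast
  have "snorm Y (U f) = snorm X f" if f: "f \<in> elems X" for f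
  proof -
    have "(\<lambda>n. (snorm Y (W n f))\<^sup>2) \<longlonglongrightarrow> (snorm Y (U f))\<^sup>2"
      using f U by (intro tendsto_power Y.limit_norm) auto
    moreover have "(\<lambda>n. (snorm Y (W n f))\<^sup>2) \<longlonglongrightarrow> (snorm X f)\<^sup>2"
    proof (rule tendsto_sandwich)
      show "(\<lambda>n. (snorm X f)\<^sup>2 - \<mu> f n) \<longlonglongrightarrow> (snorm X f)\<^sup>2"
        using tendsto_diff[OF tendsto_const \<mu>_tendsto_0[OF f], of "(snorm X f)\<^sup>2"] by simp
    qed (use norm_W_sq[OF f] in auto)
    ultimately have "(snorm Y (U f))\<^sup>2 = (snorm X f)\<^sup>2" using LIMSEQ_unique by blast
    then show ?thesis using f U by (simp add: power2_eq_iff_nonneg)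
  qed
  then show thesis using that U by blast
qed

end

context adjoint_pair
begin

interpretation swap: adjoint_pair Y ipY X ipX A V K
  by (rule adjoint_pair_swap)

lemma swap_S: "swap.S h = V (A h)"
  by (simp add: swap.S_def)

lemma A_Bk: "h \<in> elems Y \<Longrightarrow> A ((swap.B ^^ k) h) = (B ^^ k) (A h)"
proof (induction k)
  case (Suc k)
  have "A (swap.B g) = B (A g)" if "g \<in> elems Y" for g
    unfolding B_def swap.B_def using that
    by (simp add: Y.exact_linear_diff[OF A] exact_linear_scale[OF A] swap_S S_def del: of_real_divide)
  then show ?case using Suc by simp
qed auto

text \<open>Intertwining of functions of \<open>V A\<close> with functions of \<open>A V\<close>. It
  shows that the approximants for \<open>A\<close> are the adjoints of those for
  \<open>V\<close>.\<close>

lemma A_Q: "h \<in> elems Y \<Longrightarrow> A (swap.Q n h) = Q n (A h)"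
  unfolding Q_def swap.Q_def
  by (subst Y.exact_linear_sum[OF A]) (simp_all add: exact_linear_scale[OF A] A_Bk)

text \<open>The polar isometry \<open>R\<close> of \<open>A\<close> is the adjoint of
  \<open>U\<close>, as a limit of adjoints. Hence \<open><U R h, h> = ||R h||^2 = ||h||^2\<close>,
  and since \<open>||U R h|| = ||h||\<close> as well, \<open>U R h\<close> and \<open>h\<close>
  coincide up to null functions. The commutation relation holds for each approximant and passes to
  the limit.\<close>

theorem polar_decomposition:
  obtains U where "unitary_op X Y U" "bounded_op X Y U"
    "\<And>f. f \<in> elems X \<Longrightarrow> eq_in Y (U (A (V f))) (V (A (U f)))"
proof -
  obtain U where U: "bounded_op X Y U" "\<And>f. f \<in> elems X \<Longrightarrow> U f \<in> elems Y"
    "\<And>f. f \<in> elems X \<Longrightarrow> (\<lambda>n. snorm Y (\<lambda>y. W n f y - U f y)) \<longlonglongrightarrow> 0"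
    "\<And>f. f \<in> elems X \<Longrightarrow> snorm Y (U f) = snorm X f"
    by (rule polar_isometry, rule that) blast+
  obtain R where "bounded_op Y X R" and R: "\<And>f. f \<in> elems Y \<Longrightarrow> R f \<in> elems X"
    "\<And>f. f \<in> elems Y \<Longrightarrow> (\<lambda>n. snorm X (\<lambda>y. swap.W n f y - R f y)) \<longlonglongrightarrow> 0"
    "\<And>f. f \<in> elems Y \<Longrightarrow> snorm X (R f) = snorm Y f"
    by (rule swap.polar_isometry, rule that) blast+
  have UR: "eq_in Y (U (R h)) h" if h: "h \<in> elems Y" for h
  proof -
    have "ipY (W n (R h)) h = ipX (R h) (swap.W n h)" for n
    proof -
      have Q_self: "ipX (Q n f) g = ipX f (Q n g)" if "f \<in> elems X" "g \<in> elems X" for f g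
        unfolding Q_def using that ip_Bk[of f g _ 0] ip_Bk[of f g 0]
        by (simp add: X.ip_sum_left X.ip_sum_right X.ip_scale_left X.ip_scale_right)
      have "ipY (W n (R h)) h = of_real (1 / sqrt K) * ipX (Q n (R h)) (A h)"
        unfolding W_def using h R by (simp add: Y.ip_scale_left adjoint del: of_real_divide)
      also have "\<dots> = ipX (R h) (swap.W n h)"
        unfolding swap.W_def using h R
        by (simp add: X.ip_scale_right A_Q Q_self del: of_real_divide)
      finally show ?thesis .
    qed
    moreover have "(\<lambda>n. ipY (W n (R h)) h) \<longlonglongrightarrow> ipY (U (R h)) h"
      using h R U by (intro Y.limit_ip) auto
    moreover have "(\<lambda>n. ipX (R h) (swap.W n h)) \<longlonglongrightarrow> ipX (R h) (R h)"
    proof -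
      have "(\<lambda>n. cnj (ipX (swap.W n h) (R h))) \<longlonglongrightarrow> cnj (ipX (R h) (R h))"
        using h R by (intro tendsto_cnj X.limit_ip) auto
      moreover have "cnj (ipX (swap.W n h) (R h)) = ipX (R h) (swap.W n h)" for n
        using h R X.ip_cnj[of "swap.W n h" "R h"] by simp
      ultimately show ?thesis using h R X.ip_cnj[of "R h" "R h"] by simp
    qed
    ultimately have "ipY (U (R h)) h = ipX (R h) (R h)"
      using LIMSEQ_unique by simp
    then have "Re (ipY (U (R h)) h) = (snorm Y h)\<^sup>2"
      using h R by (simp add: X.ip_self)
    then have "(snorm Y (\<lambda>y. U (R h) y - h y))\<^sup>2 = 0"
      using h R U by (simp add: Y.norm_diff_sq)
    then show ?thesis by (simp add: eq_in_def)
  qed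
  have "unitary_op X Y U"
    unfolding unitary_op_def using U(1,4) UR R(1) unfolding bounded_op_def by blast
  moreover have "eq_in Y (U (A (V f))) (V (A (U f)))" if f: "f \<in> elems X" for f
  proof (rule Y.limit_unique)
    show "W n (A (V f)) \<in> elems Y" for n using f by simp
    show "(\<lambda>n. snorm Y (\<lambda>x. W n (A (V f)) x - U (A (V f)) x)) \<longlonglongrightarrow> 0" using f U by simp
    \<comment> \<open>\<open>Q n\<close> is a polynomial in \<open>A V\<close> and so commutes with
      it: \<open>V q(A V) A V = V A (V q(A V))\<close>.\<close>
    have WS: "W n (A (V f)) = V (A (W n f))" for n
      using S_Q_commute[OF f, of n] f unfolding S_def W_def
      by (simp add: exact_linear_scale[OF V] exact_linear_scale[OF A] del: of_real_divide)
    show "(\<lambda>n. snorm Y (\<lambda>x. W n (A (V f)) x - V (A (U f)) x)) \<longlonglongrightarrow> 0"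
    proof -
      have "(\<lambda>n. (snorm Y (\<lambda>x. W n (A (V f)) x - V (A (U f)) x))\<^sup>2) \<longlonglongrightarrow> 0"
      proof (rule tendsto_zero_le)
        show "(\<lambda>n. K * (K * (snorm Y (\<lambda>y. W n f y - U f y))\<^sup>2)) \<longlonglongrightarrow> 0"
          using tendsto_mult_left[OF tendsto_power[OF U(3)[OF f], of 2], of "K * K"]
          by (simp add: mult.assoc)
        fix n
        let ?d = "\<lambda>y. W n f y - U f y"
        have d: "?d \<in> elems Y" using f U by simp
        have "(\<lambda>x. W n (A (V f)) x - V (A (U f)) x) = V (A ?d)"
          using f U by (simp add: WS X.exact_linear_diff[OF V] Y.exact_linear_diff[OF A])
        then have "(snorm Y (\<lambda>x. W n (A (V f)) x - V (A (U f)) x))\<^sup>2 \<le> K * (snorm X (A ?d))\<^sup>2"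
          using V_bound[of "A ?d"] d by simp
        also have "\<dots> \<le> K * (K * (snorm Y ?d)\<^sup>2)"
          using A_bound[OF d] K by (intro mult_left_mono) auto
        finally show "(snorm Y (\<lambda>x. W n (A (V f)) x - V (A (U f)) x))\<^sup>2 \<le> K * (K * (snorm Y ?d)\<^sup>2)" .
      qed auto
      then show ?thesis by simp
    qed
  qed (use f U in auto)
  ultimately show thesis using that U(1) by blast
qed

end

section \<open>Norms and spectra\<close>

lemma linear_opD:
  assumes "linear_op X Y T"
  shows "f \<in> elems X \<Longrightarrow> T f \<in> elems Y"
    "f \<in> elems X \<Longrightarrow> g \<in> elems X \<Longrightarrow> eq_in Y (T (\<lambda>x. f x + g x)) (\<lambda>y. T f y + T g y)"
    "f \<in> elems X \<Longrightarrow> eq_in Y (T (\<lambda>x. c * f x)) (\<lambda>y. c * T f y)"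
  using assms by (auto simp: linear_op_def)

lemma bounded_opD:
  assumes "bounded_op X Y T"
  shows "linear_op X Y T" "f \<in> elems X \<Longrightarrow> T f \<in> elems Y"
  using assms by (auto simp: bounded_op_def linear_op_def)

lemma bounded_op_bound:
  assumes "complete_fun_space X" "bounded_op X Y T"
  obtains C where "C \<ge> 0" "\<And>f. f \<in> elems X \<Longrightarrow> snorm Y (T f) \<le> C * snorm X f"
proof -
  interpret complete_fun_space X by fact
  obtain C where C: "\<And>f. f \<in> elems X \<Longrightarrow> snorm Y (T f) \<le> C * snorm X f"
    using assms(2) by (auto simp: bounded_op_def)
  have "snorm Y (T f) \<le> max C 0 * snorm X f" if "f \<in> elems X" for f
    using order_trans[OF C[OF that] mult_right_mono[of C "max C 0"]] that by simp
  then show thesis using that[of "max C 0"] by simp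
qed

lemma op_norm_ge:
  assumes X: "complete_fun_space X" and T: "bounded_op X Y T" and f: "f \<in> elems X" "snorm X f \<le> 1"
  shows "snorm Y (T f) \<le> op_norm X Y T"
proof -
  obtain C where C: "C \<ge> 0" "\<And>f. f \<in> elems X \<Longrightarrow> snorm Y (T f) \<le> C * snorm X f"
    using bounded_op_bound[OF X T] by blast
  have "snorm Y (T f) \<le> C" if "f \<in> elems X" "snorm X f \<le> 1" for f
    using order_trans[OF C(2)[OF that(1)] mult_left_mono[OF that(2) C(1)]] by simp
  then have "bdd_above ((\<lambda>f. snorm Y (T f)) ` {f \<in> elems X. snorm X f \<le> 1})"
    by (auto simp: bdd_above_def)
  then show ?thesis unfolding op_norm_def using f by (intro cSUP_upper) auto
qed

lemma op_norm_le:
  assumes X: "complete_fun_space X" and "C \<ge> 0" "\<And>f. f \<in> elems X \<Longrightarrow> snorm Y (T f) \<le> C * snorm X f"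
  shows "op_norm X Y T \<le> C"
proof -
  interpret complete_fun_space X by fact
  have "snorm Y (T f) \<le> C" if "f \<in> elems X" "snorm X f \<le> 1" for f
    using order_trans[OF assms(3)[OF that(1)] mult_left_mono[OF that(2) assms(2)]] by simp
  moreover have "(\<lambda>x. 0) \<in> {f \<in> elems X. snorm X f \<le> 1}" by simp
  then have "{f \<in> elems X. snorm X f \<le> 1} \<noteq> {}" by blast
  ultimately show ?thesis unfolding op_norm_def by (intro cSUP_least) auto
qed

lemma linear_op_diff:
  assumes X: "complete_fun_space X" and Y: "complete_fun_space Y" and T: "linear_op X Y T"
    and f: "f \<in> elems X" and g: "g \<in> elems X"
  shows "eq_in Y (T (\<lambda>x. f x - g x)) (\<lambda>y. T f y - T g y)"
proof -
  interpret X: complete_fun_space X by fact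
  interpret Y: complete_fun_space Y by fact
  note T_in = linear_opD(1)[OF T]
  have 1: "eq_in Y (T (\<lambda>x. f x + - 1 * g x)) (\<lambda>y. T f y + T (\<lambda>x. - 1 * g x) y)"
    using f g X.scale_in by (intro linear_opD(2)[OF T]) blast+
  have "eq_in Y (T (\<lambda>x. - 1 * g x)) (\<lambda>y. - 1 * T g y)"
    by (rule linear_opD(3)[OF T g])
  then have 2: "eq_in Y (\<lambda>y. T f y + T (\<lambda>x. - 1 * g x) y) (\<lambda>y. T f y - T g y)"
    by (simp add: eq_in_def)
  have "(\<lambda>x. - 1 * g x) \<in> elems X" using g by (rule X.scale_in)
  then have "eq_in Y (T (\<lambda>x. f x + - 1 * g x)) (\<lambda>y. T f y - T g y)"
    using f g T_in by (intro Y.eq_in_trans[OF _ _ _ 1 2]) (auto simp del: mult_minus1)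
  then show ?thesis by simp
qed

lemma bounded_op_diff_eq:
  assumes X: "complete_fun_space X" and Y: "complete_fun_space Y" and T: "bounded_op X Y T"
    and C: "\<And>f. f \<in> elems X \<Longrightarrow> snorm Y (T f) \<le> C * snorm X f"
    and f: "f \<in> elems X" and g: "g \<in> elems X"
  shows "snorm Y (\<lambda>y. T f y - T g y) \<le> C * snorm X (\<lambda>x. f x - g x)"
proof -
  interpret X: complete_fun_space X by fact
  interpret Y: complete_fun_space Y by fact
  have "snorm Y (T (\<lambda>x. f x - g x)) = snorm Y (\<lambda>y. T f y - T g y)"
    using linear_op_diff[OF X Y bounded_opD(1)[OF T] f g] f g bounded_opD(2)[OF T]
    by (intro Y.norm_eq_in) auto
  then show ?thesis using C[of "\<lambda>x. f x - g x"] f g by simp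
qed

lemma bounded_op_cong:
  assumes X: "complete_fun_space X" and Y: "complete_fun_space Y" and T: "bounded_op X Y T"
    and f: "f \<in> elems X" and g: "g \<in> elems X" and fg: "eq_in X f g"
  shows "eq_in Y (T f) (T g)"
proof -
  interpret Y: complete_fun_space Y by fact
  obtain C where C: "\<And>f. f \<in> elems X \<Longrightarrow> snorm Y (T f) \<le> C * snorm X f"
    using bounded_op_bound[OF X T] by blast
  have "snorm Y (\<lambda>y. T f y - T g y) \<le> 0"
    using bounded_op_diff_eq[OF X Y T C f g] fg by (simp add: eq_in_def)
  moreover have "0 \<le> snorm Y (\<lambda>y. T f y - T g y)"
    using bounded_opD(2)[OF T] f g by (intro Y.norm_nonneg Y.diff_in)
  ultimately show ?thesis by (simp add: eq_in_def)
qed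

lemma bounded_op_minus:
  assumes X: "complete_fun_space X" and Y: "complete_fun_space Y"
    and T: "bounded_op X Y T" and S: "bounded_op X Y S"
  shows "bounded_op X Y (\<lambda>f y. T f y - S f y)"
proof -
  interpret X: complete_fun_space X by fact
  interpret Y: complete_fun_space Y by fact
  note Tl = bounded_opD(1)[OF T] and Sl = bounded_opD(1)[OF S]
  note in_Y = linear_opD(1)[OF Tl] linear_opD(1)[OF Sl]
  have add: "eq_in Y (\<lambda>y. T (\<lambda>x. f x + g x) y - S (\<lambda>x. f x + g x) y)
      (\<lambda>y. (T f y - S f y) + (T g y - S g y))" if fg: "f \<in> elems X" "g \<in> elems X" for f g
  proof -
    let ?A = "\<lambda>y. T (\<lambda>x. f x + g x) y - (T f y + T g y)" and ?B = "\<lambda>y. S (\<lambda>x. f x + g x) y - (S f y + S g y)"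
    have AB: "?A \<in> elems Y" "?B \<in> elems Y" using fg in_Y by auto
    have "snorm Y (\<lambda>y. ?A y - ?B y) \<le> 0"
      using Y.norm_diff_le[OF AB] linear_opD(2)[OF Tl fg] linear_opD(2)[OF Sl fg] by (simp add: eq_in_def)
    moreover have "0 \<le> snorm Y (\<lambda>y. ?A y - ?B y)" by (rule Y.norm_nonneg[OF Y.diff_in[OF AB]])
    ultimately show ?thesis by (simp add: eq_in_def algebra_simps)
  qed
  have scale: "eq_in Y (\<lambda>y. T (\<lambda>x. c * f x) y - S (\<lambda>x. c * f x) y) (\<lambda>y. c * (T f y - S f y))"
    if f: "f \<in> elems X" for f c
  proof -
    let ?A = "\<lambda>y. T (\<lambda>x. c * f x) y - c * T f y" and ?B = "\<lambda>y. S (\<lambda>x. c * f x) y - c * S f y"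
    have AB: "?A \<in> elems Y" "?B \<in> elems Y" using f in_Y by auto
    have "snorm Y (\<lambda>y. ?A y - ?B y) \<le> 0"
      using Y.norm_diff_le[OF AB] linear_opD(3)[OF Tl f] linear_opD(3)[OF Sl f] by (simp add: eq_in_def)
    moreover have "0 \<le> snorm Y (\<lambda>y. ?A y - ?B y)" by (rule Y.norm_nonneg[OF Y.diff_in[OF AB]])
    ultimately show ?thesis by (simp add: eq_in_def algebra_simps)
  qed
  obtain C D where "\<And>f. f \<in> elems X \<Longrightarrow> snorm Y (T f) \<le> C * snorm X f"
      "\<And>f. f \<in> elems X \<Longrightarrow> snorm Y (S f) \<le> D * snorm X f"
    using bounded_op_bound[OF X T] bounded_op_bound[OF X S] by metis
  then have "snorm Y (\<lambda>y. T f y - S f y) \<le> (C + D) * snorm X f" if "f \<in> elems X" for f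
    using order_trans[OF Y.norm_diff_le[of "T f" "S f"] add_mono] that in_Y by (simp add: distrib_right)
  then show ?thesis
    using add scale in_Y unfolding bounded_op_def linear_op_def by (intro conjI ballI allI) (auto simp del: Y.add_in)
qed

text \<open>Inverses are given only up to null functions, so the remainders in the definition of the
  essential spectrum take null values rather than vanish; as operators they are zero, hence
  compact.\<close>

lemma compact_op_null:
  assumes X: "complete_fun_space X" and Y: "complete_fun_space Y"
    and K: "\<And>f. f \<in> elems X \<Longrightarrow> K f \<in> elems Y" "\<And>f. f \<in> elems X \<Longrightarrow> snorm Y (K f) = 0"
  shows "compact_op X Y K"
proof -
  interpret X: complete_fun_space X by fact
  interpret Y: complete_fun_space Y by fact
  have "eq_in Y g h" if "g \<in> elems Y" "h \<in> elems Y" "snorm Y g = 0" "snorm Y h = 0" for g h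
    using Y.norm_diff_le[OF that(1,2)] Y.norm_nonneg[OF Y.diff_in[OF that(1,2)]] that by (simp add: eq_in_def)
  moreover have "snorm Y (\<lambda>y. K f y + K g y) = 0" if "f \<in> elems X" "g \<in> elems X" for f g
    using Y.norm_triangle[of "K f" "K g"] Y.norm_nonneg[OF Y.add_in[OF K(1) K(1)]]
      K(1)[OF that(1)] K(1)[OF that(2)] K(2)[OF that(1)] K(2)[OF that(2)] that by (metis add_0 antisym)
  moreover have "snorm Y (\<lambda>y. c * K f y) = 0" if "f \<in> elems X" for f c
    using Y.norm_scale[of "K f" c] K that by simp
  ultimately have "linear_op X Y K" unfolding linear_op_def using K by auto
  then have "bounded_op X Y K" using K by (auto simp: bounded_op_def intro!: exI[of _ 0])
  moreover have "\<exists>g\<in>elems Y. \<exists>r :: nat \<Rightarrow> nat. strict_mono r \<and> (\<lambda>n. snorm Y (\<lambda>y. K (F (r n)) y - g y)) \<longlonglongrightarrow> 0"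
    if "\<forall>n. F n \<in> elems X \<and> snorm X (F n) \<le> C" for F C
    using that K by (intro bexI[of _ "\<lambda>x. 0"] exI[of _ "\<lambda>n. n"]) (auto simp: strict_mono_def)
  ultimately show ?thesis unfolding compact_op_def by blast
qed

lemma ess_spectrum_subset_spectrum:
  assumes X: "complete_fun_space X" and T: "bounded_op X X T"
  shows "ess_spectrum_op X T \<subseteq> spectrum_op X T"
proof -
  interpret complete_fun_space X by fact
  have "c \<notin> ess_spectrum_op X T" if "c \<notin> spectrum_op X T" for c
  proof -
    have "\<exists>R. bounded_op X X R \<and> (\<forall>f\<in>elems X. eq_in X (R (\<lambda>x. c * f x - T f x)) f) \<and>
        (\<forall>f\<in>elems X. eq_in X (\<lambda>x. c * R f x - T (R f) x) f)"
      using that by (simp add: spectrum_op_def)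
    then obtain R where R: "bounded_op X X R"
        "\<forall>f\<in>elems X. eq_in X (R (\<lambda>x. c * f x - T f x)) f"
        "\<forall>f\<in>elems X. eq_in X (\<lambda>x. c * R f x - T (R f) x) f"
      by blast
    note in_X = bounded_opD(2)[OF R(1)] bounded_opD(2)[OF T]
    have "compact_op X X (\<lambda>f x. R (\<lambda>y. c * f y - T f y) x - f x)"
      using R(2) in_X by (intro compact_op_null[OF X X]) (auto simp: eq_in_def)
    moreover have "compact_op X X (\<lambda>f x. (c * R f x - T (R f) x) - f x)"
      using R(3) in_X by (intro compact_op_null[OF X X]) (auto simp: eq_in_def)
    ultimately show ?thesis using R(1) by (auto simp: ess_spectrum_op_def)
  qed
  then show ?thesis by blast
qed

text \<open>A singular Weyl sequence. The constant mutual distance \<open>d\<close> takes the role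
  of orthonormality, so that the notion makes sense in L^p: no subsequence converges.\<close>

locale separated_eigensequence = complete_fun_space X for X :: "'a fun_space" +
  fixes T :: "('a \<Rightarrow> complex) \<Rightarrow> ('a \<Rightarrow> complex)" and r :: complex and F :: "nat \<Rightarrow> 'a \<Rightarrow> complex" and d :: real
  assumes T: "bounded_op X X T" and F: "\<And>n. F n \<in> elems X" "\<And>n. snorm X (F n) = 1"
    and lim: "(\<lambda>n. snorm X (\<lambda>x. T (F n) x - r * F n x)) \<longlonglongrightarrow> 0"
    and d: "d > 0" and sep: "\<And>m n. m \<noteq> n \<Longrightarrow> snorm X (\<lambda>x. F m x - F n x) = d"
begin

lemmas T_in [simp] = bounded_opD(2)[OF T]
lemmas F_in [simp] = F(1)

lemma not_convergent:
  assumes s: "strict_mono (s :: nat \<Rightarrow> nat)" and g: "g \<in> elems X"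
  shows "\<not> (\<lambda>n. snorm X (\<lambda>x. F (s n) x - g x)) \<longlonglongrightarrow> 0"
proof
  assume lim: "(\<lambda>n. snorm X (\<lambda>x. F (s n) x - g x)) \<longlonglongrightarrow> 0"
  have "d \<le> snorm X (\<lambda>x. F (s n) x - g x) + snorm X (\<lambda>x. F (s (Suc n)) x - g x)" for n
  proof -
    have "s n \<noteq> s (Suc n)" using strict_monoD[OF s, of n "Suc n"] by simp
    then show ?thesis
      using norm_diff_triangle[of "F (s n)" g "F (s (Suc n))"] sep[of "s n" "s (Suc n)"]
        norm_diff_commute[of g "F (s (Suc n))"] g by simp
  qed
  moreover have "(\<lambda>n. snorm X (\<lambda>x. F (s n) x - g x) + snorm X (\<lambda>x. F (s (Suc n)) x - g x)) \<longlonglongrightarrow> 0"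
    using tendsto_add[OF lim LIMSEQ_Suc[OF lim]] by simp
  ultimately have "d \<le> 0" by (intro tendsto_lowerbound[of _ 0 sequentially]) auto
  then show False using d by simp
qed

text \<open>If \<open>R (r - T) - 1\<close> were compact, it would send a subsequence of
  \<open>F\<close> to a convergent one. But \<open>R (r - T)\<close> tends to 0 along
  \<open>F\<close>, so that subsequence of \<open>F\<close> would converge itself.\<close>

lemma in_ess_spectrum: "r \<in> ess_spectrum_op X T"
proof (rule ccontr)
  assume "r \<notin> ess_spectrum_op X T"
  then obtain R where R: "bounded_op X X R"
      "compact_op X X (\<lambda>f x. R (\<lambda>y. r * f y - T f y) x - f x)"
    by (auto simp: ess_spectrum_op_def)
  note R_in = bounded_opD(2)[OF R(1)]
  have "\<forall>n. F n \<in> elems X \<and> snorm X (F n) \<le> 1" using F by simp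
  with R(2) obtain g s where g: "g \<in> elems X" "strict_mono (s :: nat \<Rightarrow> nat)"
      "(\<lambda>n. snorm X (\<lambda>x. (R (\<lambda>y. r * F (s n) y - T (F (s n)) y) x - F (s n) x) - g x)) \<longlonglongrightarrow> 0"
    unfolding compact_op_def by blast
  obtain C where C: "\<And>f. f \<in> elems X \<Longrightarrow> snorm X (R f) \<le> C * snorm X f"
    using bounded_op_bound[OF complete_fun_space_axioms R(1)] by blast
  let ?h = "\<lambda>n y. r * F n y - T (F n) y"
  have h: "?h n \<in> elems X" for n by simp
  have hn: "snorm X (?h n) = snorm X (\<lambda>x. T (F n) x - r * F n x)" for n
    by (rule norm_diff_commute) simp_all
  have "(\<lambda>n. snorm X (\<lambda>x. F (s n) x - (- g x))) \<longlonglongrightarrow> 0"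
  proof (rule tendsto_zero_le)
    show "(\<lambda>n. C * snorm X (?h (s n)) + snorm X (\<lambda>x. (R (?h (s n)) x - F (s n) x) - g x)) \<longlonglongrightarrow> 0"
      unfolding hn
      using tendsto_add[OF tendsto_mult_left[OF LIMSEQ_subseq_LIMSEQ[OF lim g(2)], of C] g(3)]
      by (simp add: comp_def)
    fix n
    show "0 \<le> snorm X (\<lambda>x. F (s n) x - (- g x))" using g(1) by (intro norm_nonneg diff_in minus_in) auto
    have "snorm X (\<lambda>x. R (?h (s n)) x - ((R (?h (s n)) x - F (s n) x) - g x)) \<le>
        snorm X (R (?h (s n))) + snorm X (\<lambda>x. (R (?h (s n)) x - F (s n) x) - g x)"
      using R_in[OF h] g(1) by (intro norm_diff_le diff_in) auto
    then show "snorm X (\<lambda>x. F (s n) x - (- g x)) \<le>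
        C * snorm X (?h (s n)) + snorm X (\<lambda>x. (R (?h (s n)) x - F (s n) x) - g x)"
      using C[OF h, of "s n"] by (simp add: algebra_simps)
  qed
  then show False using not_convergent[OF g(2), of "\<lambda>x. - g x"] g(1) by simp
qed

text \<open>Along a subsequence \<open>K\<close> converges on \<open>F\<close>, to a limit which may
  be nonzero. Differences of consecutive members have norm \<open>d\<close> and cancel that limit,
  so \<open>T - K\<close> acts on them almost as multiplication by \<open>r\<close>.\<close>

lemma op_norm_compact_perturbation:
  assumes K: "compact_op X X K"
  shows "cmod r \<le> op_norm X X (\<lambda>f x. T f x - K f x)"
proof -
  have Kb: "bounded_op X X K" using K by (simp add: compact_op_def)
  note K_in = bounded_opD(2)[OF Kb]
  define D where "D = (\<lambda>f x. T f x - K f x)"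
  have D: "bounded_op X X D"
    unfolding D_def by (rule bounded_op_minus[OF complete_fun_space_axioms complete_fun_space_axioms T Kb])
  note D_in = bounded_opD(2)[OF D]
  have "\<forall>n. F n \<in> elems X \<and> snorm X (F n) \<le> 1" using F by simp
  with K obtain g s where g: "g \<in> elems X" "strict_mono (s :: nat \<Rightarrow> nat)"
      "(\<lambda>n. snorm X (\<lambda>x. K (F (s n)) x - g x)) \<longlonglongrightarrow> 0"
    unfolding compact_op_def by blast
  define e where "e n = snorm X (\<lambda>x. T (F (s n)) x - r * F (s n) x) + snorm X (\<lambda>x. K (F (s n)) x - g x)" for n
  have e0: "e \<longlonglongrightarrow> 0"
    unfolding e_def using tendsto_add[OF LIMSEQ_subseq_LIMSEQ[OF lim g(2)] g(3)] by (simp add: comp_def)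
  \<comment> \<open>Thus \<open>D (F (s n)) = r F (s n) - g + E n\<close>, and \<open>g\<close>
    drops out of differences.\<close>
  define E where "E n = (\<lambda>x. (T (F (s n)) x - r * F (s n) x) - (K (F (s n)) x - g x))" for n
  have E: "E n \<in> elems X" "snorm X (E n) \<le> e n" for n
    unfolding E_def e_def
    using K_in g(1) norm_diff_le[of "\<lambda>x. T (F (s n)) x - r * F (s n) x" "\<lambda>x. K (F (s n)) x - g x"] by auto
  have main: "cmod r * d - (e n + e (Suc n)) \<le> op_norm X X D * d" for n
  proof -
    have ne: "s n \<noteq> s (Suc n)" using strict_monoD[OF g(2), of n "Suc n"] by simp
    let ?f = "\<lambda>x. F (s n) x - F (s (Suc n)) x"
    have f: "?f \<in> elems X" "snorm X ?f = d" using sep[OF ne] by auto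
    define a where "a = snorm X (\<lambda>x. D (F (s n)) x - D (F (s (Suc n))) x)"
    define b where "b = snorm X (\<lambda>x. E n x - E (Suc n) x)"
    have b: "b \<le> e n + e (Suc n)"
      unfolding b_def by (rule order_trans[OF norm_diff_le[OF E(1) E(1)] add_mono[OF E(2) E(2)]])
    have "cmod r * d = snorm X (\<lambda>x. r * ?f x)"
      using norm_scale[OF f(1), of r] f(2) by simp
    also have "(\<lambda>x. r * ?f x) = (\<lambda>x. (D (F (s n)) x - D (F (s (Suc n))) x) - (E n x - E (Suc n) x))"
      by (auto simp: D_def E_def algebra_simps)
    also have "snorm X \<dots> \<le> a + b"
      unfolding a_def b_def
      by (rule norm_diff_le[OF diff_in[OF D_in[OF F_in] D_in[OF F_in]] diff_in[OF E(1) E(1)]])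
    finally have 1: "cmod r * d \<le> a + (e n + e (Suc n))" using b by linarith
    let ?h = "\<lambda>x. complex_of_real (1 / d) * ?f x"
    have h: "?h \<in> elems X" "snorm X ?h = 1"
      using f d norm_scale[OF f(1), of "complex_of_real (1 / d)"] by (auto simp del: of_real_divide)
    have "snorm X (D ?f) = snorm X (\<lambda>x. D (F (s n)) x - D (F (s (Suc n))) x)"
      by (intro norm_eq_in linear_op_diff[OF complete_fun_space_axioms complete_fun_space_axioms bounded_opD(1)[OF D]])
         (use D_in f in auto)
    moreover have "snorm X (D ?h) = snorm X (\<lambda>x. complex_of_real (1 / d) * D ?f x)"
      by (intro norm_eq_in linear_opD(3)[OF bounded_opD(1)[OF D]] scale_in D_in) (use f in auto)
    moreover have "snorm X (\<lambda>x. complex_of_real (1 / d) * D ?f x) = 1 / d * snorm X (D ?f)"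
      using norm_scale[OF D_in[OF f(1)], of "complex_of_real (1 / d)"] d by (simp del: of_real_divide)
    moreover have "snorm X (D ?h) \<le> op_norm X X D"
      using h by (intro op_norm_ge[OF complete_fun_space_axioms D]) auto
    ultimately have "a \<le> op_norm X X D * d"
      unfolding a_def using d by (simp add: pos_divide_le_eq)
    then show ?thesis using 1 by linarith
  qed
  have "(\<lambda>n. cmod r * d - (e n + e (Suc n))) \<longlonglongrightarrow> cmod r * d - (0 + 0)"
    by (intro tendsto_intros e0 LIMSEQ_Suc[OF e0])
  then have "cmod r * d \<le> op_norm X X D * d"
    using main by (intro tendsto_upperbound[of _ "cmod r * d" sequentially]) auto
  then show ?thesis using d by (simp add: D_def)
qed

lemma zero_compact: "compact_op X X (\<lambda>f x. 0)"
  by (rule compact_op_null[OF complete_fun_space_axioms complete_fun_space_axioms]) simp_all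

lemma norm_le_op_norm: "cmod r \<le> op_norm X X T"
  using op_norm_compact_perturbation[OF zero_compact] by simp

lemma not_compact: "r \<noteq> 0 \<Longrightarrow> \<not> compact_op X X T"
proof
  assume "r \<noteq> 0" "compact_op X X T"
  then have "cmod r \<le> op_norm X X (\<lambda>f x. 0)"
    using op_norm_compact_perturbation[of T] by simp
  also have "\<dots> \<le> 0" by (rule op_norm_le[OF complete_fun_space_axioms]) auto
  finally show False using \<open>r \<noteq> 0\<close> by simp
qed

lemma ess_norm_eq: "op_norm X X T \<le> cmod r \<Longrightarrow> ess_norm X T = cmod r"
proof (rule antisym)
  assume le: "op_norm X X T \<le> cmod r"
  have "bdd_below ((\<lambda>K. op_norm X X (\<lambda>f x. T f x - K f x)) ` {K. compact_op X X K})"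
    using op_norm_compact_perturbation by (auto simp: bdd_below_def)
  then have "ess_norm X T \<le> op_norm X X (\<lambda>f x. T f x - (\<lambda>f x. 0) f x)"
    unfolding ess_norm_def using zero_compact by (intro cINF_lower) auto
  then show "ess_norm X T \<le> cmod r" using le by simp
  show "cmod r \<le> ess_norm X T"
    unfolding ess_norm_def using op_norm_compact_perturbation zero_compact by (intro cINF_greatest) auto
qed

end

text \<open>For \<open>c\<close> off the segment, \<open>c - s\<close> with \<open>s\<close> in
  [0, K] stays in an open half-plane bounded by a line through 0. A factor \<open>w\<close> rotates
  \<open>c\<close> and \<open>c - K\<close> into the right half-plane, and a small multiple
  \<open>\<epsilon> * w\<close> brings \<open>1 - \<epsilon> w (c - s)\<close> into the unit disc at
  both endpoints.\<close>

lemma exists_contracting_multiplier: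
  fixes c :: complex and K :: real
  assumes "c \<notin> complex_of_real ` {0..K}" "K > 0"
  obtains \<alpha> where "\<alpha> \<noteq> 0" "cmod (1 - \<alpha> * c) < 1" "cmod (1 - \<alpha> * c + \<alpha> * of_real K) < 1"
proof -
  \<comment> \<open>The squared modulus is
    \<open>1 - 2 \<epsilon> Re u + \<epsilon>^2 |u|^2\<close>.\<close>
  have aux: "cmod (1 - of_real \<epsilon> * u) < 1" if "0 < \<epsilon>" "\<epsilon> * (cmod u)\<^sup>2 < 2 * Re u" for \<epsilon> u
  proof -
    have "(cmod (1 - of_real \<epsilon> * u))\<^sup>2 = 1 - \<epsilon> * (2 * Re u - \<epsilon> * (cmod u)\<^sup>2)"
      unfolding cmod_power2 by (simp add: power2_eq_square algebra_simps)
    also have "\<dots> < 1\<^sup>2" using that by simp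
    finally show ?thesis by (rule power2_less_imp_less) simp
  qed
  obtain w :: complex where w: "Re (w * c) > 0" "Re (w * (c - of_real K)) > 0"
  proof -
    consider "Im c > 0" | "Im c < 0" | "Im c = 0" "Re c < 0" | "Im c = 0" "Re c > K"
    proof -
      have "\<not> (Im c = 0 \<and> 0 \<le> Re c \<and> Re c \<le> K)"
        using assms(1) complex_eqI[of c "complex_of_real (Re c)"] by (auto simp: image_iff)
      then show thesis using that by linarith
    qed
    then show thesis
    proof cases
      case 1 then show thesis using that[of "- \<i>"] by simp
    next
      case 2 then show thesis using that[of "\<i>"] by simp
    next
      case 3 then show thesis using that[of "-1"] assms(2) by simp
    next
      case 4 then show thesis using that[of 1] assms(2) by simp
    qed
  qed
  define m where "m = min (Re (w * c)) (Re (w * (c - of_real K)))"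
  define M where "M = max ((cmod (w * c))\<^sup>2) ((cmod (w * (c - of_real K)))\<^sup>2)"
  have M: "M \<ge> 0" by (simp add: M_def le_max_iff_disj)
  define \<epsilon> where "\<epsilon> = m / (M + 1)"
  have m: "m > 0" using w by (simp add: m_def)
  have \<epsilon>: "\<epsilon> > 0" using m M by (simp add: \<epsilon>_def)
  have "\<epsilon> * M \<le> \<epsilon> * (M + 1)" using \<epsilon> by simp
  also have "\<dots> = m" using M by (simp add: \<epsilon>_def)
  finally have le: "\<epsilon> * M \<le> m" .
  have bound: "\<epsilon> * (cmod u)\<^sup>2 < 2 * Re u" if "(cmod u)\<^sup>2 \<le> M" "m \<le> Re u" for u
    using mult_left_mono[OF that(1), of \<epsilon>] \<epsilon> le m that(2) by linarith
  show thesis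
  proof (rule that[of "of_real \<epsilon> * w"])
    show "of_real \<epsilon> * w \<noteq> 0" using \<epsilon> w by auto
    show "cmod (1 - of_real \<epsilon> * w * c) < 1"
      using aux[OF \<epsilon> bound, of "w * c"] by (simp add: M_def m_def mult.assoc)
    have "cmod (1 - of_real \<epsilon> * (w * (c - of_real K))) < 1"
      by (rule aux[OF \<epsilon> bound]) (simp_all add: M_def m_def)
    then show "cmod (1 - of_real \<epsilon> * w * c + of_real \<epsilon> * w * of_real K) < 1"
      by (simp add: algebra_simps)
  qed
qed

section \<open>Resolvent and spectrum of the operator S = A V\<close>

context adjoint_pair
begin

text \<open>Functional calculus for an affine function on [0, K]: \<open>cmod (x + s * y)\<close> is
  convex in \<open>s\<close> and attains its maximum at an endpoint.\<close>

lemma norm_combination: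
  assumes f: "f \<in> elems X"
  shows "snorm X (\<lambda>t. x * f t + y * S f t) \<le> max (cmod x) (cmod (x + of_real K * y)) * snorm X f"
proof -
  define n where "n = (snorm X f)\<^sup>2"
  define s where "s = (snorm Y (V f))\<^sup>2"
  have s: "0 \<le> s" "s \<le> K * n" using V_bound[OF f] by (simp_all add: s_def n_def)
  have ipS: "ipX f (S f) = of_real s"
    using X.ip_cnj[OF S_in[OF f] f] f by (simp add: ip_S Y.ip_self s_def)
  have "(snorm X (\<lambda>t. x * f t + y * S f t))\<^sup>2 = (cmod x)\<^sup>2 * n + 2 * (Re (x * cnj y) * s) + (cmod y)\<^sup>2 * (snorm X (S f))\<^sup>2"
    using f by (simp add: X.norm_add_sq X.norm_scale X.ip_scale_left X.ip_scale_right ipS n_def power_mult_distrib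
        algebra_simps)
  \<comment> \<open>S^2 <= K S makes the bound affine in \<open>s = <S f, f>\<close>, which ranges
    over \<open>[0, K * n]\<close>; the sign of the slope decides which endpoint is the
    larger.\<close>
  also have "\<dots> \<le> (cmod x)\<^sup>2 * n + 2 * (Re (x * cnj y) * s) + (cmod y)\<^sup>2 * (K * s)"
    using norm_S_sq[OF f] by (simp add: s_def mult_left_mono)
  also have "\<dots> = (cmod x)\<^sup>2 * n + ((cmod (x + of_real K * y))\<^sup>2 - (cmod x)\<^sup>2) / K * s"
  proof -
    have "(cmod (x + of_real K * y))\<^sup>2 - (cmod x)\<^sup>2 = K * (2 * Re (x * cnj y) + K * (cmod y)\<^sup>2)"
      unfolding cmod_power2 by (simp add: power2_eq_square algebra_simps)
    then have "((cmod (x + of_real K * y))\<^sup>2 - (cmod x)\<^sup>2) / K = 2 * Re (x * cnj y) + K * (cmod y)\<^sup>2"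
      using K by simp
    then show ?thesis by (simp only: algebra_simps)
  qed
  also have "\<dots> \<le> (max (cmod x) (cmod (x + of_real K * y)))\<^sup>2 * n"
  proof (cases "cmod (x + of_real K * y) \<le> cmod x")
    case True
    then have "((cmod (x + of_real K * y))\<^sup>2 - (cmod x)\<^sup>2) / K * s \<le> 0"
      using K s by (intro mult_nonpos_nonneg divide_nonpos_pos) (auto simp: power_mono)
    then show ?thesis using True by (simp add: max_def)
  next
    case False
    then have "((cmod (x + of_real K * y))\<^sup>2 - (cmod x)\<^sup>2) / K * s \<le> ((cmod (x + of_real K * y))\<^sup>2 - (cmod x)\<^sup>2) / K * (K * n)"
      using K s by (intro mult_left_mono divide_nonneg_pos) (auto simp: power_mono)
    also have "\<dots> = (cmod (x + of_real K * y))\<^sup>2 * n - (cmod x)\<^sup>2 * n"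
      using K by (simp add: left_diff_distrib diff_divide_distrib)
    finally show ?thesis using False by (simp add: max_def)
  qed
  finally have "(snorm X (\<lambda>t. x * f t + y * S f t))\<^sup>2 \<le> (max (cmod x) (cmod (x + of_real K * y)) * snorm X f)\<^sup>2"
    by (simp add: n_def power_mult_distrib)
  then show ?thesis
    by (rule power2_le_imp_le) (use f in \<open>auto intro!: mult_nonneg_nonneg simp: le_max_iff_disj\<close>)
qed

text \<open>\<open>\<alpha> (c - S) = 1 - T\<close> with
  \<open>T = (1 - \<alpha> c) + \<alpha> S\<close>, a contraction by
  \<open>norm_combination\<close>. The inverse is the Neumann series of \<open>T\<close> composed
  with multiplication by \<open>\<alpha>\<close>.\<close>

lemma resolvent:
  assumes c: "c \<notin> complex_of_real ` {0..K}"
  obtains R where "bounded_op X X R"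
    "\<And>f. f \<in> elems X \<Longrightarrow> eq_in X (R (\<lambda>x. c * f x - S f x)) f"
    "\<And>f. f \<in> elems X \<Longrightarrow> eq_in X (\<lambda>x. c * R f x - S (R f) x) f"
proof -
  obtain \<alpha> where \<alpha>: "\<alpha> \<noteq> 0" "cmod (1 - \<alpha> * c) < 1" "cmod (1 - \<alpha> * c + \<alpha> * of_real K) < 1"
    using exists_contracting_multiplier[OF c K] by blast
  define T where "T f = (\<lambda>x. (1 - \<alpha> * c) * f x + \<alpha> * S f x)" for f
  define \<rho> where "\<rho> = max (cmod (1 - \<alpha> * c)) (cmod (1 - \<alpha> * c + of_real K * \<alpha>))"
  have T: "exact_linear X X T"
    unfolding T_def
    by (intro exact_linearI) (auto simp: exact_linear_add[OF S] exact_linear_scale[OF S] algebra_simps fun_eq_iff)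
  have \<rho>: "0 \<le> \<rho>" "\<rho> < 1" using \<alpha> by (auto simp: \<rho>_def le_max_iff_disj mult.commute)
  have T_le: "snorm X (T f) \<le> \<rho> * snorm X f" if "f \<in> elems X" for f
    unfolding T_def \<rho>_def by (rule norm_combination[OF that])
  obtain R where R: "bounded_op X X R" "\<And>f. f \<in> elems X \<Longrightarrow> R f \<in> elems X"
    "\<And>f. f \<in> elems X \<Longrightarrow> eq_in X (R (\<lambda>x. f x - T f x)) f"
    "\<And>f. f \<in> elems X \<Longrightarrow> eq_in X (\<lambda>x. R f x - T (R f) x) f"
    by (rule X.neumann_series[OF T T_le \<rho>], assumption, rule that) blast+
  have diff: "(\<lambda>x. f x - T f x) = (\<lambda>x. \<alpha> * (c * f x - S f x))" for f
    by (simp add: T_def algebra_simps)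
  obtain C where C: "\<And>f. f \<in> elems X \<Longrightarrow> snorm X (R f) \<le> C * snorm X f"
    using R(1) by (auto simp: bounded_op_def)
  show thesis
  proof (rule that[of "\<lambda>f. R (\<lambda>x. \<alpha> * f x)"])
    have lin: "linear_op X X R" using R(1) by (simp add: bounded_op_def)
    have "linear_op X X (\<lambda>f. R (\<lambda>x. \<alpha> * f x))"
      unfolding linear_op_def
    proof (intro conjI ballI allI)
      fix f g assume fg: "f \<in> elems X" "g \<in> elems X"
      show "eq_in X (R (\<lambda>x. \<alpha> * (f x + g x))) (\<lambda>y. R (\<lambda>x. \<alpha> * f x) y + R (\<lambda>x. \<alpha> * g x) y)"
        using linear_opD(2)[OF lin X.scale_in[OF fg(1), of \<alpha>] X.scale_in[OF fg(2), of \<alpha>]]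
        by (simp add: distrib_left)
    next
      fix d f assume f: "f \<in> elems X"
      show "eq_in X (R (\<lambda>x. \<alpha> * (d * f x))) (\<lambda>y. d * R (\<lambda>x. \<alpha> * f x) y)"
        using linear_opD(3)[OF lin X.scale_in[OF f, of \<alpha>], of d] by (simp add: mult.left_commute)
    qed (use R(2) in auto)
    moreover have "snorm X (R (\<lambda>x. \<alpha> * f x)) \<le> (C * cmod \<alpha>) * snorm X f" if "f \<in> elems X" for f
      using C[of "\<lambda>x. \<alpha> * f x"] that by (simp add: X.norm_scale mult.assoc)
    ultimately show "bounded_op X X (\<lambda>f. R (\<lambda>x. \<alpha> * f x))" by (auto simp: bounded_op_def)
    show "eq_in X (R (\<lambda>x. \<alpha> * (c * f x - S f x))) f" if "f \<in> elems X" for f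
      using R(3)[OF that] by (simp add: diff)
    show "eq_in X (\<lambda>x. c * R (\<lambda>x. \<alpha> * f x) x - S (R (\<lambda>x. \<alpha> * f x)) x) f" if f: "f \<in> elems X" for f
    proof -
      let ?g = "\<lambda>x. \<alpha> * f x"
      have g: "?g \<in> elems X" using f by simp
      have "eq_in X (\<lambda>x. \<alpha> * (c * R ?g x - S (R ?g) x)) ?g"
        using R(4)[OF g] by (simp add: diff)
      then have "snorm X (\<lambda>x. \<alpha> * ((c * R ?g x - S (R ?g) x) - f x)) = 0"
        by (simp add: eq_in_def algebra_simps)
      then show ?thesis
        using X.norm_scale[of "\<lambda>x. (c * R ?g x - S (R ?g) x) - f x" \<alpha>] \<alpha>(1) f R(2)[OF g]
        by (simp add: eq_in_def)
    qed
  qed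
qed

text \<open>Stated for any \<open>T\<close> that represents \<open>S\<close> up to null functions,
  because the transform on L^2 agrees with \<open>A V\<close> only on (0, 1).\<close>

lemma spectrum_subset:
  assumes T: "\<And>f. f \<in> elems X \<Longrightarrow> T f \<in> elems X" "\<And>f. f \<in> elems X \<Longrightarrow> eq_in X (S f) (T f)"
  shows "spectrum_op X T \<subseteq> complex_of_real ` {0..K}"
proof (rule subsetI, rule ccontr)
  fix c assume "c \<in> spectrum_op X T" and c: "c \<notin> complex_of_real ` {0..K}"
  note Xc = X.complete_fun_space_axioms
  obtain R where R: "bounded_op X X R"
    "\<And>f. f \<in> elems X \<Longrightarrow> eq_in X (R (\<lambda>x. c * f x - S f x)) f"
    "\<And>f. f \<in> elems X \<Longrightarrow> eq_in X (\<lambda>x. c * R f x - S (R f) x) f"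
    using resolvent[OF c] by blast
  note R_in = bounded_opD(2)[OF R(1)]
  have sub: "eq_in X (\<lambda>x. h x - T f x) (\<lambda>x. h x - S f x)" if "f \<in> elems X" "h \<in> elems X" for f h
    using T(2)[OF that(1)] by (simp add: eq_in_def)
  have "eq_in X (R (\<lambda>x. c * f x - T f x)) f" if f: "f \<in> elems X" for f
  proof -
    have "eq_in X (R (\<lambda>x. c * f x - T f x)) (R (\<lambda>x. c * f x - S f x))"
      by (rule bounded_op_cong[OF Xc Xc R(1) _ _ sub]) (use f T(1) in auto)
    then show ?thesis
      by (rule X.eq_in_trans[rotated 3, OF _ R(2)[OF f]]) (use f T(1) in \<open>auto intro!: R_in\<close>)
  qed
  moreover have "eq_in X (\<lambda>x. c * R f x - T (R f) x) f" if f: "f \<in> elems X" for f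
    by (rule X.eq_in_trans[OF _ _ _ sub R(3)[OF f]]) (use f T(1) R_in in auto)
  ultimately have "c \<notin> spectrum_op X T" using R(1) by (auto simp: spectrum_op_def)
  with \<open>c \<in> spectrum_op X T\<close> show False by blast
qed

end

section \<open>The spaces \<open>L\<^sup>p\<close>\<close>

text \<open>Over a general measure, so that sequence space l^2, taken with counting measure, shares
  completeness and inner product with L^2(0, 1).\<close>

definition Lp_space :: "'a measure \<Rightarrow> real \<Rightarrow> 'a fun_space" where
  "Lp_space M p = \<lparr>
     elems = {f. f \<in> borel_measurable M \<and> integrable M (\<lambda>t. cmod (f t) powr p)},
     snorm = (\<lambda>f. (LINT t|M. cmod (f t) powr p) powr (1 / p)) \<rparr>"

lemma Lp01_eq_Lp_space: "Lp01 p = Lp_space (lebesgue_on {0<..<1}) p"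
  by (simp add: Lp01_def Lp_space_def)

lemma Lp_space_mem:
  "f \<in> elems (Lp_space M p) \<longleftrightarrow> f \<in> borel_measurable M \<and> integrable M (\<lambda>t. cmod (f t) powr p)"
  by (simp add: Lp_space_def)

lemma Lp_space_measurable [measurable_dest]: "f \<in> elems (Lp_space M p) \<Longrightarrow> f \<in> borel_measurable M"
  by (simp add: Lp_space_mem)

lemma Lp_space_snorm: "snorm (Lp_space M p) f = (LINT t|M. cmod (f t) powr p) powr (1 / p)"
  by (simp add: Lp_space_def)

lemma Lp_space_nonneg: "0 \<le> snorm (Lp_space M p) f"
  by (simp add: Lp_space_snorm)

lemma Lp_space_snorm_powr:
  "p > 0 \<Longrightarrow> snorm (Lp_space M p) f powr p = (LINT t|M. cmod (f t) powr p)"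
  by (simp add: Lp_space_snorm powr_powr integral_nonneg_AE)

lemma Lp_space_nn_integral:
  assumes "p > 0" "f \<in> elems (Lp_space M p)"
  shows "(\<integral>\<^sup>+t. ennreal (cmod (f t) powr p) \<partial>M) = ennreal (snorm (Lp_space M p) f powr p)"
  using assms by (simp add: Lp_space_snorm_powr Lp_space_mem nn_integral_eq_integral)

lemma Lp_spaceI:
  assumes "p > 0" "f \<in> borel_measurable M" "0 \<le> C"
    and "(\<integral>\<^sup>+t. ennreal (cmod (f t) powr p) \<partial>M) \<le> ennreal (C powr p)"
  shows "f \<in> elems (Lp_space M p)" "snorm (Lp_space M p) f \<le> C"
proof -
  have "(\<integral>\<^sup>+t. ennreal (cmod (f t) powr p) \<partial>M) < \<infinity>"
    using assms(4) by (simp add: le_less_trans[of _ "ennreal (C powr p)"])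
  then show f: "f \<in> elems (Lp_space M p)"
    using assms(2) by (auto simp: Lp_space_mem intro!: integrableI_nonneg)
  have "snorm (Lp_space M p) f powr p \<le> C powr p"
    using assms(4) Lp_space_nn_integral[OF assms(1) f] by simp
  then show "snorm (Lp_space M p) f \<le> C"
    using powr_less_mono2[of p C "snorm (Lp_space M p) f"] assms(1,3) by (meson not_le)
qed

lemma Lp_space_snorm_eq_0:
  assumes "p > 0" "f \<in> elems (Lp_space M p)"
  shows "snorm (Lp_space M p) f = 0 \<longleftrightarrow> (AE t in M. f t = 0)"
  using assms integral_nonneg_eq_0_iff_AE[of M "\<lambda>t. cmod (f t) powr p"]
  by (simp add: Lp_space_snorm Lp_space_mem)

lemma Lp_space_snorm_mono:
  assumes "p > 0" "f \<in> borel_measurable M" "g \<in> elems (Lp_space M p)"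
    and "AE t in M. cmod (f t) \<le> cmod (g t)"
  shows "f \<in> elems (Lp_space M p)" "snorm (Lp_space M p) f \<le> snorm (Lp_space M p) g"
proof -
  have "(\<integral>\<^sup>+t. ennreal (cmod (f t) powr p) \<partial>M) \<le> (\<integral>\<^sup>+t. ennreal (cmod (g t) powr p) \<partial>M)"
    using assms(4) by (intro nn_integral_mono_AE) (auto elim!: eventually_mono intro!: powr_mono2 simp: assms(1) less_imp_le)
  also have "\<dots> = ennreal (snorm (Lp_space M p) g powr p)"
    by (rule Lp_space_nn_integral[OF assms(1,3)])
  finally show "f \<in> elems (Lp_space M p)" "snorm (Lp_space M p) f \<le> snorm (Lp_space M p) g"
    using Lp_spaceI[OF assms(1,2) Lp_space_nonneg] by blast+
qed

lemma powr_add_le: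
  fixes x y :: real
  assumes "0 \<le> x" "0 \<le> y" "0 < p"
  shows "(x + y) powr p \<le> 2 powr p * (x powr p + y powr p)"
proof -
  have "(x + y) powr p \<le> (2 * max x y) powr p"
    using assms by (intro powr_mono2) auto
  also have "\<dots> = 2 powr p * max x y powr p"
    by (rule powr_mult)
  also have "max x y powr p \<le> x powr p + y powr p"
    by (simp add: max_def)
  finally show ?thesis by simp
qed

text \<open>If one argument is 0, the inequality reduces to
  \<open>\<theta> powr p \<le> \<theta>\<close> on [0, 1]; otherwise it is convexity on the positive
  half-line.\<close>

lemma powr_convex_combination:
  fixes x y \<theta> :: real
  assumes p: "1 \<le> p" and \<theta>: "0 \<le> \<theta>" "\<theta> \<le> 1" and xy: "0 \<le> x" "0 \<le> y"
  shows "(\<theta> * x + (1 - \<theta>) * y) powr p \<le> \<theta> * x powr p + (1 - \<theta>) * y powr p"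
proof -
  have le: "t powr p \<le> t" if "0 \<le> t" "t \<le> 1" for t :: real
    using powr_mono'[of 1 p t] p that by simp
  consider "x = 0" | "y = 0" | "x > 0" "y > 0" using xy by fastforce
  then show ?thesis
  proof cases
    case 3
    then show ?thesis
      using convex_onD[OF powr_convex[OF p], of "1 - \<theta>" x y] \<theta> by simp
  qed (use \<theta> xy le[of \<theta>] le[of "1 - \<theta>"] in \<open>auto simp: powr_mult intro!: mult_right_mono\<close>)
qed

lemma Lp_space_add:
  assumes p: "p > 0" and f: "f \<in> elems (Lp_space M p)" and g: "g \<in> elems (Lp_space M p)"
  shows "(\<lambda>x. f x + g x) \<in> elems (Lp_space M p)"
proof -
  have "integrable M (\<lambda>t. cmod (f t + g t) powr p)"
  proof (rule Bochner_Integration.integrable_bound)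
    show "integrable M (\<lambda>t. 2 powr p * (cmod (f t) powr p + cmod (g t) powr p))"
      using f g by (auto simp: Lp_space_mem)
    have "cmod (f t + g t) powr p \<le> 2 powr p * (cmod (f t) powr p + cmod (g t) powr p)" for t
      using order_trans[OF powr_mono2 powr_add_le[of "cmod (f t)" "cmod (g t)" p]]
        p norm_triangle_ineq[of "f t" "g t"] by simp
    then show "AE t in M. norm (cmod (f t + g t) powr p) \<le>
        norm (2 powr p * (cmod (f t) powr p + cmod (g t) powr p))"
      by (auto simp: abs_of_nonneg)
  qed (use f g in \<open>auto simp: Lp_space_mem\<close>)
  then show ?thesis using f g by (auto simp: Lp_space_mem)
qed

text \<open>Normalising \<open>f\<close> and \<open>g\<close> reduces this to the convexity of \<open>x powr p\<close>.\<close>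

lemma Lp_space_triangle:
  assumes p: "p \<ge> 1" and f: "f \<in> elems (Lp_space M p)" and g: "g \<in> elems (Lp_space M p)"
  shows "snorm (Lp_space M p) (\<lambda>x. f x + g x) \<le> snorm (Lp_space M p) f + snorm (Lp_space M p) g"
proof (rule field_le_epsilon)
  fix e :: real assume e: "e > 0"
  have p0: "p > 0" using p by simp
  \<comment> \<open>The summand \<open>e / 2\<close> makes the normalising constants positive even
    for null functions; \<open>e\<close> is arbitrary.\<close>
  define a where "a = snorm (Lp_space M p) f + e / 2"
  define b where "b = snorm (Lp_space M p) g + e / 2"
  define \<theta> where "\<theta> = a / (a + b)"
  have ab: "a > 0" "b > 0"
    unfolding a_def b_def using e Lp_space_nonneg by (auto intro!: add_nonneg_pos)
  have \<theta>: "0 \<le> \<theta>" "\<theta> \<le> 1" using ab by (auto simp: \<theta>_def)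
  have 1: "1 - \<theta> = b / (a + b)" using ab by (simp add: \<theta>_def field_simps)
  have pt: "cmod (f t + g t) powr p \<le>
      (a + b) powr p * (\<theta> * (cmod (f t) powr p / a powr p) + (1 - \<theta>) * (cmod (g t) powr p / b powr p))" for t
  proof -
    have "cmod (f t + g t) powr p \<le> ((a + b) * (\<theta> * (cmod (f t) / a) + (1 - \<theta>) * (cmod (g t) / b))) powr p"
      unfolding 1 unfolding \<theta>_def using ab p norm_triangle_ineq[of "f t" "g t"]
      by (intro powr_mono2) (auto simp: distrib_left)
    also have "\<dots> = (a + b) powr p * (\<theta> * (cmod (f t) / a) + (1 - \<theta>) * (cmod (g t) / b)) powr p"
      by (rule powr_mult)
    also have "\<dots> \<le> (a + b) powr p * (\<theta> * (cmod (f t) / a) powr p + (1 - \<theta>) * (cmod (g t) / b) powr p)"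
      using ab by (intro mult_left_mono powr_convex_combination p \<theta>) auto
    finally show ?thesis using ab by (simp add: powr_divide)
  qed
  have If: "integrable M (\<lambda>t. cmod (f t) powr p)" and Ig: "integrable M (\<lambda>t. cmod (g t) powr p)"
    and Ifg: "integrable M (\<lambda>t. cmod (f t + g t) powr p)"
    using f g Lp_space_add[OF p0 f g] by (auto simp: Lp_space_mem)
  have le: "snorm (Lp_space M p) f powr p / a powr p \<le> 1" "snorm (Lp_space M p) g powr p / b powr p \<le> 1"
    unfolding a_def b_def using e p0 Lp_space_nonneg[of M p] ab
    by (auto simp: a_def b_def intro!: powr_mono2)
  have "snorm (Lp_space M p) (\<lambda>x. f x + g x) powr p = (LINT t|M. cmod (f t + g t) powr p)"
    by (rule Lp_space_snorm_powr[OF p0])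
  also have "\<dots> \<le> (LINT t|M. (a + b) powr p * (\<theta> * (cmod (f t) powr p / a powr p) + (1 - \<theta>) * (cmod (g t) powr p / b powr p)))"
    using If Ig Ifg by (intro integral_mono pt) auto
  also have "\<dots> = (a + b) powr p * (\<theta> * (snorm (Lp_space M p) f powr p / a powr p)
      + (1 - \<theta>) * (snorm (Lp_space M p) g powr p / b powr p))"
    using If Ig by (simp add: Lp_space_snorm_powr[OF p0])
  also have "\<dots> \<le> (a + b) powr p * (\<theta> * 1 + (1 - \<theta>) * 1)"
    using \<theta> le by (intro mult_left_mono add_mono) auto
  finally have "snorm (Lp_space M p) (\<lambda>x. f x + g x) powr p \<le> (a + b) powr p" by simp
  then have "snorm (Lp_space M p) (\<lambda>x. f x + g x) \<le> a + b"
    using powr_less_mono2[of p "a + b" "snorm (Lp_space M p) (\<lambda>x. f x + g x)"] p0 ab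
    by (meson add_pos_pos less_imp_le not_le)
  then show "snorm (Lp_space M p) (\<lambda>x. f x + g x) \<le> snorm (Lp_space M p) f + snorm (Lp_space M p) g + e"
    by (simp add: a_def b_def)
qed

lemma Lp_space_scale:
  assumes p: "p > 0" and f: "f \<in> elems (Lp_space M p)"
  shows "(\<lambda>x. c * f x) \<in> elems (Lp_space M p)"
    "snorm (Lp_space M p) (\<lambda>x. c * f x) = cmod c * snorm (Lp_space M p) f"
  using p f by (auto simp: Lp_space_mem Lp_space_snorm norm_mult powr_mult powr_powr)

lemma Lp_space_zero: "p > 0 \<Longrightarrow> (\<lambda>x. 0) \<in> elems (Lp_space M p)"
  by (simp add: Lp_space_mem)

lemma Lp_space_norm_of_real:
  assumes "f \<in> elems (Lp_space M p)"
  shows "(\<lambda>x. complex_of_real (cmod (f x))) \<in> elems (Lp_space M p)"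
    "snorm (Lp_space M p) (\<lambda>x. complex_of_real (cmod (f x))) = snorm (Lp_space M p) f"
  using assms by (auto simp: Lp_space_mem Lp_space_snorm)

text \<open>A subsequence with increments below (1/2)^k has an increment series that converges
  absolutely almost everywhere, by monotone convergence. Fatou's lemma turns the pointwise limit
  into a limit in norm.\<close>

lemma Lp_space_Riesz_Fischer:
  assumes p: "p \<ge> 1" and F: "\<And>n. F n \<in> elems (Lp_space M p)"
    and Cauchy: "\<And>e. e > 0 \<Longrightarrow> \<exists>N. \<forall>m\<ge>N. \<forall>n\<ge>m. snorm (Lp_space M p) (\<lambda>x. F m x - F n x) < e"
  shows "\<exists>g\<in>elems (Lp_space M p). (\<lambda>n. snorm (Lp_space M p) (\<lambda>x. F n x - g x)) \<longlonglongrightarrow> 0"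
proof -
  let ?N = "snorm (Lp_space M p)"
  have p0: "p > 0" using p by simp
  have diff: "(\<lambda>x. f x - g x) \<in> elems (Lp_space M p)"
    if "f \<in> elems (Lp_space M p)" "g \<in> elems (Lp_space M p)" for f g
    using Lp_space_add[OF p0 that(1) Lp_space_scale(1)[OF p0 that(2), of "-1"]] by simp
  have "\<forall>k. \<exists>N. \<forall>m\<ge>N. \<forall>n\<ge>m. ?N (\<lambda>x. F m x - F n x) < (1 / 2) ^ k"
    using Cauchy by simp
  then obtain R where R: "\<And>k m n. m \<ge> R k \<Longrightarrow> n \<ge> m \<Longrightarrow> ?N (\<lambda>x. F m x - F n x) < (1 / 2) ^ k"
    by metis
  \<comment> \<open>One formula that is monotone and dominates both \<open>k\<close> and
    \<open>R k\<close>.\<close>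
  define r where "r k = k + (\<Sum>i\<le>k. R i)" for k
  have r_ge: "R k \<le> r k" "k \<le> r k" for k
    unfolding r_def using member_le_sum[of k "{..k}" R] by auto
  have r_mono: "r k \<le> r (Suc k)" for k by (simp add: r_def)
  define d where "d k x = F (r k) x - F (r (Suc k)) x" for k x
  have d: "d k \<in> elems (Lp_space M p)" "?N (d k) < (1 / 2) ^ k" for k
    unfolding d_def using R[OF r_ge(1) r_mono, of k] diff F by auto
  define G where "G n x = (\<Sum>k<n. cmod (d k x))" for n x
  have G: "(\<lambda>x. complex_of_real (G n x)) \<in> elems (Lp_space M p) \<and>
      ?N (\<lambda>x. complex_of_real (G n x)) \<le> (\<Sum>k<n. (1 / 2) ^ k)" for n
  proof (induction n)
    case 0
    then show ?case using Lp_space_zero[OF p0] p0 by (simp add: G_def Lp_space_snorm)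
  next
    case (Suc n)
    have eq: "(\<lambda>x. complex_of_real (G (Suc n) x)) =
        (\<lambda>x. complex_of_real (G n x) + complex_of_real (cmod (d n x)))"
      by (simp add: G_def)
    have dn: "(\<lambda>x. complex_of_real (cmod (d n x))) \<in> elems (Lp_space M p)"
      "?N (\<lambda>x. complex_of_real (cmod (d n x))) = ?N (d n)"
      using Lp_space_norm_of_real[OF d(1)] by blast+
    have "?N (\<lambda>x. complex_of_real (G n x) + complex_of_real (cmod (d n x)))
        \<le> (\<Sum>k<n. (1 / 2) ^ k) + (1 / 2) ^ n"
      using Lp_space_triangle[OF p conjunct1[OF Suc.IH] dn(1)] Suc.IH d(2)[of n] dn(2) by linarith
    then show ?case unfolding eq using Lp_space_add[OF p0 conjunct1[OF Suc.IH] dn(1)] by simp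
  qed
  have G2: "?N (\<lambda>x. complex_of_real (G n x)) \<le> 2" for n
  proof -
    have "(\<Sum>k<n. (1 / 2) ^ k) \<le> (\<Sum>k. (1 / 2 :: real) ^ k)"
      by (intro sum_le_suminf summable_geometric) auto
    then show ?thesis using G[of n] suminf_geometric[of "1/2 :: real"] by simp
  qed
  have G_nonneg: "0 \<le> G n x" for n x by (simp add: G_def sum_nonneg)
  have G_inc: "G n x \<le> G (Suc n) x" for n x by (simp add: G_def)
  have [measurable]: "F n \<in> borel_measurable M" for n using F by (auto simp: Lp_space_mem)
  have [measurable]: "d n \<in> borel_measurable M" for n using d by (auto simp: Lp_space_mem)
  have [measurable]: "G n \<in> borel_measurable M" for n unfolding G_def by measurable
  have "(\<integral>\<^sup>+x. (SUP n. ennreal (G n x powr p)) \<partial>M) = (SUP n. \<integral>\<^sup>+x. ennreal (G n x powr p) \<partial>M)"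
    using G_inc G_nonneg p0
    by (intro nn_integral_monotone_convergence_SUP)
       (auto intro!: incseq_SucI le_funI ennreal_leI powr_mono2)
  also have "\<dots> \<le> ennreal (2 powr p)"
  proof (rule SUP_least)
    fix n
    have "(\<integral>\<^sup>+x. ennreal (G n x powr p) \<partial>M) = ennreal (?N (\<lambda>x. complex_of_real (G n x)) powr p)"
      using Lp_space_nn_integral[OF p0, of "\<lambda>x. complex_of_real (G n x)" M] G[of n] G_nonneg by simp
    also have "\<dots> \<le> ennreal (2 powr p)"
      using G2[of n] p0 Lp_space_nonneg by (intro ennreal_leI powr_mono2) auto
    finally show "(\<integral>\<^sup>+x. ennreal (G n x powr p) \<partial>M) \<le> ennreal (2 powr p)" .
  qed
  finally have fin: "(\<integral>\<^sup>+x. (SUP n. ennreal (G n x powr p)) \<partial>M) \<noteq> \<infinity>"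
    by (metis ennreal_less_top infinity_ennreal_def leD)
  have "AE x in M. (SUP n. ennreal (G n x powr p)) \<noteq> \<infinity>"
    by (rule nn_integral_PInf_AE[OF _ fin]) measurable
  then have conv: "AE x in M. convergent (\<lambda>k. F (r k) x)"
  proof (rule eventually_mono)
    fix x assume fin: "(SUP n. ennreal (G n x powr p)) \<noteq> \<infinity>"
    then obtain B where B: "0 \<le> B" "(SUP n. ennreal (G n x powr p)) = ennreal B"
      by (cases "SUP n. ennreal (G n x powr p)") auto
    have "G n x \<le> B powr (1 / p)" for n
    proof -
      have "ennreal (G n x powr p) \<le> ennreal B" unfolding B(2)[symmetric] by (rule SUP_upper) simp
      then have "G n x powr p \<le> B" using B(1) by simp
      then have "(G n x powr p) powr (1 / p) \<le> B powr (1 / p)"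
        using p0 by (intro powr_mono2) auto
      then show ?thesis using p0 G_nonneg by (simp add: powr_powr)
    qed
    then have "summable (\<lambda>k. cmod (d k x))"
      by (intro summableI_nonneg_bounded) (auto simp: G_def)
    then have "summable (\<lambda>k. d k x)" by (rule summable_norm_cancel)
    then have "convergent (\<lambda>n. F (r 0) x - (\<Sum>k<n. d k x))"
      by (intro convergent_diff convergent_const) (simp add: summable_iff_convergent)
    moreover have "F (r 0) x - (\<Sum>k<n. d k x) = F (r n) x" for n
      using sum_lessThan_telescope'[of "\<lambda>k. F (r k) x" n] by (simp add: d_def)
    ultimately show "convergent (\<lambda>k. F (r k) x)" by simp
  qed
  define g where "g x = lim (\<lambda>k. F (r k) x)" for x
  have [measurable]: "g \<in> borel_measurable M" unfolding g_def by measurable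
  have lim: "AE x in M. (\<lambda>k. F (r k) x) \<longlonglongrightarrow> g x"
    using conv by (rule eventually_mono) (simp add: g_def convergent_LIMSEQ_iff)
  \<comment> \<open>Fatou's lemma along the subsequence. Membership of \<open>g\<close> itself then
    follows from that of \<open>F N - g\<close>.\<close>
  have bound: "(\<lambda>x. F m x - g x) \<in> elems (Lp_space M p) \<and> ?N (\<lambda>x. F m x - g x) \<le> e"
    if e: "e > 0" and N: "\<forall>m\<ge>N. \<forall>n\<ge>m. ?N (\<lambda>x. F m x - F n x) < e" and m: "m \<ge> N" for e N m
  proof -
    have "(\<integral>\<^sup>+x. ennreal (cmod (F m x - g x) powr p) \<partial>M) =
        (\<integral>\<^sup>+x. liminf (\<lambda>k. ennreal (cmod (F m x - F (r k) x) powr p)) \<partial>M)"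
    proof (rule nn_integral_cong_AE, use lim in \<open>rule eventually_mono\<close>)
      fix x assume "(\<lambda>k. F (r k) x) \<longlonglongrightarrow> g x"
      then have "(\<lambda>k. cmod (F m x - F (r k) x) powr p) \<longlonglongrightarrow> cmod (F m x - g x) powr p"
        using p0 by (intro tendsto_powr' tendsto_intros) auto
      then show "ennreal (cmod (F m x - g x) powr p) =
          liminf (\<lambda>k. ennreal (cmod (F m x - F (r k) x) powr p))"
        by (intro lim_imp_Liminf[symmetric] tendsto_ennrealI) auto
    qed
    also have "\<dots> \<le> liminf (\<lambda>k. \<integral>\<^sup>+x. ennreal (cmod (F m x - F (r k) x) powr p) \<partial>M)"
      by (rule nn_integral_liminf) measurable
    also have "\<dots> \<le> ennreal (e powr p)"
    proof -
      have "\<forall>\<^sub>F k in sequentially. (\<integral>\<^sup>+x. ennreal (cmod (F m x - F (r k) x) powr p) \<partial>M) \<le> ennreal (e powr p)"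
        unfolding eventually_sequentially
      proof (intro exI allI impI)
        fix k assume "m \<le> k"
        then have "m \<le> r k" using r_ge(2)[of k] by simp
        then have "?N (\<lambda>x. F m x - F (r k) x) < e" using N m by simp
        then have "?N (\<lambda>x. F m x - F (r k) x) powr p \<le> e powr p"
          using p0 Lp_space_nonneg by (intro powr_mono2) auto
        then show "(\<integral>\<^sup>+x. ennreal (cmod (F m x - F (r k) x) powr p) \<partial>M) \<le> ennreal (e powr p)"
          using Lp_space_nn_integral[OF p0 diff[OF F F]] by (simp add: ennreal_leI)
      qed
      then show ?thesis
        using Liminf_mono[of "\<lambda>k. \<integral>\<^sup>+x. ennreal (cmod (F m x - F (r k) x) powr p) \<partial>M"
            "\<lambda>_. ennreal (e powr p)" sequentially] by (simp add: Liminf_const)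
    qed
    finally show ?thesis using e by (intro conjI Lp_spaceI[OF p0, where C = e]) auto
  qed
  obtain N where N: "\<forall>m\<ge>N. \<forall>n\<ge>m. ?N (\<lambda>x. F m x - F n x) < 1" using Cauchy[of 1] by auto
  have "(\<lambda>x. F N x - g x) \<in> elems (Lp_space M p)"
    using bound[OF zero_less_one N order_refl] by simp
  from diff[OF F this, of N] have g: "g \<in> elems (Lp_space M p)" by simp
  have "(\<lambda>n. ?N (\<lambda>x. F n x - g x)) \<longlonglongrightarrow> 0"
  proof (rule LIMSEQ_I)
    fix e :: real assume e: "e > 0"
    obtain N where "\<forall>m\<ge>N. \<forall>n\<ge>m. ?N (\<lambda>x. F m x - F n x) < e / 2"
      using Cauchy[of "e / 2"] e by auto
    then have "?N (\<lambda>x. F m x - g x) < e" if "m \<ge> N" for m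
      using bound[of "e / 2" N m] e that by auto
    then show "\<exists>N. \<forall>n\<ge>N. norm (?N (\<lambda>x. F n x - g x) - 0) < e"
      by (intro exI[of _ N]) (simp add: Lp_space_nonneg)
  qed
  with g show ?thesis by blast
qed

lemma complete_fun_space_Lp: "p \<ge> 1 \<Longrightarrow> complete_fun_space (Lp_space M p)"
  using Lp_space_zero[of p M] Lp_space_add[of p _ M] Lp_space_scale[of p _ M] Lp_space_triangle[of p _ M]
    Lp_space_Riesz_Fischer[of p _ M]
  by unfold_locales auto

section \<open>The inner product of L^2\<close>

definition L2_ip :: "'a measure \<Rightarrow> ('a \<Rightarrow> complex) \<Rightarrow> ('a \<Rightarrow> complex) \<Rightarrow> complex" where
  "L2_ip M f g = (LINT t|M. f t * cnj (g t))"

lemma L2_integrable_mult: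
  assumes "f \<in> elems (Lp_space M 2)" "g \<in> elems (Lp_space M 2)"
  shows "integrable M (\<lambda>t. f t * g t)"
proof (rule Bochner_Integration.integrable_bound)
  show "integrable M (\<lambda>t. (cmod (f t))\<^sup>2 + (cmod (g t))\<^sup>2)"
    using assms by (auto simp: Lp_space_mem)
  have "cmod (f t) * cmod (g t) \<le> (cmod (f t))\<^sup>2 + (cmod (g t))\<^sup>2" for t
  proof -
    have "2 * (cmod (f t) * cmod (g t)) \<le> (cmod (f t))\<^sup>2 + (cmod (g t))\<^sup>2"
      using sum_squares_bound[of "cmod (f t)" "cmod (g t)"] by (simp add: mult.assoc)
    moreover have "0 \<le> cmod (f t) * cmod (g t)" by simp
    ultimately show ?thesis by linarith
  qed
  then show "AE t in M. norm (f t * g t) \<le> norm ((cmod (f t))\<^sup>2 + (cmod (g t))\<^sup>2)"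
    by (auto simp: norm_mult)
qed (use assms in \<open>auto simp: Lp_space_mem\<close>)

lemma Lp_space_cnj: "g \<in> elems (Lp_space M p) \<Longrightarrow> (\<lambda>t. cnj (g t)) \<in> elems (Lp_space M p)"
  using measurable_compose[OF _ borel_measurable_continuous_onI[OF continuous_on_cnj[OF continuous_on_id]], of g M]
  by (auto simp: Lp_space_mem)

lemma L2_snorm_sq: "(snorm (Lp_space M 2) f)\<^sup>2 = (LINT t|M. (cmod (f t))\<^sup>2)"
  using Lp_space_snorm_powr[of 2 M f] Lp_space_nonneg[of M 2 f] by simp

lemma semi_hilbert_L2: "semi_hilbert (Lp_space M 2) (L2_ip M)"
proof -
  interpret complete_fun_space "Lp_space M 2" by (rule complete_fun_space_Lp) simp
  note int = L2_integrable_mult[OF _ Lp_space_cnj]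
  show ?thesis
  proof
    show "L2_ip M (\<lambda>x. f x + g x) h = L2_ip M f h + L2_ip M g h"
      if "f \<in> elems (Lp_space M 2)" "g \<in> elems (Lp_space M 2)" "h \<in> elems (Lp_space M 2)" for f g h
      unfolding L2_ip_def using int[OF that(1,3)] int[OF that(2,3)] by (simp add: distrib_right)
    show "L2_ip M (\<lambda>x. c * f x) h = c * L2_ip M f h" for c f h
      unfolding L2_ip_def by (simp add: mult.assoc)
    show "L2_ip M g f = cnj (L2_ip M f g)" for f g
      unfolding L2_ip_def
      by (subst Bochner_Integration.integral_cnj[symmetric]) (simp only: complex_cnj_mult complex_cnj_cnj mult.commute)
    show "L2_ip M f f = of_real ((snorm (Lp_space M 2) f)\<^sup>2)" for f
    proof -
      have "L2_ip M f f = (LINT t|M. complex_of_real ((cmod (f t))\<^sup>2))"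
        unfolding L2_ip_def by (intro Bochner_Integration.integral_cong refl) (simp only: complex_norm_square)
      then show ?thesis by (simp add: L2_snorm_sq del: of_real_power)
    qed
  qed
qed

section \<open>The Schur test\<close>

lemma Gamma_reflection_real:
  fixes a :: real
  shows "Gamma a * Gamma (1 - a) = pi / sin (pi * a)"
proof -
  have "complex_of_real (Gamma a * Gamma (1 - a)) = Gamma (of_real a) * Gamma (1 - of_real a)"
    by (simp flip: Gamma_complex_of_real)
  also have "\<dots> = of_real pi / sin (of_real pi * of_real a)"
    by (rule Gamma_reflection_complex)
  also have "\<dots> = of_real (pi / sin (pi * a))"
    by (simp only: of_real_mult[symmetric] sin_of_real of_real_divide)
  finally have "complex_of_real (Gamma a * Gamma (1 - a)) = complex_of_real (pi / sin (pi * a))" .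
  then show ?thesis using of_real_eq_iff by blast
qed

lemma absolutely_integrable_lebesgue_on:
  fixes f :: "real \<Rightarrow> real"
  assumes "f absolutely_integrable_on S" "S \<in> sets lebesgue"
  shows "integrable (lebesgue_on S) f" "(LINT t|lebesgue_on S. f t) = integral S f"
proof -
  show "integrable (lebesgue_on S) f"
    using assms by (simp add: integrable_restrict_space set_integrable_def)
  then show "(LINT t|lebesgue_on S. f t) = integral S f"
    using assms(2) by (rule lebesgue_integral_eq_integral)
qed

text \<open>The substitution \<open>t = y / (1 - z + y)\<close> maps the half-line onto (0, 1), and
  \<open>z\<close> survives only in the factor \<open>(1 - z) powr (- a)\<close>. As an equivalence
  it can be used twice: at \<open>z = 0\<close> to evaluate the half-line integral by the beta
  function, and then for every \<open>z < 1\<close>.\<close>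

lemma beta_kernel_substitution:
  fixes a z b :: real
  assumes a: "0 < a" "a < 1" and z: "z < 1"
  defines "f \<equiv> \<lambda>t. t powr (a - 1) * (1 - t) powr (- a) / (1 - t * z)"
  shows "f absolutely_integrable_on {0<..<1} \<and> integral {0<..<1} f = (1 - z) powr (- a) * b
     \<longleftrightarrow> (\<lambda>y. y powr (a - 1) / (1 + y)) absolutely_integrable_on {0<..} \<and>
       integral {0<..} (\<lambda>y. y powr (a - 1) / (1 + y)) = b"
proof -
  define c where "c = 1 - z"
  have c: "c > 0" using z by (simp add: c_def)
  define g where "g y = y / (c + y)" for y
  define g' where "g' y = c / (c + y)\<^sup>2" for y
  have der: "(g has_field_derivative g' y) (at y within {0<..})" if "y \<in> {0<..}" for y
    unfolding g_def g'_def using that c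
    by (auto intro!: derivative_eq_intros simp: field_simps power2_eq_square)
  have inj: "inj_on g {0<..}"
    unfolding g_def using c by (auto simp: inj_on_def field_simps)
  have img: "g ` {0<..} = {0<..<1}"
  proof (intro equalityI subsetI)
    fix t :: real assume t: "t \<in> {0<..<1}"
    then have "t = g (c * t / (1 - t))" using c by (simp add: g_def field_simps)
    moreover have "c * t / (1 - t) \<in> {0<..}" using t c by simp
    ultimately show "t \<in> g ` {0<..}" by blast
  qed (use c in \<open>auto simp: g_def field_simps\<close>)
  have eq: "\<bar>g' y\<bar> * f (g y) = c powr (- a) * (y powr (a - 1) / (1 + y))" if y: "y \<in> {0<..}" for y
  proof -
    have y0: "y > 0" "c + y > 0" using y c by auto
    have "1 - g y = c / (c + y)" using y0 by (simp add: g_def field_simps)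
    moreover have "1 - g y * z = c * (1 + y) / (c + y)"
      using y0 by (simp add: g_def c_def field_simps)
    moreover have "g y powr (a - 1) = y powr (a - 1) * (c + y) / (c + y) powr a"
      unfolding g_def using y0 by (simp add: powr_divide powr_diff)
    moreover have "(c / (c + y)) powr (- a) = c powr (- a) * (c + y) powr a"
      using y0 c by (simp add: powr_divide powr_minus_divide)
    ultimately show ?thesis
      using y0 c by (simp add: f_def g'_def power2_eq_square)
  qed
  have "f absolutely_integrable_on {0<..<1} \<and> integral {0<..<1} f = c powr (- a) * b \<longleftrightarrow>
      (\<lambda>y. \<bar>g' y\<bar> * f (g y)) absolutely_integrable_on {0<..} \<and>
      integral {0<..} (\<lambda>y. \<bar>g' y\<bar> * f (g y)) = c powr (- a) * b"
    using has_absolute_integral_change_of_variables_1'[of "{0<..}" g g' f "c powr (- a) * b"] der inj img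
    by simp
  also have "\<dots> \<longleftrightarrow> (\<lambda>y. c powr (- a) * (y powr (a - 1) / (1 + y))) absolutely_integrable_on {0<..} \<and>
      integral {0<..} (\<lambda>y. c powr (- a) * (y powr (a - 1) / (1 + y))) = c powr (- a) * b"
    using eq
    by (intro arg_cong2[of _ _ _ _ "(\<and>)"] arg_cong2[of _ _ _ _ "(=)"] refl integral_cong
        set_integrable_cong) auto
  also have "\<dots> \<longleftrightarrow> (\<lambda>y. y powr (a - 1) / (1 + y)) absolutely_integrable_on {0<..} \<and>
       integral {0<..} (\<lambda>y. y powr (a - 1) / (1 + y)) = b"
    using c by (simp del: times_divide_eq_right)
  finally show ?thesis by (simp add: c_def)
qed

lemma beta_kernel_half_line:
  fixes a :: real
  assumes a: "0 < a" "a < 1"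
  shows "(\<lambda>y. y powr (a - 1) / (1 + y)) absolutely_integrable_on {0<..}"
    "integral {0<..} (\<lambda>y. y powr (a - 1) / (1 + y)) = pi / sin (pi * a)"
proof -
  let ?f = "\<lambda>t. t powr (a - 1) * (1 - t) powr (- a)"
  have "((\<lambda>t. t powr (a - 1) * (1 - t) powr (1 - a - 1)) has_integral Beta a (1 - a)) {0..1}"
    using a by (intro has_integral_Beta_real) auto
  then have "(?f has_integral pi / sin (pi * a)) {0<..<1}"
    using Gamma_reflection_real[of a] by (simp add: has_integral_Icc_iff_Ioo Beta_def)
  then have "?f absolutely_integrable_on {0<..<1}" "integral {0<..<1} ?f = pi / sin (pi * a)"
    by (auto simp: has_integral_iff absolutely_integrable_on_iff_nonneg)
  then show "(\<lambda>y. y powr (a - 1) / (1 + y)) absolutely_integrable_on {0<..}"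
    "integral {0<..} (\<lambda>y. y powr (a - 1) / (1 + y)) = pi / sin (pi * a)"
    using beta_kernel_substitution[OF a, of 0 "pi / sin (pi * a)"] by simp_all
qed

lemma beta_kernel_integral:
  fixes a z :: real
  assumes "0 < a" "a < 1" "z < 1"
  shows "integrable (lebesgue_on {0<..<1}) (\<lambda>t. t powr (a - 1) * (1 - t) powr (- a) / (1 - t * z))"
    "(LINT t|lebesgue_on {0<..<1}. t powr (a - 1) * (1 - t) powr (- a) / (1 - t * z))
       = pi / sin (pi * a) * (1 - z) powr (- a)"
proof -
  have *: "(\<lambda>t. t powr (a - 1) * (1 - t) powr (- a) / (1 - t * z)) absolutely_integrable_on {0<..<1}"
    "integral {0<..<1} (\<lambda>t. t powr (a - 1) * (1 - t) powr (- a) / (1 - t * z))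
       = pi / sin (pi * a) * (1 - z) powr (- a)"
    using beta_kernel_substitution[OF assms, of "pi / sin (pi * a)"] beta_kernel_half_line[OF assms(1,2)]
    by (simp_all add: mult.commute)
  then show "integrable (lebesgue_on {0<..<1}) (\<lambda>t. t powr (a - 1) * (1 - t) powr (- a) / (1 - t * z))"
    "(LINT t|lebesgue_on {0<..<1}. t powr (a - 1) * (1 - t) powr (- a) / (1 - t * z))
       = pi / sin (pi * a) * (1 - z) powr (- a)"
    using absolutely_integrable_lebesgue_on[OF *(1)] by simp_all
qed

text \<open>Hoelder's inequality for the measure with density \<open>w\<close>, from Young's
  inequality for \<open>\<phi> / m\<close> with a free scale \<open>m\<close>, optimised at the
  end.\<close>

lemma nn_integral_Holder_weight:
  fixes w \<phi> :: "'a \<Rightarrow> real"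
  assumes p: "p > 1" and [measurable]: "w \<in> borel_measurable M" "\<phi> \<in> borel_measurable M"
    and nn: "\<And>x. x \<in> space M \<Longrightarrow> 0 \<le> w x" "\<And>x. x \<in> space M \<Longrightarrow> 0 \<le> \<phi> x"
    and N: "(\<integral>\<^sup>+x. ennreal (w x) \<partial>M) \<le> ennreal N" "N > 0"
    and J: "(\<integral>\<^sup>+x. ennreal (w x * \<phi> x powr p) \<partial>M) \<le> ennreal J" "J \<ge> 0"
  shows "(\<integral>\<^sup>+x. ennreal (w x * \<phi> x) \<partial>M) \<le> ennreal (N powr (1 - 1 / p) * J powr (1 / p))"
proof -
  have *: "(\<integral>\<^sup>+x. ennreal (w x * \<phi> x) \<partial>M) \<le> ennreal (m powr (1 - p) / p * J + m * (1 - 1 / p) * N)"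
    if m: "m > 0" for m
  proof -
    have Young: "s \<le> m powr (1 - p) / p * s powr p + m * (1 - 1 / p)" if s: "s \<ge> 0" for s
    proof -
      have "(s / m) * 1 \<le> (s / m) powr p / p + 1 powr (p / (p - 1)) / (p / (p - 1))"
        using p m s by (intro Youngs_inequality) (auto simp: field_simps)
      then have "m * (s / m) \<le> m * ((s / m) powr p / p + (1 - 1 / p))"
        using m p by (intro mult_left_mono) (auto simp: field_simps)
      then show ?thesis
        using m s by (simp add: powr_divide powr_diff field_simps)
    qed
    have "(\<integral>\<^sup>+x. ennreal (w x * \<phi> x) \<partial>M) \<le>
        (\<integral>\<^sup>+x. ennreal (m powr (1 - p) / p) * ennreal (w x * \<phi> x powr p) + ennreal (m * (1 - 1 / p)) * ennreal (w x) \<partial>M)"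
    proof (rule nn_integral_mono)
      fix x assume x: "x \<in> space M"
      have "w x * \<phi> x \<le> w x * (m powr (1 - p) / p * \<phi> x powr p + m * (1 - 1 / p))"
        using Young[OF nn(2)[OF x]] nn(1)[OF x] by (intro mult_left_mono) auto
      also have "\<dots> = (m powr (1 - p) / p) * (w x * \<phi> x powr p) + (m * (1 - 1 / p)) * w x"
        by (simp add: algebra_simps)
      finally show "ennreal (w x * \<phi> x) \<le> ennreal (m powr (1 - p) / p) * ennreal (w x * \<phi> x powr p) + ennreal (m * (1 - 1 / p)) * ennreal (w x)"
        using nn[OF x] p m by (simp add: ennreal_leI flip: ennreal_mult ennreal_plus)
    qed
    also have "\<dots> = ennreal (m powr (1 - p) / p) * (\<integral>\<^sup>+x. ennreal (w x * \<phi> x powr p) \<partial>M)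
        + ennreal (m * (1 - 1 / p)) * (\<integral>\<^sup>+x. ennreal (w x) \<partial>M)"
      by (simp add: nn_integral_add nn_integral_cmult)
    also have "\<dots> \<le> ennreal (m powr (1 - p) / p) * ennreal J + ennreal (m * (1 - 1 / p)) * ennreal N"
      by (intro add_mono mult_left_mono J N) auto
    also have "\<dots> = ennreal (m powr (1 - p) / p * J + m * (1 - 1 / p) * N)"
      using p m J N by (simp flip: ennreal_mult ennreal_plus)
    finally show ?thesis .
  qed
  show ?thesis
  proof (cases "J = 0")
    case False
    then have J0: "J > 0" using J by simp
    \<comment> \<open>At this scale \<open>m * N\<close> and \<open>m powr (1 - p) * J\<close>
      agree, so the weights \<open>1 / p\<close> and \<open>1 - 1 / p\<close> add up to the
      bound.\<close>
    define m where "m = (J / N) powr (1 / p)"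
    have m: "m > 0" using J0 N by (simp add: m_def)
    have "m * N = N powr (1 - 1 / p) * J powr (1 / p)"
      using J0 N by (simp add: m_def powr_divide powr_diff)
    moreover have "m powr (1 - p) * J = N powr (1 - 1 / p) * J powr (1 / p)"
    proof -
      have "m powr (1 - p) = J powr (1 / p - 1) / N powr (1 / p - 1)"
        unfolding m_def powr_powr using J0 N p by (simp add: powr_divide diff_divide_distrib)
      then show ?thesis using J0 N by (simp add: powr_diff)
    qed
    ultimately have "m powr (1 - p) / p * J + m * (1 - 1 / p) * N = N powr (1 - 1 / p) * J powr (1 / p)"
      by (simp add: algebra_simps)
    then show ?thesis using *[OF m] by simp
  next
    \<comment> \<open>Only the term proportional to \<open>m\<close> remains, and \<open>m\<close>
      may be taken arbitrarily small.\<close>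
    case True
    have "(\<integral>\<^sup>+x. ennreal (w x * \<phi> x) \<partial>M) \<le> 0"
    proof (rule ennreal_le_epsilon)
      fix e :: real assume e: "e > 0"
      have c: "(1 - 1 / p) * N > 0" using p N by simp
      have "e / ((1 - 1 / p) * N) * (1 - 1 / p) * N = e" using p N by simp
      then show "(\<integral>\<^sup>+x. ennreal (w x * \<phi> x) \<partial>M) \<le> 0 + ennreal e"
        using *[of "e / ((1 - 1 / p) * N)"] e c True by simp
    qed
    then show ?thesis by simp
  qed
qed

section \<open>The transform on L^p(0, 1)\<close>

abbreviation unit_measure :: "real measure" where
  "unit_measure \<equiv> lebesgue_on {0<..<1}"

interpretation unit: finite_measure unit_measure
  by (rule finite_measure_lebesgue_on) simp

interpretation unit_pair: pair_sigma_finite unit_measure unit_measure ..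

lemma measurable_ident_unit: "(\<lambda>t. t) \<in> borel_measurable unit_measure"
  by (intro measurable_restrict_space1 measurable_completion) simp

lemma space_unit: "space unit_measure = {0<..<1}"
  by (simp add: space_restrict_space)

lemma Lp_unit_integrable:
  assumes p: "p \<ge> 1" and f: "f \<in> elems (Lp_space unit_measure p)"
  shows "integrable unit_measure f"
proof (rule Bochner_Integration.integrable_bound)
  show "integrable unit_measure (\<lambda>t. 1 + cmod (f t) powr p)"
    using f by (auto simp: Lp_space_mem)
  have "cmod (f t) \<le> 1 + cmod (f t) powr p" for t
    using powr_mono[of 1 p "cmod (f t)"] p by (cases "cmod (f t) \<le> 1") (auto simp: add_increasing2)
  then show "AE t in unit_measure. norm (f t) \<le> norm (1 + cmod (f t) powr p)"
    by (auto simp: abs_of_nonneg)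
qed (use f in \<open>auto simp: Lp_space_mem\<close>)

lemma markov_stieltjes_integrable:
  fixes z :: complex
  assumes f: "integrable unit_measure f" and z: "\<And>t. 0 < t \<Longrightarrow> t < 1 \<Longrightarrow> \<delta> \<le> cmod (1 - of_real t * z)" and \<delta>: "\<delta> > 0"
  shows "integrable unit_measure (\<lambda>t. f t / (1 - of_real t * z))"
proof (rule Bochner_Integration.integrable_bound)
  note [measurable] = measurable_ident_unit
  have [measurable]: "f \<in> borel_measurable unit_measure" using f by auto
  show "integrable unit_measure (\<lambda>t. norm (f t) / \<delta>)" using f by auto
  show "(\<lambda>t. f t / (1 - of_real t * z)) \<in> borel_measurable unit_measure" by measurable
  show "AE t in unit_measure. norm (f t / (1 - of_real t * z)) \<le> norm (norm (f t) / \<delta>)"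
  proof (rule AE_I2)
    fix t assume "t \<in> space unit_measure"
    then have "\<delta> \<le> cmod (1 - of_real t * z)" using z by (simp add: space_unit)
    then show "norm (f t / (1 - of_real t * z)) \<le> norm (norm (f t) / \<delta>)"
      using \<delta> by (simp add: norm_divide frac_le)
  qed
qed

lemma markov_stieltjes_integrable_real:
  fixes f :: "real \<Rightarrow> complex"
  assumes f: "integrable unit_measure f" and y: "y < 1"
  shows "integrable unit_measure (\<lambda>t. f t / (1 - of_real t * of_real y))"
proof (rule markov_stieltjes_integrable[OF f])
  fix t :: real assume t: "0 < t" "t < 1"
  have "t * y \<le> max 0 y"
  proof (cases "y \<ge> 0")
    case True
    then have "t * y \<le> 1 * y" using t by (intro mult_right_mono) auto
    also have "1 * y \<le> max 0 y" by simp
    finally show ?thesis .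
  qed (use t in \<open>auto simp: mult_nonneg_nonpos\<close>)
  moreover have "min 1 (1 - y) = 1 - max 0 y" by (auto simp: min_def max_def)
  ultimately have "min 1 (1 - y) \<le> \<bar>1 - t * y\<bar>" by linarith
  then show "min 1 (1 - y) \<le> cmod (1 - of_real t * of_real y)"
    by (metis norm_of_real of_real_1 of_real_diff of_real_mult)
qed (use y in auto)

lemma MS_Lp_measurable:
  assumes [measurable]: "f \<in> borel_measurable unit_measure"
  shows "MS_Lp f \<in> borel_measurable unit_measure"
proof -
  note [measurable] = measurable_ident_unit
  show ?thesis unfolding MS_Lp_def markov_stieltjes_def by measurable
qed

lemma norm_MS_Lp_le:
  assumes f: "integrable unit_measure f" and y: "0 < y" "y < 1"
  shows "ennreal (cmod (MS_Lp f y)) \<le> (\<integral>\<^sup>+t. ennreal (cmod (f t) / (1 - t * y)) \<partial>unit_measure)"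
proof -
  have "ennreal (cmod (MS_Lp f y)) \<le> (\<integral>\<^sup>+t. ennreal (cmod (f t / (1 - of_real t * of_real y))) \<partial>unit_measure)"
    unfolding MS_Lp_def markov_stieltjes_def
    by (rule integral_norm_bound_ennreal[OF markov_stieltjes_integrable_real[OF f y(2)]])
  also have "\<dots> = (\<integral>\<^sup>+t. ennreal (cmod (f t) / (1 - t * y)) \<partial>unit_measure)"
  proof (rule nn_integral_cong)
    fix t assume "t \<in> space unit_measure"
    then have t: "0 < t" "t < 1" by (auto simp: space_unit)
    then have "t * y < 1 * 1" using y by (intro mult_strict_mono) auto
    then have "cmod (1 - of_real t * of_real y) = 1 - t * y"
      by (metis norm_of_real of_real_1 of_real_diff of_real_mult abs_of_pos diff_gt_0_iff_gt mult_1)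
    then show "ennreal (cmod (f t / (1 - of_real t * of_real y))) = ennreal (cmod (f t) / (1 - t * y))"
      by (simp add: norm_divide)
  qed
  finally show ?thesis .
qed

lemma one_minus_mult_pos: "0 < t \<Longrightarrow> t < 1 \<Longrightarrow> 0 < y \<Longrightarrow> y < 1 \<Longrightarrow> 0 < 1 - t * (y :: real)"
  using mult_strict_mono[of t 1 y 1] by simp

text \<open>Hoelder's inequality for the weight \<open>t powr (1 / p - 1) * (1 - t) powr (- 1 / p)\<close>, whose integral against
  the kernel is explicit.\<close>

lemma MS_Lp_pointwise_Holder:
  assumes p: "p > 1" and f: "f \<in> elems (Lp_space unit_measure p)" and y: "0 < y" "y < 1"
  shows "ennreal (cmod (MS_Lp f y) powr p) \<le>
    ennreal ((pi / sin (pi / p)) powr (p - 1)) *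
    (\<integral>\<^sup>+t. ennreal (cmod (f t) powr p * (1 - t) powr (1 - 1 / p) * ((1 - y) powr (1 / p - 1) / (1 - t * y))) \<partial>unit_measure)"
    (is "_ \<le> ennreal (?C powr _) * ?I")
proof -
  let ?a = "1 / p"
  have a: "0 < ?a" "?a < 1" using p by auto
  define C where "C = pi / sin (pi / p)"
  have C: "C > 0" unfolding C_def using a p by (intro divide_pos_pos sin_gt_zero) (auto simp: field_simps)
  note [measurable] = measurable_ident_unit
  have [measurable]: "f \<in> borel_measurable unit_measure" using f by (simp add: Lp_space_mem)
  define H where "H t = t powr (?a - 1) * (1 - t) powr (- ?a)" for t
  have [measurable]: "H \<in> borel_measurable unit_measure" unfolding H_def by measurable
  \<comment> \<open>The kernel applied to |f| is the integral of \<open>cmod (f t) / H t\<close>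
    against the density \<open>w\<close>, whose total mass is
    \<open>C * (1 - y) powr (- 1 / p)\<close>.\<close>
  define w where "w t = H t / (1 - t * y)" for t
  have [measurable]: "w \<in> borel_measurable unit_measure" unfolding w_def by measurable
  define J where "J = (\<integral>\<^sup>+t. ennreal (cmod (f t) powr p * (1 - t) powr (1 - ?a) / (1 - t * y)) \<partial>unit_measure)"
  have H: "H t > 0" if "0 < t" "t < 1" for t using that by (simp add: H_def)
  have I: "?I = ennreal ((1 - y) powr (?a - 1)) * J"
  proof -
    have "ennreal (cmod (f t) powr p * (1 - t) powr (1 - ?a) * ((1 - y) powr (?a - 1) / (1 - t * y))) =
        ennreal ((1 - y) powr (?a - 1)) * ennreal (cmod (f t) powr p * (1 - t) powr (1 - ?a) / (1 - t * y))"
      if "t \<in> space unit_measure" for t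
      using that one_minus_mult_pos[OF _ _ y]
      by (subst ennreal_mult[symmetric]) (auto simp: space_unit less_imp_le mult_ac)
    then have "?I = (\<integral>\<^sup>+t. ennreal ((1 - y) powr (?a - 1)) *
        ennreal (cmod (f t) powr p * (1 - t) powr (1 - ?a) / (1 - t * y)) \<partial>unit_measure)"
      by (intro nn_integral_cong)
    also have "\<dots> = ennreal ((1 - y) powr (?a - 1)) * J"
      unfolding J_def by (rule nn_integral_cmult) measurable
    finally show ?thesis .
  qed
  have "ennreal (cmod (MS_Lp f y) powr p) \<le> ennreal (C powr (p - 1)) * ?I"
  proof (cases "J = \<infinity>")
    case True
    have "?I = \<infinity>" unfolding I using True y by (simp add: ennreal_mult_top)
    then show ?thesis using C by (simp add: ennreal_mult_top)
  next
    case False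
    then obtain j where j: "J = ennreal j" "j \<ge> 0" by (cases J) auto
    have N: "(\<integral>\<^sup>+t. ennreal (w t) \<partial>unit_measure) = ennreal (C * (1 - y) powr (- ?a))"
    proof (subst nn_integral_eq_integral)
      show "integrable unit_measure w"
        unfolding w_def H_def using beta_kernel_integral(1)[OF a y(2)] by simp
      show "AE t in unit_measure. 0 \<le> w t"
        by (rule AE_I2) (use H one_minus_mult_pos[OF _ _ y] in \<open>auto simp: w_def space_unit less_imp_le\<close>)
      show "ennreal (integral\<^sup>L unit_measure w) = ennreal (C * (1 - y) powr (- ?a))"
        unfolding w_def H_def C_def using beta_kernel_integral(2)[OF a y(2)] by simp
    qed
    have "(\<integral>\<^sup>+t. ennreal (w t * (cmod (f t) / H t)) \<partial>unit_measure) \<le>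
        ennreal ((C * (1 - y) powr (- ?a)) powr (1 - 1 / p) * j powr (1 / p))"
    proof (rule nn_integral_Holder_weight[OF p])
      show "(\<integral>\<^sup>+t. ennreal (w t * (cmod (f t) / H t) powr p) \<partial>unit_measure) \<le> ennreal j"
        unfolding j(1)[symmetric] J_def
      proof (rule nn_integral_mono)
        fix t assume "t \<in> space unit_measure"
        then have t: "0 < t" "t < 1" by (auto simp: space_unit)
        have "H t powr (1 - p) = t powr ((?a - 1) * (1 - p)) * (1 - t) powr ((- ?a) * (1 - p))"
          unfolding H_def by (simp add: powr_mult powr_powr)
        also have "(- ?a) * (1 - p) = 1 - ?a" using p by (simp add: field_simps)
        \<comment> \<open>The exponent is nonnegative, so the power of \<open>t\<close> is at most
          1; only the weight at the corner \<open>t = 1\<close> is kept.\<close>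
        also have "t powr ((?a - 1) * (1 - p)) \<le> t powr 0"
          using t a p by (intro powr_mono') (auto simp: mult_nonpos_nonpos)
        finally have HH: "H t powr (1 - p) \<le> (1 - t) powr (1 - ?a)"
          using t by (simp add: mult_right_mono)
        have "w t * (cmod (f t) / H t) powr p = cmod (f t) powr p * H t powr (1 - p) / (1 - t * y)"
          using H[OF t] by (simp add: w_def powr_divide powr_diff mult.commute)
        also have "\<dots> \<le> cmod (f t) powr p * (1 - t) powr (1 - ?a) / (1 - t * y)"
          using HH one_minus_mult_pos[OF t y] by (intro divide_right_mono mult_left_mono) auto
        finally show "ennreal (w t * (cmod (f t) / H t) powr p) \<le>
            ennreal (cmod (f t) powr p * (1 - t) powr (1 - ?a) / (1 - t * y))"
          by (rule ennreal_leI)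
      qed
    qed (use N j y C H one_minus_mult_pos[OF _ _ y] in \<open>auto simp: space_unit w_def less_imp_le\<close>)
    also have "(\<integral>\<^sup>+t. ennreal (w t * (cmod (f t) / H t)) \<partial>unit_measure) =
        (\<integral>\<^sup>+t. ennreal (cmod (f t) / (1 - t * y)) \<partial>unit_measure)"
      by (intro nn_integral_cong) (use H in \<open>fastforce simp: w_def space_unit\<close>)
    finally have "ennreal (cmod (MS_Lp f y)) \<le> ennreal ((C * (1 - y) powr (- ?a)) powr (1 - 1 / p) * j powr (1 / p))"
      using norm_MS_Lp_le[OF Lp_unit_integrable[OF less_imp_le[OF p] f] y] by (rule order_trans[rotated])
    then have "cmod (MS_Lp f y) \<le> (C * (1 - y) powr (- ?a)) powr (1 - 1 / p) * j powr (1 / p)"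
      by (subst (asm) ennreal_le_iff) auto
    then have "cmod (MS_Lp f y) powr p \<le> ((C * (1 - y) powr (- ?a)) powr (1 - 1 / p) * j powr (1 / p)) powr p"
      using p by (intro powr_mono2) auto
    also have "\<dots> = (C * (1 - y) powr (- ?a)) powr (p - 1) * j"
    proof -
      have e: "(1 - 1 / p) * p = p - 1" "1 / p * p = 1" using p by (simp_all add: field_simps)
      have "(X powr (1 - 1 / p) * j powr (1 / p)) powr p = X powr (p - 1) * j" for X
        using j by (simp only: powr_mult powr_powr e powr_one)
      then show ?thesis .
    qed
    also have "\<dots> = C powr (p - 1) * ((1 - y) powr (?a - 1) * j)"
    proof -
      have e: "- ?a * (p - 1) = ?a - 1" using p by (simp add: field_simps)
      show ?thesis by (simp only: powr_mult powr_powr e mult.assoc)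
    qed
    finally show ?thesis
      unfolding I j(1) using C j by (simp add: ennreal_leI flip: ennreal_mult)
  qed
  then show ?thesis by (simp only: C_def)
qed

text \<open>After exchanging the integrals, the inner one is again of beta type, now with exponent
  \<open>1 - 1 / p\<close>. Its constant is the same by \<open>sin (pi - x) = sin x\<close>, so the
  two steps contribute \<open>C powr (p - 1)\<close> and \<open>C\<close>.\<close>

theorem MS_Lp_bound:
  assumes p: "p > 1" and f: "f \<in> elems (Lp_space unit_measure p)"
  shows "MS_Lp f \<in> elems (Lp_space unit_measure p)"
    "snorm (Lp_space unit_measure p) (MS_Lp f) \<le> pi / sin (pi / p) * snorm (Lp_space unit_measure p) f"
proof -
  define C where "C = pi / sin (pi / p)"
  let ?b = "1 - 1 / p"
  have b: "0 < ?b" "?b < 1" using p by auto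
  have C: "C > 0" unfolding C_def using p by (intro divide_pos_pos sin_gt_zero) (auto simp: field_simps)
  have Cb: "pi / sin (pi * ?b) = C"
    unfolding C_def using sin_pi_minus[of "pi / p"] by (simp add: algebra_simps)
  note [measurable] = measurable_ident_unit
  have [measurable]: "f \<in> borel_measurable unit_measure" using f by (simp add: Lp_space_mem)
  have inner: "(\<integral>\<^sup>+y. ennreal (cmod (f t) powr p * (1 - t) powr ?b * ((1 - y) powr (1 / p - 1) / (1 - t * y))) \<partial>unit_measure)
      \<le> ennreal (C * cmod (f t) powr p)" if t: "0 < t" "t < 1" for t
  proof -
    have "(\<integral>\<^sup>+y. ennreal (cmod (f t) powr p * (1 - t) powr ?b * ((1 - y) powr (1 / p - 1) / (1 - t * y))) \<partial>unit_measure)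
       \<le> (\<integral>\<^sup>+y. ennreal (cmod (f t) powr p * (1 - t) powr ?b) * ennreal (y powr (?b - 1) * (1 - y) powr (- ?b) / (1 - y * t)) \<partial>unit_measure)"
    proof (rule nn_integral_mono)
      fix y assume "y \<in> space unit_measure"
      then have y: "0 < y" "y < 1" by (auto simp: space_unit)
      \<comment> \<open>Inserting a factor that is at least 1 completes the integrand to the one
        evaluated in \<open>beta_kernel_integral\<close>.\<close>
      have "y powr 0 \<le> y powr (?b - 1)" using y b by (intro powr_mono') auto
      then have "(1 - y) powr (1 / p - 1) / (1 - t * y) \<le> y powr (?b - 1) * (1 - y) powr (- ?b) / (1 - y * t)"
        using y one_minus_mult_pos[OF t y] mult_right_mono[of 1 "y powr (?b - 1)" "(1 - y) powr (- ?b)"]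
        by (simp add: mult.commute divide_right_mono)
      then have "cmod (f t) powr p * (1 - t) powr ?b * ((1 - y) powr (1 / p - 1) / (1 - t * y))
          \<le> cmod (f t) powr p * (1 - t) powr ?b * (y powr (?b - 1) * (1 - y) powr (- ?b) / (1 - y * t))"
        by (intro mult_left_mono) auto
      then show "ennreal (cmod (f t) powr p * (1 - t) powr ?b * ((1 - y) powr (1 / p - 1) / (1 - t * y)))
          \<le> ennreal (cmod (f t) powr p * (1 - t) powr ?b) * ennreal (y powr (?b - 1) * (1 - y) powr (- ?b) / (1 - y * t))"
        using one_minus_mult_pos[OF y t] by (subst ennreal_mult[symmetric]) (auto intro: ennreal_leI)
    qed
    also have "\<dots> = ennreal (cmod (f t) powr p * (1 - t) powr ?b) *
        (\<integral>\<^sup>+y. ennreal (y powr (?b - 1) * (1 - y) powr (- ?b) / (1 - y * t)) \<partial>unit_measure)"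
      by (rule nn_integral_cmult) measurable
    also have "(\<integral>\<^sup>+y. ennreal (y powr (?b - 1) * (1 - y) powr (- ?b) / (1 - y * t)) \<partial>unit_measure) =
        ennreal (C * (1 - t) powr (- ?b))"
    proof (subst nn_integral_eq_integral[OF beta_kernel_integral(1)[OF b t(2)]])
      show "AE y in unit_measure. 0 \<le> y powr (?b - 1) * (1 - y) powr (- ?b) / (1 - y * t)"
        by (rule AE_I2) (use one_minus_mult_pos[OF _ _ t] in \<open>auto simp: space_unit less_imp_le\<close>)
    qed (simp only: beta_kernel_integral(2)[OF b t(2)] Cb)
    also have "ennreal (cmod (f t) powr p * (1 - t) powr ?b) * ennreal (C * (1 - t) powr (- ?b))
        = ennreal (C * cmod (f t) powr p)"
    proof -
      have "(1 - t) powr ?b * (1 - t) powr (- ?b) = 1"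
        using t by (simp flip: powr_add)
      then have "C * cmod (f t) powr p = C * cmod (f t) powr p * ((1 - t) powr ?b * (1 - t) powr (- ?b))"
        by simp
      also have "\<dots> = cmod (f t) powr p * (1 - t) powr ?b * (C * (1 - t) powr (- ?b))"
        by (simp only: mult_ac)
      finally have "cmod (f t) powr p * (1 - t) powr ?b * (C * (1 - t) powr (- ?b)) = C * cmod (f t) powr p"
        by (rule sym)
      then show ?thesis
        using C by (subst ennreal_mult[symmetric]) (simp_all only: mult_nonneg_nonneg powr_ge_zero less_imp_le)
    qed
    finally show ?thesis .
  qed
  have "(\<integral>\<^sup>+y. ennreal (cmod (MS_Lp f y) powr p) \<partial>unit_measure) \<le>
      (\<integral>\<^sup>+y. ennreal (C powr (p - 1)) * (\<integral>\<^sup>+t. ennreal (cmod (f t) powr p * (1 - t) powr ?b *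
        ((1 - y) powr (1 / p - 1) / (1 - t * y))) \<partial>unit_measure) \<partial>unit_measure)"
    by (intro nn_integral_mono MS_Lp_pointwise_Holder[OF p f, folded C_def]) (auto simp: space_unit)
  also have "\<dots> = ennreal (C powr (p - 1)) * (\<integral>\<^sup>+y. (\<integral>\<^sup>+t. ennreal (cmod (f t) powr p * (1 - t) powr ?b *
        ((1 - y) powr (1 / p - 1) / (1 - t * y))) \<partial>unit_measure) \<partial>unit_measure)"
    by (rule nn_integral_cmult) measurable
  also have "(\<integral>\<^sup>+y. (\<integral>\<^sup>+t. ennreal (cmod (f t) powr p * (1 - t) powr ?b *
        ((1 - y) powr (1 / p - 1) / (1 - t * y))) \<partial>unit_measure) \<partial>unit_measure) =
      (\<integral>\<^sup>+t. (\<integral>\<^sup>+y. ennreal (cmod (f t) powr p * (1 - t) powr ?b *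
        ((1 - y) powr (1 / p - 1) / (1 - t * y))) \<partial>unit_measure) \<partial>unit_measure)"
    by (rule unit_pair.Fubini') measurable
  also have "\<dots> \<le> (\<integral>\<^sup>+t. ennreal C * ennreal (cmod (f t) powr p) \<partial>unit_measure)"
    using inner C by (intro nn_integral_mono) (auto simp: space_unit ennreal_mult)
  also have "\<dots> = ennreal C * ennreal (snorm (Lp_space unit_measure p) f powr p)"
    using Lp_space_nn_integral[OF _ f] p by (subst nn_integral_cmult) auto
  also have "ennreal (C powr (p - 1)) * (ennreal C * ennreal (snorm (Lp_space unit_measure p) f powr p))
      = ennreal ((C * snorm (Lp_space unit_measure p) f) powr p)"
    using C by (simp add: powr_diff powr_mult flip: ennreal_mult)
  finally have *: "(\<integral>\<^sup>+y. ennreal (cmod (MS_Lp f y) powr p) \<partial>unit_measure) \<le>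
      ennreal ((C * snorm (Lp_space unit_measure p) f) powr p)"
    by (simp add: mult_left_mono)
  have nonneg: "0 \<le> C * snorm (Lp_space unit_measure p) f"
    using C Lp_space_nonneg by (intro mult_nonneg_nonneg) auto
  show "MS_Lp f \<in> elems (Lp_space unit_measure p)"
    "snorm (Lp_space unit_measure p) (MS_Lp f) \<le> pi / sin (pi / p) * snorm (Lp_space unit_measure p) f"
    unfolding C_def[symmetric] using Lp_spaceI[OF _ MS_Lp_measurable nonneg *] p by simp_all
qed

section \<open>Approximate eigenfunctions\<close>

definition mellin :: "real \<Rightarrow> real \<Rightarrow> real \<Rightarrow> complex" where
  "mellin a \<xi> u = complex_of_real (u powr (- a)) * cis (\<xi> * ln u)"

text \<open>The Mellin transform of 1 / (1 + u) at 1 - a + i \<xi>; for 0 < a < 1 it equals pi / sin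
  (pi (a - i \<xi>)), which at a = 1/2 is pi / cosh (pi \<xi>).\<close>

definition mellin_symbol :: "real \<Rightarrow> real \<Rightarrow> complex" where
  "mellin_symbol a \<xi> = (LINT u|lborel. indicator {0<..} u *\<^sub>R (mellin a \<xi> u / complex_of_real (1 + u)))"

lemma mellin_measurable [measurable]: "mellin a \<xi> \<in> borel_measurable borel"
proof -
  have [measurable]: "cis \<in> borel_measurable borel"
    by (intro borel_measurable_continuous_onI continuous_intros)
  show ?thesis unfolding mellin_def by measurable
qed

lemma norm_mellin: "cmod (mellin a \<xi> u) = u powr (- a)"
  by (simp add: mellin_def norm_mult)

lemma mellin_mult:
  assumes "u > 0" "v > 0"
  shows "mellin a \<xi> (u * v) = mellin a \<xi> u * mellin a \<xi> v"
  using assms by (simp add: mellin_def ln_mult powr_mult distrib_left flip: cis_mult)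

lemma nn_integral_half_line_kernel:
  assumes "0 < a" "a < 1"
  shows "(\<integral>\<^sup>+u. ennreal (u powr (- a) / (1 + u)) * indicator {0<..} u \<partial>lborel) = ennreal (pi / sin (pi * a))"
proof (rule nn_integral_has_integral_lebesgue')
  have "sin (pi * (1 - a)) = sin (pi * a)"
    using sin_pi_minus[of "pi * a"] by (simp add: algebra_simps)
  then show "((\<lambda>u. u powr (- a) / (1 + u)) has_integral pi / sin (pi * a)) {0<..}"
    using beta_kernel_half_line[of "1 - a"] assms
    by (simp add: has_integral_iff set_lebesgue_integral_eq_integral(1))
qed auto

lemma mellin_kernel_integrable:
  assumes "0 < a" "a < 1"
  shows "integrable lborel (\<lambda>u. indicator {0<..} u *\<^sub>R (mellin a \<xi> u / complex_of_real (1 + u)))"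
proof (rule integrableI_bounded)
  have "(\<integral>\<^sup>+u. ennreal (norm (indicator {0<..} u *\<^sub>R (mellin a \<xi> u / complex_of_real (1 + u)))) \<partial>lborel)
      = (\<integral>\<^sup>+u. ennreal (u powr (- a) / (1 + u)) * indicator {0<..} u \<partial>lborel)"
  proof (intro nn_integral_cong)
    fix u :: real
    have "cmod (1 + of_real u) = 1 + u" if "u > 0"
      using that by (metis norm_of_real of_real_1 of_real_add abs_of_pos add_pos_pos zero_less_one)
    then show "ennreal (norm (indicator {0<..} u *\<^sub>R (mellin a \<xi> u / complex_of_real (1 + u)))) =
        ennreal (u powr (- a) / (1 + u)) * indicator {0<..} u"
      by (simp add: indicator_def norm_divide norm_mellin)
  qed
  then show "(\<integral>\<^sup>+u. ennreal (norm (indicator {0<..} u *\<^sub>R (mellin a \<xi> u / complex_of_real (1 + u)))) \<partial>lborel) < \<infinity>"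
    using nn_integral_half_line_kernel[OF assms] by simp
qed measurable

text \<open>The generalized eigenvalue equation of the Carleman kernel: its homogeneity of degree -1
  and the multiplicativity of \<open>mellin\<close> allow \<open>u\<close> to be replaced by
  \<open>c * u\<close>.\<close>

lemma mellin_kernel_scaled:
  assumes a: "0 < a" "a < 1" and c: "c > 0"
  shows "integrable lborel (\<lambda>u. indicator {0<..} u *\<^sub>R (mellin a \<xi> u / complex_of_real (u + c)))"
    "(LINT u|lborel. indicator {0<..} u *\<^sub>R (mellin a \<xi> u / complex_of_real (u + c))) = mellin_symbol a \<xi> * mellin a \<xi> c"
proof -
  let ?f = "\<lambda>u. indicator {0<..} u *\<^sub>R (mellin a \<xi> u / complex_of_real (u + c))"
  have eq: "?f (0 + c * u) = (mellin a \<xi> c / of_real c) *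
      (indicator {0<..} u *\<^sub>R (mellin a \<xi> u / complex_of_real (1 + u)))" for u
  proof (cases "u > 0")
    case True
    have "of_real (c * u) + of_real c = complex_of_real c * of_real (1 + u)" by (simp add: algebra_simps)
    then show ?thesis using True c mellin_mult[of c u a \<xi>] by simp
  qed (use c in \<open>simp add: zero_less_mult_iff\<close>)
  have "integrable lborel (\<lambda>u. ?f (0 + c * u))"
    unfolding eq using mellin_kernel_integrable[OF a] by (intro integrable_mult_right)
  then show "integrable lborel ?f"
    using lborel_integrable_real_affine_iff[of c ?f 0] c by simp
  have "integral\<^sup>L lborel ?f = \<bar>c\<bar> *\<^sub>R (LINT u|lborel. ?f (0 + c * u))"
    using c by (intro lborel_integral_real_affine) auto
  also have "\<dots> = mellin_symbol a \<xi> * mellin a \<xi> c"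
    unfolding eq integral_mult_right_zero mellin_symbol_def[symmetric]
    using c by (simp add: scaleR_conv_of_real)
  finally show "integral\<^sup>L lborel ?f = mellin_symbol a \<xi> * mellin a \<xi> c" .
qed

text \<open>Majorant of what the kernel applied to \<^const>\<open>mellin\<close> gains or loses by cutting off at \<open>\<gamma>\<close>. The
  \<open>L\<^sup>p\<close> norm of its integral in \<open>v\<close> does not depend on \<open>\<gamma>\<close>, by scaling.\<close>

definition edge_kernel :: "real \<Rightarrow> real \<Rightarrow> real \<Rightarrow> real \<Rightarrow> real" where
  "edge_kernel a \<gamma> v u = (if v < \<gamma> then indicator {\<gamma>..} u * u powr (- a - 1)
     else indicator {0..\<gamma>} u * (u powr (- a) / v))"

definition edge_bound :: "real \<Rightarrow> real \<Rightarrow> real \<Rightarrow> real" where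
  "edge_bound a \<gamma> v = (if v < \<gamma> then \<gamma> powr (- a) / a else \<gamma> powr (1 - a) / ((1 - a) * v))"

lemma edge_measurable [measurable]:
  "edge_kernel a \<gamma> v \<in> borel_measurable borel" "edge_bound a \<gamma> \<in> borel_measurable borel"
  unfolding edge_kernel_def edge_bound_def by measurable

lemma nn_integral_powr_from_0:
  assumes "a < 1" "\<gamma> \<ge> 0"
  shows "(\<integral>\<^sup>+u. ennreal (u powr (- a)) * indicator {0..\<gamma>} u \<partial>lborel) = ennreal (\<gamma> powr (1 - a) / (1 - a))"
  by (rule nn_integral_has_integral_lebesgue')
     (use has_integral_powr_from_0[of "- a" \<gamma>] assms in auto)

lemma nn_integral_powr_to_inf:
  assumes "a > 0" "\<gamma> > 0"
  shows "(\<integral>\<^sup>+u. ennreal (u powr (- a - 1)) * indicator {\<gamma>..} u \<partial>lborel) = ennreal (\<gamma> powr (- a) / a)"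
  by (rule nn_integral_has_integral_lebesgue')
     (use has_integral_powr_to_inf[of "- a - 1" \<gamma>] assms in auto)

lemma edge_kernel_nonneg: "v > 0 \<Longrightarrow> 0 \<le> edge_kernel a \<gamma> v u"
  by (simp add: edge_kernel_def)

lemma nn_integral_edge_kernel:
  assumes a: "0 < a" "a < 1" and \<gamma>: "\<gamma> > 0" and v: "v > 0"
  shows "(\<integral>\<^sup>+u. ennreal (edge_kernel a \<gamma> v u) \<partial>lborel) = ennreal (edge_bound a \<gamma> v)"
proof (cases "v < \<gamma>")
  case True
  have "(\<integral>\<^sup>+u. ennreal (edge_kernel a \<gamma> v u) \<partial>lborel) =
      (\<integral>\<^sup>+u. ennreal (u powr (- a - 1)) * indicator {\<gamma>..} u \<partial>lborel)"
    using True by (intro nn_integral_cong) (auto simp: edge_kernel_def indicator_def)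
  then show ?thesis using True nn_integral_powr_to_inf[OF a(1) \<gamma>] by (simp add: edge_bound_def)
next
  case False
  have "(\<integral>\<^sup>+u. ennreal (edge_kernel a \<gamma> v u) \<partial>lborel) =
      (\<integral>\<^sup>+u. ennreal (1 / v) * (ennreal (u powr (- a)) * indicator {0..\<gamma>} u) \<partial>lborel)"
    using False v by (intro nn_integral_cong) (auto simp: edge_kernel_def indicator_def simp flip: ennreal_mult)
  also have "\<dots> = ennreal (1 / v) * ennreal (\<gamma> powr (1 - a) / (1 - a))"
    using nn_integral_powr_from_0[OF a(2), of \<gamma>] \<gamma> by (subst nn_integral_cmult) auto
  also have "\<dots> = ennreal (edge_bound a \<gamma> v)"
    using False v a by (simp add: edge_bound_def flip: ennreal_mult)
  finally show ?thesis .
qed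

text \<open>With \<open>u = 1 - t\<close> and \<open>v = 1 - y\<close> the kernel
  \<open>1 / (1 - t y)\<close> becomes \<open>1 / (u + v - u v)\<close>. If both variables lie in
  the window, it differs from \<open>1 / (u + v)\<close> by at most 1. If exactly one does, an edge
  of the window separates \<open>u\<close> from \<open>v\<close>, and the whole term is charged to
  the \<open>edge_kernel\<close> at that edge.\<close>

lemma window_kernel_pointwise:
  fixes u v a :: real
  assumes \<alpha>\<beta>: "0 < \<alpha>" "\<alpha> < \<beta>" "\<beta> \<le> 1" and v: "0 < v" "v < 1"
  shows "cmod (indicator {\<alpha>..<\<beta>} u *\<^sub>R (mellin a \<xi> u / complex_of_real (u + v - u * v)) -
      indicator {\<alpha>..<\<beta>} v *\<^sub>R (indicator {0<..} u *\<^sub>R (mellin a \<xi> u / complex_of_real (u + v))))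
    \<le> u powr (- a) * indicator {0..1} u + edge_kernel a \<alpha> v u + edge_kernel a \<beta> v u" (is "?L \<le> ?R")
proof (cases "u > 0")
  case False
  then show ?thesis
    using \<alpha>\<beta> v edge_kernel_nonneg[OF v(1), of a \<alpha> u] edge_kernel_nonneg[OF v(1), of a \<beta> u] by simp
next
  case u: True
  note nn = edge_kernel_nonneg[OF v(1), of a \<alpha> u] edge_kernel_nonneg[OF v(1), of a \<beta> u]
  have den: "u + v > 0" using u v by simp
  have eu: "u powr (- a) / (u + v) \<le> u powr (- a - 1)" "u powr (- a) / (u + v) \<le> u powr (- a) / v"
    using u v by (auto simp: powr_diff intro!: divide_left_mono mult_pos_pos)
  show ?thesis
  proof (cases "\<alpha> \<le> v \<and> v < \<beta>")
    case vin: True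
    show ?thesis
    proof (cases "\<alpha> \<le> u \<and> u < \<beta>")
      case True
      have u1: "u < 1" using True \<alpha>\<beta> by simp
      have k1: "u \<le> u + v - u * v" "v \<le> u + v - u * v"
        using mult_left_mono[of u 1 v] mult_left_mono[of v 1 u] u v u1 by (auto simp: mult.commute)
      have pos: "u + v - u * v > 0" using k1 u by linarith
      have "1 / (u + v - u * v) - 1 / (u + v) = u * v / ((u + v - u * v) * (u + v))"
        using pos den by (simp add: field_simps)
      \<comment> \<open>The factors of the denominator dominate \<open>u\<close> and
        \<open>v\<close> respectively.\<close>
      also have "\<dots> \<le> 1"
        using mult_mono[OF k1(1), of v "u + v"] u v pos den by simp
      finally have d: "1 / (u + v - u * v) - 1 / (u + v) \<le> 1" .
      have d0: "0 \<le> 1 / (u + v - u * v) - 1 / (u + v)"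
        using u v pos den by (simp add: frac_le)
      have "?L = cmod (mellin a \<xi> u * complex_of_real (1 / (u + v - u * v) - 1 / (u + v)))"
        using True vin u by (simp add: algebra_simps del: of_real_add of_real_diff of_real_mult)
          (simp add: algebra_simps)
      also have "\<dots> = u powr (- a) * (1 / (u + v - u * v) - 1 / (u + v))"
        unfolding norm_mult norm_mellin norm_of_real using d0 by simp
      also have "\<dots> \<le> u powr (- a) * 1" using d by (intro mult_left_mono) auto
      finally show ?thesis using nn u u1 by simp
    next
      case False
      then have "?L = u powr (- a) / (u + v)"
        using vin u den by (simp add: norm_divide norm_mellin del: of_real_add)
      also have "\<dots> \<le> edge_kernel a \<alpha> v u + edge_kernel a \<beta> v u"
      proof (cases "u < \<alpha>")
        case True
        then have "edge_kernel a \<alpha> v u = u powr (- a) / v" using vin u by (simp add: edge_kernel_def)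
        then show ?thesis using eu nn by linarith
      next
        case False
        then have "u \<ge> \<beta>" using \<open>\<not> (\<alpha> \<le> u \<and> u < \<beta>)\<close> by simp
        then have "edge_kernel a \<beta> v u = u powr (- a - 1)" using vin u by (simp add: edge_kernel_def)
        then show ?thesis using eu nn by linarith
      qed
      finally have "?L \<le> edge_kernel a \<alpha> v u + edge_kernel a \<beta> v u" .
      moreover have "0 \<le> u powr (- a) * indicator {0..1} u" by (simp add: indicator_def)
      ultimately show ?thesis by linarith
    qed
  next
    case vout: False
    show ?thesis
    proof (cases "\<alpha> \<le> u \<and> u < \<beta>")
      case True
      have u1: "u < 1" using True \<alpha>\<beta> by simp
      have k1: "u \<le> u + v - u * v" "v \<le> u + v - u * v"
        using mult_left_mono[of u 1 v] mult_left_mono[of v 1 u] u v u1 by (auto simp: mult.commute)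
      have pos: "u + v - u * v > 0" using k1 u by linarith
      have "?L = u powr (- a) / (u + v - u * v)"
        using True vout pos by (simp add: norm_divide norm_mellin del: of_real_add of_real_diff of_real_mult)
      also have "\<dots> \<le> edge_kernel a \<alpha> v u + edge_kernel a \<beta> v u"
      proof (cases "v < \<alpha>")
        case 1: True
        have "u powr (- a) / (u + v - u * v) \<le> u powr (- a) / u"
          using k1(1) pos u by (intro divide_left_mono) auto
        also have "\<dots> = edge_kernel a \<alpha> v u"
          using 1 True u by (simp add: edge_kernel_def powr_diff)
        finally show ?thesis using nn by linarith
      next
        case 1: False
        have "u powr (- a) / (u + v - u * v) \<le> u powr (- a) / v"
          using k1(2) pos v by (intro divide_left_mono) auto
        also have "\<dots> = edge_kernel a \<beta> v u"
          using 1 vout True u by (simp add: edge_kernel_def)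
        finally show ?thesis using nn by linarith
      qed
      finally have "?L \<le> edge_kernel a \<alpha> v u + edge_kernel a \<beta> v u" .
      moreover have "0 \<le> u powr (- a) * indicator {0..1} u" by (simp add: indicator_def)
      ultimately show ?thesis by linarith
    next
      case False
      then show ?thesis using vout nn by simp
    qed
  qed
qed

lemma window_integral:
  assumes a: "0 < a" "a < 1" and \<alpha>\<beta>: "0 < \<alpha>" "\<alpha> < \<beta>" "\<beta> \<le> 1" and v: "0 < v" "v < 1"
  shows "cmod ((LINT u|lborel. indicator {\<alpha>..<\<beta>} u *\<^sub>R (mellin a \<xi> u / complex_of_real (u + v - u * v))) -
      mellin_symbol a \<xi> * (indicator {\<alpha>..<\<beta>} v *\<^sub>R mellin a \<xi> v))
    \<le> 1 / (1 - a) + edge_bound a \<alpha> v + edge_bound a \<beta> v"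
proof -
  let ?G = "\<lambda>u. indicator {\<alpha>..<\<beta>} u *\<^sub>R (mellin a \<xi> u / complex_of_real (u + v - u * v))"
  let ?H = "\<lambda>u. indicator {\<alpha>..<\<beta>} v *\<^sub>R (indicator {0<..} u *\<^sub>R (mellin a \<xi> u / complex_of_real (u + v)))"
  let ?R = "\<lambda>u. u powr (- a) * indicator {0..1} u + edge_kernel a \<alpha> v u + edge_kernel a \<beta> v u"
  have eb: "0 \<le> edge_bound a \<gamma> v" if "\<gamma> > 0" for \<gamma>
    using that a v by (simp add: edge_bound_def)
  have "(\<integral>\<^sup>+u. ennreal (?R u) \<partial>lborel) = (\<integral>\<^sup>+u. ennreal (u powr (- a)) * indicator {0..1} u
      + ennreal (edge_kernel a \<alpha> v u) + ennreal (edge_kernel a \<beta> v u) \<partial>lborel)"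
    using edge_kernel_nonneg[OF v(1)] by (intro nn_integral_cong) (auto simp: indicator_def simp flip: ennreal_plus)
  also have "\<dots> = ennreal (1 / (1 - a)) + ennreal (edge_bound a \<alpha> v) + ennreal (edge_bound a \<beta> v)"
    using nn_integral_powr_from_0[OF a(2), of 1] nn_integral_edge_kernel[OF a _ v(1)] \<alpha>\<beta>
    by (simp add: nn_integral_add)
  also have "\<dots> = ennreal (1 / (1 - a) + edge_bound a \<alpha> v + edge_bound a \<beta> v)"
    using a eb \<alpha>\<beta> by simp
  finally have R: "(\<integral>\<^sup>+u. ennreal (?R u) \<partial>lborel) = ennreal (1 / (1 - a) + edge_bound a \<alpha> v + edge_bound a \<beta> v)" .
  have H: "integrable lborel ?H" "integral\<^sup>L lborel ?H = mellin_symbol a \<xi> * (indicator {\<alpha>..<\<beta>} v *\<^sub>R mellin a \<xi> v)"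
    using mellin_kernel_scaled[OF a v(1), of \<xi>] by (simp_all del: scaleR_scaleR)
  have bound: "(\<integral>\<^sup>+u. ennreal (norm (?G u - ?H u)) \<partial>lborel) \<le> ennreal (1 / (1 - a) + edge_bound a \<alpha> v + edge_bound a \<beta> v)"
    unfolding R[symmetric] using window_kernel_pointwise[OF \<alpha>\<beta> v]
    by (intro nn_integral_mono ennreal_leI)
  \<comment> \<open>The pointwise bound makes the difference integrable; adding the integrable
    \<open>?H\<close> back then gives integrability of \<open>?G\<close>.\<close>
  have D: "integrable lborel (\<lambda>u. ?G u - ?H u)"
    using le_less_trans[OF bound] by (intro integrableI_bounded) auto
  have "integrable lborel (\<lambda>u. (?G u - ?H u) + ?H u)"
    by (rule Bochner_Integration.integrable_add[OF D H(1)])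
  then have G: "integrable lborel ?G" by simp
  have "ennreal (cmod (integral\<^sup>L lborel (\<lambda>u. ?G u - ?H u))) \<le> ennreal (1 / (1 - a) + edge_bound a \<alpha> v + edge_bound a \<beta> v)"
    by (rule order_trans[OF integral_norm_bound_ennreal[OF D] bound])
  then have "cmod (integral\<^sup>L lborel (\<lambda>u. ?G u - ?H u)) \<le> 1 / (1 - a) + edge_bound a \<alpha> v + edge_bound a \<beta> v"
    using a eb[of \<alpha>] eb[of \<beta>] \<alpha>\<beta> by (subst (asm) ennreal_le_iff) auto
  then show ?thesis
    unfolding Bochner_Integration.integral_diff[OF G H(1)] H(2) .
qed

section \<open>Windows near the corner in the coordinate 1 - t\<close>

lemma unit_integral_lborel:
  fixes f :: "real \<Rightarrow> complex"
  assumes [measurable]: "f \<in> borel_measurable borel"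
  shows "(LINT t|unit_measure. f t) = (LINT t|lborel. indicator {0<..<1} t *\<^sub>R f t)"
proof -
  have "(LINT t|unit_measure. f t) = (LINT t|lebesgue. indicator {0<..<1} t *\<^sub>R f t)"
    by (rule integral_restrict_space) simp
  also have "\<dots> = (LINT t|lborel. indicator {0<..<1} t *\<^sub>R f t)"
    by (rule integral_completion) measurable
  finally show ?thesis .
qed

lemma unit_nn_integral_lborel:
  "(\<integral>\<^sup>+t. f t \<partial>unit_measure) = (\<integral>\<^sup>+t. f t * indicator {0<..<1} t \<partial>lborel)"
  by (subst nn_integral_restrict_space) (simp_all add: nn_integral_completion)

lemma unit_nn_integral_reflect:
  assumes [measurable]: "f \<in> borel_measurable borel"
  shows "(\<integral>\<^sup>+t. f (1 - t) \<partial>unit_measure) = (\<integral>\<^sup>+t. f t * indicator {0<..<1} t \<partial>lborel)"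
proof -
  have "(\<integral>\<^sup>+t. f t * indicator {0<..<1} t \<partial>lborel) =
      \<bar>-1 :: real\<bar> * (\<integral>\<^sup>+t. f (1 + (-1) * t) * indicator {0<..<1} (1 + (-1) * t) \<partial>lborel)"
    by (rule nn_integral_real_affine) auto
  also have "\<dots> = (\<integral>\<^sup>+t. f (1 - t) * indicator {0<..<1} t \<partial>lborel)"
    by (auto intro!: nn_integral_cong simp: indicator_def)
  finally show ?thesis by (simp add: unit_nn_integral_lborel)
qed

lemma borel_measurable_unit:
  assumes "f \<in> borel_measurable borel"
  shows "f \<in> borel_measurable unit_measure"
  by (intro measurable_restrict_space1 measurable_completion) (use assms in simp)

text \<open>The window is half-open, so that windows sharing an endpoint have disjoint
  supports.\<close>

definition window :: "real \<Rightarrow> real \<Rightarrow> real \<Rightarrow> real \<Rightarrow> real \<Rightarrow> complex" where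
  "window a \<xi> \<alpha> \<beta> t = indicator {\<alpha>..<\<beta>} (1 - t) *\<^sub>R mellin a \<xi> (1 - t)"

lemma window_measurable [measurable]: "window a \<xi> \<alpha> \<beta> \<in> borel_measurable borel"
  unfolding window_def by measurable

lemma MS_Lp_window:
  assumes \<alpha>\<beta>: "0 < \<alpha>" "\<alpha> < \<beta>" "\<beta> \<le> 1"
  shows "MS_Lp (window a \<xi> \<alpha> \<beta>) (1 - v) =
    (LINT u|lborel. indicator {\<alpha>..<\<beta>} u *\<^sub>R (mellin a \<xi> u / complex_of_real (u + v - u * v)))"
proof -
  let ?f = "\<lambda>t. indicator {0<..<1} t *\<^sub>R (window a \<xi> \<alpha> \<beta> t / (1 - of_real t * of_real (1 - v)))"
  have "MS_Lp (window a \<xi> \<alpha> \<beta>) (1 - v) = (LINT t|lborel. ?f t)"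
    unfolding MS_Lp_def markov_stieltjes_def by (rule unit_integral_lborel) measurable
  also have "\<dots> = \<bar>-1 :: real\<bar> *\<^sub>R (LINT u|lborel. ?f (1 + (-1) * u))"
    by (rule lborel_integral_real_affine) simp
  also have "\<dots> = (LINT u|lborel. ?f (1 + (-1) * u))" by simp
  also have "\<dots> = (LINT u|lborel. indicator {\<alpha>..<\<beta>} u *\<^sub>R (mellin a \<xi> u / complex_of_real (u + v - u * v)))"
  proof (rule Bochner_Integration.integral_cong[OF refl])
    fix u :: real
    have "1 - of_real (1 + (-1) * u) * of_real (1 - v) = complex_of_real (u + v - u * v)"
      by (simp add: algebra_simps)
    then show "?f (1 + (-1) * u) = indicator {\<alpha>..<\<beta>} u *\<^sub>R (mellin a \<xi> u / complex_of_real (u + v - u * v))"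
      using \<alpha>\<beta> by (simp add: window_def indicator_def)
  qed
  finally show ?thesis .
qed

text \<open>At the exponent \<open>1 / p\<close> the p-th power of the modulus is
  \<open>1 / u\<close>, so the norm is unbounded as \<open>\<alpha>\<close> tends to 0, although the
  windowed function itself is in L^p.\<close>

lemma window_norm:
  assumes p: "p > 1" and \<alpha>\<beta>: "0 < \<alpha>" "\<alpha> < \<beta>" "\<beta> \<le> 1"
  shows "window (1 / p) \<xi> \<alpha> \<beta> \<in> elems (Lp_space unit_measure p)"
    "snorm (Lp_space unit_measure p) (window (1 / p) \<xi> \<alpha> \<beta>) powr p = ln (\<beta> / \<alpha>)"
proof -
  let ?w = "window (1 / p) \<xi> \<alpha> \<beta>"
  have e: "cmod (mellin (1 / p) \<xi> u) powr p = 1 / u" if "u > 0" for u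
  proof -
    have "- (1 / p) * p = - 1" using p by simp
    then have "cmod (mellin (1 / p) \<xi> u) powr p = u powr (- 1)" by (simp only: norm_mellin powr_powr)
    then show ?thesis using that by (simp add: powr_minus_divide)
  qed
  have "(\<integral>\<^sup>+t. ennreal (cmod (?w t) powr p) \<partial>unit_measure) =
      (\<integral>\<^sup>+u. ennreal (cmod (indicator {\<alpha>..<\<beta>} u *\<^sub>R mellin (1 / p) \<xi> u) powr p) * indicator {0<..<1} u \<partial>lborel)"
    unfolding window_def
    by (rule unit_nn_integral_reflect[of "\<lambda>u. ennreal (cmod (indicator {\<alpha>..<\<beta>} u *\<^sub>R mellin (1 / p) \<xi> u) powr p)"]) measurable
  also have "\<dots> = (\<integral>\<^sup>+u. ennreal (1 / u) * indicator {\<alpha>..<\<beta>} u \<partial>lborel)"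
    using \<alpha>\<beta> p by (intro nn_integral_cong) (auto simp: indicator_def e)
  also have "\<dots> = ennreal (ln (\<beta> / \<alpha>))"
  proof (rule nn_integral_has_integral_lebesgue')
    have "((\<lambda>u. 1 / u) has_integral ln \<beta> - ln \<alpha>) {\<alpha>..\<beta>}"
      using \<alpha>\<beta> by (intro fundamental_theorem_of_calculus)
        (auto intro!: derivative_eq_intros simp flip: has_real_derivative_iff_has_vector_derivative)
    then show "((\<lambda>u. 1 / u) has_integral ln (\<beta> / \<alpha>)) {\<alpha>..<\<beta>}"
      using \<alpha>\<beta> by (subst has_integral_spike_set_eq[of _ "{\<alpha>..\<beta>}"])
        (auto simp: ln_div intro: negligible_subset[of "{\<beta>}"])
  qed (use \<alpha>\<beta> in auto)
  finally have *: "(\<integral>\<^sup>+t. ennreal (cmod (?w t) powr p) \<partial>unit_measure) = ennreal (ln (\<beta> / \<alpha>))" .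
  have ln: "ln (\<beta> / \<alpha>) \<ge> 0" using \<alpha>\<beta> by simp
  show mem: "?w \<in> elems (Lp_space unit_measure p)"
    by (rule Lp_spaceI(1)[where C = "ln (\<beta> / \<alpha>) powr (1 / p)"])
       (use p * ln in \<open>auto simp: powr_powr intro!: borel_measurable_unit\<close>)
  show "snorm (Lp_space unit_measure p) ?w powr p = ln (\<beta> / \<alpha>)"
    using Lp_space_nn_integral[OF _ mem] * p ln by simp
qed

text \<open>The first summand of \<open>K\<close> comes from \<open>v < \<gamma>\<close>, where the
  bound is constant, the second from the tail of order \<open>v powr (- p)\<close>. The powers of
  \<open>\<gamma>\<close> cancel because the exponent is \<open>1 / p\<close>.\<close>

lemma edge_bound_norm:
  assumes p: "p > 1" and \<gamma>: "\<gamma> > 0"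
  defines "K \<equiv> ((1 / p) powr (- p) + (1 - 1 / p) powr (- p) / (p - 1)) powr (1 / p)"
  shows "(\<lambda>t. complex_of_real (edge_bound (1 / p) \<gamma> (1 - t))) \<in> elems (Lp_space unit_measure p)"
    "snorm (Lp_space unit_measure p) (\<lambda>t. complex_of_real (edge_bound (1 / p) \<gamma> (1 - t))) \<le> K"
proof -
  let ?a = "1 / p"
  have a: "0 < ?a" "?a < 1" using p by auto
  have "(\<integral>\<^sup>+t. ennreal (\<bar>edge_bound ?a \<gamma> (1 - t)\<bar> powr p) \<partial>unit_measure) =
      (\<integral>\<^sup>+v. ennreal (\<bar>edge_bound ?a \<gamma> v\<bar> powr p) * indicator {0<..<1} v \<partial>lborel)"
    by (rule unit_nn_integral_reflect[of "\<lambda>v. ennreal (\<bar>edge_bound ?a \<gamma> v\<bar> powr p)"]) measurable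
  also have "\<dots> \<le> (\<integral>\<^sup>+v. ennreal ((\<gamma> powr (- ?a) / ?a) powr p) * indicator {0..\<gamma>} v
      + ennreal ((\<gamma> powr (1 - ?a) / (1 - ?a)) powr p) * (ennreal (v powr (- (p - 1) - 1)) * indicator {\<gamma>..} v) \<partial>lborel)"
  proof (rule nn_integral_mono)
    fix v :: real
    show "ennreal (\<bar>edge_bound ?a \<gamma> v\<bar> powr p) * indicator {0<..<1} v \<le> ennreal ((\<gamma> powr (- ?a) / ?a) powr p) * indicator {0..\<gamma>} v
      + ennreal ((\<gamma> powr (1 - ?a) / (1 - ?a)) powr p) * (ennreal (v powr (- (p - 1) - 1)) * indicator {\<gamma>..} v)"
    proof (cases "0 < v \<and> v < 1")
      case v: True
      show ?thesis
      proof (cases "v < \<gamma>")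
        case True
        then show ?thesis using v \<gamma> p by (simp add: edge_bound_def)
      next
        case False
        have "(\<gamma> powr (1 - ?a) / ((1 - ?a) * v)) powr p = (\<gamma> powr (1 - ?a) / (1 - ?a) * v powr (- 1)) powr p"
          using v by (simp add: powr_minus_divide)
        also have "\<dots> = (\<gamma> powr (1 - ?a) / (1 - ?a)) powr p * v powr (- (p - 1) - 1)"
        proof -
          have "(- 1) * p = - (p - 1) - 1" by simp
          then show ?thesis by (simp only: powr_mult powr_powr)
        qed
        finally have "\<bar>edge_bound ?a \<gamma> v\<bar> powr p = (\<gamma> powr (1 - ?a) / (1 - ?a)) powr p * v powr (- (p - 1) - 1)"
          using False a v by (simp add: edge_bound_def)
        then have "ennreal (\<bar>edge_bound ?a \<gamma> v\<bar> powr p) =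
            ennreal ((\<gamma> powr (1 - ?a) / (1 - ?a)) powr p) * ennreal (v powr (- (p - 1) - 1))"
          by (simp only: ennreal_mult powr_ge_zero)
        then show ?thesis using False v by simp
      qed
    qed auto
  qed
  also have "\<dots> = ennreal ((\<gamma> powr (- ?a) / ?a) powr p) * ennreal \<gamma>
      + ennreal ((\<gamma> powr (1 - ?a) / (1 - ?a)) powr p) * ennreal (\<gamma> powr (- (p - 1)) / (p - 1))"
    using nn_integral_powr_to_inf[of "p - 1" \<gamma>] p \<gamma>
    by (simp add: nn_integral_add nn_integral_cmult nn_integral_cmult_indicator)
  also have "\<dots> = ennreal (K powr p)"
  proof -
    have "(\<gamma> powr (- ?a) / ?a) powr p * \<gamma> = ?a powr (- p)"
    proof -
      have "(\<gamma> powr (- ?a)) powr p = 1 / \<gamma>" 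
      proof -
        have "- (1 / p) * p = - 1" using p by simp
        then show ?thesis using \<gamma> by (simp only: powr_powr) (simp add: powr_minus_divide)
      qed
      then show ?thesis using \<gamma> a by (subst powr_divide) (simp_all add: powr_minus_divide)
    qed
    moreover have "(\<gamma> powr (1 - ?a) / (1 - ?a)) powr p * (\<gamma> powr (- (p - 1)) / (p - 1)) = (1 - ?a) powr (- p) / (p - 1)"
    proof -
      have "(1 - ?a) * p = p - 1" using p by (simp add: field_simps)
      then have "(\<gamma> powr (1 - ?a)) powr p * \<gamma> powr (- (p - 1)) = 1" using \<gamma> by (simp only: powr_powr flip: powr_add) simp
      then show ?thesis using \<gamma> a p by (subst powr_divide) (simp_all add: powr_minus_divide)
    qed
    moreover have "K powr p = ?a powr (- p) + (1 - ?a) powr (- p) / (p - 1)"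
      unfolding K_def powr_powr using p a by (simp add: add_nonneg_nonneg)
    ultimately show ?thesis using \<gamma> p by (simp flip: ennreal_mult ennreal_plus)
  qed
  finally have *: "(\<integral>\<^sup>+t. ennreal (cmod (complex_of_real (edge_bound ?a \<gamma> (1 - t))) powr p) \<partial>unit_measure) \<le> ennreal (K powr p)"
    by simp
  have m: "(\<lambda>t. complex_of_real (edge_bound ?a \<gamma> (1 - t))) \<in> borel_measurable unit_measure"
    by (rule borel_measurable_unit) measurable
  have K: "0 \<le> K" by (simp add: K_def)
  show "(\<lambda>t. complex_of_real (edge_bound ?a \<gamma> (1 - t))) \<in> elems (Lp_space unit_measure p)"
    "snorm (Lp_space unit_measure p) (\<lambda>t. complex_of_real (edge_bound ?a \<gamma> (1 - t))) \<le> K"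
    using Lp_spaceI[OF _ m K *] p by simp_all
qed

text \<open>The decisive point is that \<open>C\<close> is independent of the window. Its three
  parts come from the difference of the two kernels and from the two edges.\<close>

lemma window_error:
  assumes p: "p > 1"
  obtains C where "\<And>\<alpha> \<beta>. 0 < \<alpha> \<Longrightarrow> \<alpha> < \<beta> \<Longrightarrow> \<beta> \<le> 1 \<Longrightarrow>
    snorm (Lp_space unit_measure p) (\<lambda>t. MS_Lp (window (1 / p) \<xi> \<alpha> \<beta>) t
      - mellin_symbol (1 / p) \<xi> * window (1 / p) \<xi> \<alpha> \<beta> t) \<le> C"
proof -
  interpret complete_fun_space "Lp_space unit_measure p"
    by (rule complete_fun_space_Lp) (use p in simp)
  let ?a = "1 / p"
  have a: "0 < ?a" "?a < 1" using p by auto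
  have p0: "p > 0" using p by simp
  define K where "K = ((1 / p) powr (- p) + (1 - 1 / p) powr (- p) / (p - 1)) powr (1 / p)"
  let ?N = "snorm (Lp_space unit_measure p)"
  let ?one = "\<lambda>t :: real. complex_of_real (1 / (1 - ?a))"
  have one: "?one \<in> elems (Lp_space unit_measure p)"
    by (simp add: Lp_space_mem)
  show thesis
  proof (rule that)
    fix \<alpha> \<beta> :: real assume \<alpha>\<beta>: "0 < \<alpha>" "\<alpha> < \<beta>" "\<beta> \<le> 1"
    let ?E = "\<lambda>t. MS_Lp (window ?a \<xi> \<alpha> \<beta>) t - mellin_symbol ?a \<xi> * window ?a \<xi> \<alpha> \<beta> t"
    let ?D = "\<lambda>\<gamma> t. complex_of_real (edge_bound ?a \<gamma> (1 - t))"
    note D = edge_bound_norm[OF p, of \<alpha>, folded K_def] edge_bound_norm[OF p, of \<beta>, folded K_def]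
    have W: "window ?a \<xi> \<alpha> \<beta> \<in> elems (Lp_space unit_measure p)"
      by (rule window_norm[OF p \<alpha>\<beta>])
    have E: "?E \<in> elems (Lp_space unit_measure p)"
      using MS_Lp_bound(1)[OF p W] W by (intro diff_in scale_in)
    have "?N ?E \<le> ?N (\<lambda>t. ?one t + ?D \<alpha> t + ?D \<beta> t)"
    proof (rule Lp_space_snorm_mono(2)[OF p0])
      show "(\<lambda>t. ?one t + ?D \<alpha> t + ?D \<beta> t) \<in> elems (Lp_space unit_measure p)"
        using one D \<alpha>\<beta> by (intro add_in) auto
      show "AE t in unit_measure. cmod (?E t) \<le> cmod (?one t + ?D \<alpha> t + ?D \<beta> t)"
      proof (rule AE_I2)
        fix t assume "t \<in> space unit_measure"
        then have v: "0 < 1 - t" "1 - t < 1" by (auto simp: space_unit)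
        have nn: "0 \<le> edge_bound ?a \<gamma> (1 - t)" if "\<gamma> > 0" for \<gamma>
          using that a v by (simp add: edge_bound_def)
        have "cmod (?E t) \<le> 1 / (1 - ?a) + edge_bound ?a \<alpha> (1 - t) + edge_bound ?a \<beta> (1 - t)"
          using window_integral[OF a \<alpha>\<beta> v, of \<xi>] MS_Lp_window[OF \<alpha>\<beta>, of ?a \<xi> "1 - t"]
          by (simp add: window_def)
        also have "\<dots> = cmod (complex_of_real (1 / (1 - ?a) + edge_bound ?a \<alpha> (1 - t) + edge_bound ?a \<beta> (1 - t)))"
          unfolding norm_of_real using nn[of \<alpha>] nn[of \<beta>] \<alpha>\<beta> a by simp
        finally show "cmod (?E t) \<le> cmod (?one t + ?D \<alpha> t + ?D \<beta> t)"
          by simp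
      qed
    qed (use E in \<open>auto simp: Lp_space_mem\<close>)
    also have "\<dots> \<le> ?N (\<lambda>t. ?one t + ?D \<alpha> t) + ?N (?D \<beta>)"
      using one D \<alpha>\<beta> by (intro norm_triangle add_in) auto
    also have "\<dots> \<le> (?N ?one + ?N (?D \<alpha>)) + ?N (?D \<beta>)"
      using one D \<alpha>\<beta> by (intro add_right_mono norm_triangle) auto
    also have "\<dots> \<le> ?N ?one + K + K"
      using D \<alpha>\<beta> by (intro add_mono) auto
    finally show "?N ?E \<le> ?N ?one + K + K" .
  qed
qed

text \<open>The approximate eigenfunction must live arbitrarily close to the corner yet keep a gap
  \<open>\<delta>'\<close> from it; the gap leaves room for the next one with disjoint
  support.\<close>

definition approx_eigenvalue :: "real \<Rightarrow> complex \<Rightarrow> bool" where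
  "approx_eigenvalue p r \<longleftrightarrow> (\<forall>\<epsilon> \<delta>. 0 < \<epsilon> \<longrightarrow> 0 < \<delta> \<longrightarrow> \<delta> \<le> 1 \<longrightarrow>
     (\<exists>f \<delta>'. 0 < \<delta>' \<and> \<delta>' < \<delta> \<and> f \<in> elems (Lp_space unit_measure p) \<and> snorm (Lp_space unit_measure p) f = 1 \<and>
       (\<forall>t. \<not> (1 - \<delta> < t \<and> t \<le> 1 - \<delta>') \<longrightarrow> f t = 0) \<and>
       snorm (Lp_space unit_measure p) (\<lambda>t. MS_Lp f t - r * f t) \<le> \<epsilon>))"

lemma MS_Lp_scale: "MS_Lp (\<lambda>t. c * f t) y = c * MS_Lp f y"
  unfolding MS_Lp_def markov_stieltjes_def by (simp flip: times_divide_eq_right)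

lemma approx_eigenvalue_mellin_symbol:
  assumes p: "p > 1"
  shows "approx_eigenvalue p (mellin_symbol (1 / p) \<xi>)"
  unfolding approx_eigenvalue_def
proof (intro allI impI)
  interpret complete_fun_space "Lp_space unit_measure p"
    by (rule complete_fun_space_Lp) (use p in simp)
  fix \<epsilon> \<delta> :: real assume \<epsilon>: "0 < \<epsilon>" and \<delta>: "0 < \<delta>" "\<delta> \<le> 1"
  let ?N = "snorm (Lp_space unit_measure p)"
  let ?w = "\<lambda>\<alpha>. window (1 / p) \<xi> \<alpha> \<delta>"
  obtain C where C: "\<And>\<alpha>. 0 < \<alpha> \<Longrightarrow> \<alpha> < \<delta> \<Longrightarrow>
      ?N (\<lambda>t. MS_Lp (?w \<alpha>) t - mellin_symbol (1 / p) \<xi> * ?w \<alpha> t) \<le> C"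
    using window_error[OF p, of \<xi>] \<delta>(2) by metis
  \<comment> \<open>The window from \<open>\<delta> * exp (- L)\<close> to \<open>\<delta>\<close>
    has norm \<open>max C 0 / \<epsilon> + 1\<close>, so that an error of at most \<open>C\<close>
    becomes at most \<open>\<epsilon>\<close> after normalisation.\<close>
  define L where "L = (max C 0 / \<epsilon> + 1) powr p"
  have X: "max C 0 / \<epsilon> + 1 > 0"
    using \<epsilon> by (intro add_nonneg_pos divide_nonneg_pos) auto
  then have L: "L > 0" "L powr (1 / p) = max C 0 / \<epsilon> + 1"
    unfolding L_def powr_powr using p by auto
  define \<alpha> where "\<alpha> = \<delta> * exp (- L)"
  have \<alpha>: "0 < \<alpha>" "\<alpha> < \<delta>" using \<delta> L by (auto simp: \<alpha>_def)
  note W = window_norm[OF p \<alpha> \<delta>(2), of \<xi>]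
  have "?N (?w \<alpha>) powr p = L" using W(2) \<delta> by (simp add: \<alpha>_def ln_div ln_mult)
  then have "(?N (?w \<alpha>) powr p) powr (1 / p) = max C 0 / \<epsilon> + 1" using L by simp
  then have n: "?N (?w \<alpha>) = max C 0 / \<epsilon> + 1"
    using p by (simp add: powr_powr abs_of_nonneg[OF Lp_space_nonneg])
  have n0: "?N (?w \<alpha>) > 0" unfolding n by (rule X)
  have Cn: "C \<le> \<epsilon> * ?N (?w \<alpha>)" unfolding n using \<epsilon> by (simp add: distrib_left)
  define c where "c = complex_of_real (1 / ?N (?w \<alpha>))"
  have c: "cmod c = 1 / ?N (?w \<alpha>)" using n0 by (simp add: c_def norm_divide)
  have E: "(\<lambda>t. MS_Lp (?w \<alpha>) t - mellin_symbol (1 / p) \<xi> * ?w \<alpha> t) \<in> elems (Lp_space unit_measure p)"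
    using MS_Lp_bound(1)[OF p W(1)] W(1) by (intro diff_in scale_in)
  have "(\<lambda>t. MS_Lp (\<lambda>t. c * ?w \<alpha> t) t - mellin_symbol (1 / p) \<xi> * (c * ?w \<alpha> t)) =
      (\<lambda>t. c * (MS_Lp (?w \<alpha>) t - mellin_symbol (1 / p) \<xi> * ?w \<alpha> t))"
    by (simp add: MS_Lp_scale algebra_simps)
  then have "?N (\<lambda>t. MS_Lp (\<lambda>t. c * ?w \<alpha> t) t - mellin_symbol (1 / p) \<xi> * (c * ?w \<alpha> t)) =
      1 / ?N (?w \<alpha>) * ?N (\<lambda>t. MS_Lp (?w \<alpha>) t - mellin_symbol (1 / p) \<xi> * ?w \<alpha> t)"
    using norm_scale[OF E, of c] c by simp
  also have "\<dots> \<le> 1 / ?N (?w \<alpha>) * (\<epsilon> * ?N (?w \<alpha>))"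
    using n0 C[OF \<alpha>] Cn by (intro mult_left_mono) auto
  also have "\<dots> = \<epsilon>" using n0 by simp
  finally have le: "?N (\<lambda>t. MS_Lp (\<lambda>t. c * ?w \<alpha> t) t - mellin_symbol (1 / p) \<xi> * (c * ?w \<alpha> t)) \<le> \<epsilon>" .
  show "\<exists>f \<delta>'. 0 < \<delta>' \<and> \<delta>' < \<delta> \<and> f \<in> elems (Lp_space unit_measure p) \<and> ?N f = 1 \<and>
       (\<forall>t. \<not> (1 - \<delta> < t \<and> t \<le> 1 - \<delta>') \<longrightarrow> f t = 0) \<and>
       ?N (\<lambda>t. MS_Lp f t - mellin_symbol (1 / p) \<xi> * f t) \<le> \<epsilon>"
  proof (intro exI[of _ "\<lambda>t. c * ?w \<alpha> t"] exI[of _ \<alpha>] conjI allI impI)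
    show "?N (\<lambda>t. c * ?w \<alpha> t) = 1" using norm_scale[OF W(1), of c] c n0 by simp
    show "(\<lambda>t. c * ?w \<alpha> t) \<in> elems (Lp_space unit_measure p)" using W(1) by (rule scale_in)
    show "c * ?w \<alpha> t = 0" if "\<not> (1 - \<delta> < t \<and> t \<le> 1 - \<alpha>)" for t
      using that by (auto simp: window_def indicator_def)
  qed (use \<alpha> le in auto)
qed

text \<open>The approximate eigenvalues form a closed set, hence it suffices to approach a point by
  values of the symbol.\<close>

lemma approx_eigenvalue_limit:
  assumes p: "p > 1" and lim: "\<And>e. e > 0 \<Longrightarrow> \<exists>s. approx_eigenvalue p s \<and> cmod (s - r) < e"
  shows "approx_eigenvalue p r"
  unfolding approx_eigenvalue_def
proof (intro allI impI)
  interpret complete_fun_space "Lp_space unit_measure p"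
    by (rule complete_fun_space_Lp) (use p in simp)
  let ?N = "snorm (Lp_space unit_measure p)"
  fix \<epsilon> \<delta> :: real assume \<epsilon>: "0 < \<epsilon>" and \<delta>: "0 < \<delta>" "\<delta> \<le> 1"
  obtain s where s: "approx_eigenvalue p s" "cmod (s - r) < \<epsilon> / 2"
    using lim[of "\<epsilon> / 2"] \<epsilon> by auto
  obtain f \<delta>' where f: "0 < \<delta>'" "\<delta>' < \<delta>" "f \<in> elems (Lp_space unit_measure p)" "?N f = 1"
      "\<And>t. \<not> (1 - \<delta> < t \<and> t \<le> 1 - \<delta>') \<Longrightarrow> f t = 0" "?N (\<lambda>t. MS_Lp f t - s * f t) \<le> \<epsilon> / 2"
    using s(1)[unfolded approx_eigenvalue_def, rule_format, of "\<epsilon> / 2" \<delta>] \<epsilon> \<delta> by auto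
  have "?N (\<lambda>t. (MS_Lp f t - s * f t) + (s - r) * f t) \<le> ?N (\<lambda>t. MS_Lp f t - s * f t) + ?N (\<lambda>t. (s - r) * f t)"
    using MS_Lp_bound(1)[OF p f(3)] f(3) by (intro norm_triangle diff_in scale_in)
  also have "\<dots> \<le> \<epsilon> / 2 + \<epsilon> / 2"
    using f(4,6) s(2) norm_scale[OF f(3), of "s - r"] by (intro add_mono) auto
  finally have "?N (\<lambda>t. MS_Lp f t - r * f t) \<le> \<epsilon>" by (simp add: algebra_simps)
  with f show "\<exists>f \<delta>'. 0 < \<delta>' \<and> \<delta>' < \<delta> \<and> f \<in> elems (Lp_space unit_measure p) \<and> ?N f = 1 \<and>
       (\<forall>t. \<not> (1 - \<delta> < t \<and> t \<le> 1 - \<delta>') \<longrightarrow> f t = 0) \<and> ?N (\<lambda>t. MS_Lp f t - r * f t) \<le> \<epsilon>"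
    by blast
qed

text \<open>Each support starts where the previous one ends. For disjoint supports the p-th powers
  of the norms add, whence the distance \<open>2 powr (1 / p)\<close>.\<close>

lemma approx_eigenvalue_sequence:
  assumes p: "p > 1" and r: "approx_eigenvalue p r"
  obtains F where "\<And>n. F n \<in> elems (Lp_space unit_measure p)"
    "\<And>n. snorm (Lp_space unit_measure p) (F n) = 1"
    "(\<lambda>n. snorm (Lp_space unit_measure p) (\<lambda>t. MS_Lp (F n) t - r * F n t)) \<longlonglongrightarrow> 0"
    "\<And>m n. m \<noteq> n \<Longrightarrow> snorm (Lp_space unit_measure p) (\<lambda>t. F m t - F n t) = 2 powr (1 / p)"
proof -
  let ?N = "snorm (Lp_space unit_measure p)"
  define Q where "Q n x \<longleftrightarrow> (case x of (f, \<delta>, \<delta>') \<Rightarrow> 0 < \<delta>' \<and> \<delta>' < \<delta> \<and> \<delta> \<le> 1 \<and>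
      f \<in> elems (Lp_space unit_measure p) \<and> ?N f = 1 \<and>
      (\<forall>t. \<not> (1 - \<delta> < t \<and> t \<le> 1 - \<delta>') \<longrightarrow> f t = 0) \<and>
      ?N (\<lambda>t. MS_Lp f t - r * f t) \<le> 1 / Suc n)" for n and x :: "(real \<Rightarrow> complex) \<times> real \<times> real"
  have step: "\<exists>f \<delta>'. Q n (f, \<delta>, \<delta>')" if "0 < \<delta>" "\<delta> \<le> 1" for n \<delta>
    using r[unfolded approx_eigenvalue_def, rule_format, of "1 / Suc n" \<delta>] that
    unfolding Q_def by (simp del: of_nat_Suc)
  \<comment> \<open>The gap \<open>\<delta>'\<close> of one function is prescribed as the width
    \<open>\<delta>\<close> of the next.\<close>
  have "\<exists>x. \<forall>n. Q n (x n) \<and> fst (snd (x (Suc n))) = snd (snd (x n))"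
  proof (rule dependent_nat_choice)
    show "\<exists>x. Q 0 x" using step[of 1 0] by auto
    fix x n assume "Q n x"
    then have "0 < snd (snd x)" "snd (snd x) \<le> 1" by (auto simp: Q_def split: prod.splits)
    then show "\<exists>y. Q (Suc n) y \<and> fst (snd y) = snd (snd x)"
      using step[of "snd (snd x)" "Suc n"] by fastforce
  qed
  then obtain x where x: "\<And>n. Q n (x n)" "\<And>n. fst (snd (x (Suc n))) = snd (snd (x n))" by blast
  define F where "F n = fst (x n)" for n
  define d where "d n = fst (snd (x n))" for n
  have Q: "0 < d (Suc n)" "d (Suc n) < d n" "F n \<in> elems (Lp_space unit_measure p)" "?N (F n) = 1"
    "\<And>t. \<not> (1 - d n < t \<and> t \<le> 1 - d (Suc n)) \<Longrightarrow> F n t = 0"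
    "?N (\<lambda>t. MS_Lp (F n) t - r * F n t) \<le> 1 / Suc n" for n
    using x(1)[of n] unfolding F_def d_def x(2) by (auto simp: Q_def split: prod.splits)
  have dmono: "d n \<le> d m" if "m \<le> n" for m n
    using lift_Suc_antimono_le[of d m n] Q(2) that by (simp add: less_imp_le)
  have disj: "F m t = 0 \<or> F n t = 0" if "m < n" for m n t
  proof (rule ccontr)
    assume "\<not> (F m t = 0 \<or> F n t = 0)"
    then have "t \<le> 1 - d (Suc m)" "1 - d n < t" using Q(5)[of m t] Q(5)[of n t] by blast+
    moreover have "d n \<le> d (Suc m)" using that by (intro dmono) auto
    ultimately show False by linarith
  qed
  have lt: "?N (\<lambda>t. F m t - F n t) = 2 powr (1 / p)" if "m < n" for m n
  proof -
    have eq: "cmod (F m t - F n t) powr p = cmod (F m t) powr p + cmod (F n t) powr p" for t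
      using disj[OF that, of t] p by auto
    have "(LINT t|unit_measure. cmod (F m t - F n t) powr p) = ?N (F m) powr p + ?N (F n) powr p"
      unfolding eq using Q(3)[of m] Q(3)[of n] p
      by (subst Bochner_Integration.integral_add) (auto simp: Lp_space_mem Lp_space_snorm_powr)
    then show ?thesis using Q(4) by (simp add: Lp_space_snorm)
  qed
  show thesis
  proof (rule that[of F])
    show "?N (\<lambda>t. F m t - F n t) = 2 powr (1 / p)" if "m \<noteq> n" for m n
      using that lt[of m n] lt[of n m] by (cases "m < n") (auto simp: Lp_space_snorm norm_minus_commute)
    show "(\<lambda>n. ?N (\<lambda>t. MS_Lp (F n) t - r * F n t)) \<longlonglongrightarrow> 0"
      by (rule tendsto_zero_le[OF LIMSEQ_inverse_real_of_nat])
         (use Q(6) Lp_space_nonneg in \<open>auto simp: inverse_eq_divide\<close>)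
  qed (use Q in auto)
qed

section \<open>Values of the symbol\<close>

lemma mellin_symbol_0:
  assumes a: "0 < a" "a < 1"
  shows "mellin_symbol a 0 = of_real (pi / sin (pi * a))"
proof -
  have "mellin_symbol a 0 = (LINT u|lborel. complex_of_real (indicator {0<..} u * (u powr (- a) / (1 + u))))"
    unfolding mellin_symbol_def
    by (intro Bochner_Integration.integral_cong) (auto simp: mellin_def indicator_def)
  also have "\<dots> = of_real (LINT u|lborel. indicator {0<..} u * (u powr (- a) / (1 + u)))"
    by (rule integral_complex_of_real)
  also have "(LINT u|lborel. indicator {0<..} u * (u powr (- a) / (1 + u))) =
      enn2real (\<integral>\<^sup>+u. ennreal (indicator {0<..} u * (u powr (- a) / (1 + u))) \<partial>lborel)"
    by (rule integral_eq_nn_integral) (auto simp: indicator_def)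
  also have "(\<integral>\<^sup>+u. ennreal (indicator {0<..} u * (u powr (- a) / (1 + u))) \<partial>lborel) = ennreal (pi / sin (pi * a))"
    unfolding nn_integral_half_line_kernel[OF a, symmetric]
    by (intro nn_integral_cong) (auto simp: indicator_def)
  also have "enn2real (ennreal (pi / sin (pi * a))) = pi / sin (pi * a)"
    using a by (intro enn2real_ennreal divide_nonneg_nonneg sin_ge_zero) auto
  finally show ?thesis .
qed

text \<open>Rescaling by \<open>c\<close> with \<open>\<xi> * ln c = \<pi>\<close> reverses the sign of \<open>u powr (\<i> \<xi>)\<close>, so that the symbol
  is half the integral of a difference which tends to \<open>0\<close> as \<open>c \<rightarrow> 1\<close>.\<close>

lemma mellin_symbol_decay:
  assumes \<xi>: "\<xi> > 0"
  shows "2 * cmod (mellin_symbol (1 / 2) \<xi>) \<le> (exp (pi / (2 * \<xi>)) - 1) * pi"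
proof -
  let ?m = "mellin (1 / 2) \<xi>"
  define r where "r = exp (pi / (2 * \<xi>))"
  have r: "r > 1" using \<xi> by (simp add: r_def)
  define c where "c = r\<^sup>2"
  have c: "c > 0" using r by (simp add: c_def)
  have "ln c = pi / \<xi>" using r by (simp add: c_def ln_realpow) (simp add: r_def)
  then have "cis (\<xi> * ln c) = -1" using \<xi> by simp
  moreover have "c powr (- (1 / 2)) = 1 / r"
    using r by (simp add: c_def powr_minus_divide powr_half_sqrt)
  ultimately have mc: "?m c = - complex_of_real (1 / r)" by (simp add: mellin_def)
  define f where "f u = indicator {0<..} u *\<^sub>R (?m u / complex_of_real (1 + u))" for u
  define g where "g u = indicator {0<..} u *\<^sub>R (?m u / complex_of_real (1 + c * u))" for u
  have [measurable]: "f \<in> borel_measurable borel" "g \<in> borel_measurable borel"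
    unfolding f_def g_def by measurable
  have f_int: "integrable lborel f" unfolding f_def by (rule mellin_kernel_integrable) auto
  have fc: "f (0 + c * u) = - complex_of_real (1 / r) * g u" for u
    unfolding f_def g_def
    using c mellin_mult[of c u "1 / 2" \<xi>] mc by (cases "u > 0") (auto simp: zero_less_mult_iff)
  have "integrable lborel (\<lambda>u. - complex_of_real r * f (0 + c * u))"
    using lborel_integrable_real_affine[OF f_int, of c 0] c by (intro integrable_mult_right) auto
  moreover have "(\<lambda>u. - complex_of_real r * f (0 + c * u)) = g"
    unfolding fc using r by auto
  ultimately have g_int: "integrable lborel g" by (simp only:)
  have "mellin_symbol (1 / 2) \<xi> = \<bar>c\<bar> *\<^sub>R (LINT u|lborel. f (0 + c * u))"
    unfolding mellin_symbol_def f_def[symmetric] using c by (intro lborel_integral_real_affine) auto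
  also have "\<dots> = - complex_of_real r * (LINT u|lborel. g u)"
    unfolding fc integral_mult_right_zero using c r
    by (simp add: scaleR_conv_of_real c_def power2_eq_square)
  finally have "2 * mellin_symbol (1 / 2) \<xi> = (LINT u|lborel. f u) - complex_of_real r * (LINT u|lborel. g u)"
    by (simp add: mellin_symbol_def f_def)
  also have "\<dots> = (LINT u|lborel. f u - complex_of_real r * g u)"
    using f_int g_int by (subst Bochner_Integration.integral_diff) auto
  finally have 2: "2 * mellin_symbol (1 / 2) \<xi> = (LINT u|lborel. f u - complex_of_real r * g u)" .
  have "ennreal (cmod (LINT u|lborel. f u - complex_of_real r * g u)) \<le>
      (\<integral>\<^sup>+u. ennreal (cmod (f u - complex_of_real r * g u)) \<partial>lborel)"
    using f_int g_int by (intro integral_norm_bound_ennreal) auto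
  also have "\<dots> \<le> (\<integral>\<^sup>+u. ennreal (r - 1) * (ennreal (u powr (- (1 / 2)) / (1 + u)) * indicator {0<..} u) \<partial>lborel)"
  proof (rule nn_integral_mono)
    fix u :: real
    show "ennreal (cmod (f u - complex_of_real r * g u)) \<le>
        ennreal (r - 1) * (ennreal (u powr (- (1 / 2)) / (1 + u)) * indicator {0<..} u)"
    proof (cases "u > 0")
      case u: True
      have pos: "1 + u > 0" "1 + c * u > 0" using u c by (auto intro: add_pos_pos)
      have "f u - complex_of_real r * g u = ?m u * complex_of_real (1 / (1 + u) - r / (1 + c * u))"
        using u by (simp add: f_def g_def algebra_simps)
      then have N: "cmod (f u - complex_of_real r * g u) = u powr (- (1 / 2)) * \<bar>1 / (1 + u) - r / (1 + c * u)\<bar>"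
        by (simp only: norm_mult norm_mellin norm_of_real)
      have "\<bar>1 / (1 + u) - r / (1 + c * u)\<bar> \<le> (r - 1) / (1 + u)"
      proof -
        \<comment> \<open>Because \<open>c\<close> is the square of \<open>r\<close>, the numerator
          factors and yields \<open>r - 1\<close> uniformly in \<open>u\<close>; the remaining
          quotient is at most 1.\<close>
        have "1 / (1 + u) - r / (1 + c * u) = (1 - r) * (1 - r * u) / ((1 + u) * (1 + c * u))"
          using pos by (simp add: field_simps c_def power2_eq_square)
        then have "\<bar>1 / (1 + u) - r / (1 + c * u)\<bar> = (r - 1) / (1 + u) * (\<bar>1 - r * u\<bar> / (1 + c * u))"
          using pos r by (simp add: abs_mult)
        also have "\<dots> \<le> (r - 1) / (1 + u) * 1"
        proof (rule mult_left_mono)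
          have "r \<le> c" using r by (simp add: c_def power2_eq_square)
          then have "r * u \<le> c * u" using u by (intro mult_right_mono) auto
          moreover have "0 < r * u" using r u by simp
          ultimately have "\<bar>1 - r * u\<bar> \<le> 1 + c * u" by linarith
          then show "\<bar>1 - r * u\<bar> / (1 + c * u) \<le> 1" using pos by simp
        qed (use r pos in auto)
        finally show ?thesis by simp
      qed
      then have "cmod (f u - complex_of_real r * g u) \<le> u powr (- (1 / 2)) * ((r - 1) / (1 + u))"
        unfolding N by (rule mult_left_mono) simp
      then have "cmod (f u - complex_of_real r * g u) \<le> (r - 1) * (u powr (- (1 / 2)) / (1 + u))"
        by (simp add: mult.commute)
      then show ?thesis using u r by (simp add: ennreal_leI flip: ennreal_mult)
    qed (auto simp: f_def g_def)
  qed
  also have "\<dots> = ennreal (r - 1) * ennreal pi"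
    using nn_integral_half_line_kernel[of "1 / 2"] by (subst nn_integral_cmult) auto
  finally have "cmod (LINT u|lborel. f u - complex_of_real r * g u) \<le> (r - 1) * pi"
    using r by (simp flip: ennreal_mult)
  then show ?thesis unfolding 2[symmetric] by (simp add: r_def norm_mult)
qed

lemma continuous_mellin_symbol:
  assumes a: "0 < a" "a < 1"
  shows "isCont (mellin_symbol a) \<xi>"
  unfolding continuous_at_sequentially comp_def
proof (intro allI impI)
  fix x :: "nat \<Rightarrow> real" assume x: "x \<longlonglongrightarrow> \<xi>"
  show "(\<lambda>n. mellin_symbol a (x n)) \<longlonglongrightarrow> mellin_symbol a \<xi>"
    unfolding mellin_symbol_def
  proof (rule integral_dominated_convergence)
    show "integrable lborel (\<lambda>u. norm (indicator {0<..} u *\<^sub>R (mellin a 0 u / complex_of_real (1 + u))))"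
      using mellin_kernel_integrable[OF a] by (rule integrable_norm)
    show "AE u in lborel. (\<lambda>n. indicator {0<..} u *\<^sub>R (mellin a (x n) u / complex_of_real (1 + u)))
        \<longlonglongrightarrow> indicator {0<..} u *\<^sub>R (mellin a \<xi> u / complex_of_real (1 + u))"
    proof (rule AE_I2)
      fix u :: real
      have "(\<lambda>n. mellin a (x n) u) \<longlonglongrightarrow> mellin a \<xi> u"
        unfolding mellin_def using x by (intro tendsto_intros tendsto_cis)
      then show "(\<lambda>n. indicator {0<..} u *\<^sub>R (mellin a (x n) u / complex_of_real (1 + u)))
        \<longlonglongrightarrow> indicator {0<..} u *\<^sub>R (mellin a \<xi> u / complex_of_real (1 + u))"
        unfolding divide_inverse by (intro tendsto_scaleR tendsto_mult tendsto_const)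
    qed
  qed (auto simp: norm_divide norm_mellin)
qed

text \<open>The intermediate value theorem between the value pi at 0 and the small values at large
  \<open>\<xi>\<close>. The endpoint 0 is reached only by approximation.\<close>

lemma mellin_symbol_dense:
  assumes real: "\<And>\<xi>. mellin_symbol (1 / 2) \<xi> \<in> complex_of_real ` {0..pi}"
    and r: "0 \<le> r" "r \<le> pi" and e: "e > 0"
  shows "\<exists>\<xi>. cmod (mellin_symbol (1 / 2) \<xi> - complex_of_real r) < e"
proof -
  define g where "g \<xi> = Re (mellin_symbol (1 / 2) \<xi>)" for \<xi>
  have sym: "mellin_symbol (1 / 2) \<xi> = complex_of_real (g \<xi>)" for \<xi>
    using real[of \<xi>] by (auto simp: g_def)
  have small: "\<exists>\<xi>>0. \<bar>g \<xi>\<bar> < d" if d: "d > 0" for d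
  proof -
    \<comment> \<open>Solves \<open>exp (pi / (2 * \<xi>)) - 1 = d / pi\<close>, so that the decay
      estimate has right-hand side \<open>d\<close>.\<close>
    define \<xi> where "\<xi> = pi / (2 * ln (1 + d / pi))"
    have l: "ln (1 + d / pi) > 0"
      using divide_pos_pos[OF d pi_gt_zero] by (intro ln_gt_zero) simp
    have \<xi>: "\<xi> > 0" using l by (simp add: \<xi>_def)
    have "pi / (2 * \<xi>) = ln (1 + d / pi)" using l by (simp add: \<xi>_def)
    then have "exp (pi / (2 * \<xi>)) = 1 + d / pi" using d by (simp add: add_pos_pos)
    then have "2 * \<bar>g \<xi>\<bar> \<le> d"
      using mellin_symbol_decay[OF \<xi>] by (simp add: sym)
    then show ?thesis using \<xi> d by (intro exI[of _ \<xi>]) auto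
  qed
  show ?thesis
  proof (cases "r = 0")
    case True
    then show ?thesis using small[OF e] by (auto simp: sym)
  next
    case False
    then obtain \<xi>1 where \<xi>1: "\<xi>1 > 0" "\<bar>g \<xi>1\<bar> < r" using small[of r] r by auto
    have "g 0 = pi" by (simp add: g_def mellin_symbol_0)
    moreover have "isCont g \<xi>" for \<xi>
      unfolding g_def by (intro continuous_Re continuous_mellin_symbol) auto
    moreover have "g \<xi>1 \<le> r" using \<xi>1 by linarith
    ultimately obtain \<xi> where "g \<xi> = r"
      using IVT2[of g \<xi>1 r 0] \<xi>1 r by auto
    then show ?thesis using e by (intro exI[of _ \<xi>]) (simp add: sym)
  qed
qed

section \<open>Moments and power series\<close>

abbreviation l2 :: "nat fun_space" where
  "l2 \<equiv> Lp_space (count_space UNIV) 2"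

abbreviation L2 :: "real fun_space" where
  "L2 \<equiv> Lp_space unit_measure 2"

lemma l2_mem: "a \<in> elems l2 \<longleftrightarrow> summable (\<lambda>n. (cmod (a n))\<^sup>2)"
  by (simp add: Lp_space_mem integrable_count_space_nat_iff)

lemma l2_norm_sq: "a \<in> elems l2 \<Longrightarrow> (snorm l2 a)\<^sup>2 = (\<Sum>n. (cmod (a n))\<^sup>2)"
  by (simp add: L2_snorm_sq integral_count_space_nat Lp_space_mem)

interpretation l2: semi_hilbert l2 "L2_ip (count_space UNIV)"
  by (rule semi_hilbert_L2)

interpretation L2: semi_hilbert L2 "L2_ip unit_measure"
  by (rule semi_hilbert_L2)

lemma l2_ip_sums:
  assumes "a \<in> elems l2" "b \<in> elems l2"
  shows "(\<lambda>n. a n * cnj (b n)) sums L2_ip (count_space UNIV) a b"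
  unfolding L2_ip_def by (rule sums_integral_count_space_nat[OF L2_integrable_mult[OF assms(1) Lp_space_cnj[OF assms(2)]]])

definition moments :: "(real \<Rightarrow> complex) \<Rightarrow> nat \<Rightarrow> complex" where
  "moments f n = (LINT t|unit_measure. f t * of_real t ^ n)"

text \<open>Set to 0 outside (0, 1), where the series may diverge, so that linearity holds at every
  point as \<open>exact_linear\<close> demands.\<close>

definition series_unit :: "(nat \<Rightarrow> complex) \<Rightarrow> real \<Rightarrow> complex" where
  "series_unit a t = (if t \<in> {0<..<1} then \<Sum>n. a n * of_real t ^ n else 0)"

lemma integrable_times_bounded:
  fixes f g :: "real \<Rightarrow> complex"
  assumes f: "integrable unit_measure f" and g: "g \<in> borel_measurable borel" "\<And>t. 0 < t \<Longrightarrow> t < 1 \<Longrightarrow> cmod (g t) \<le> C"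
  shows "integrable unit_measure (\<lambda>t. f t * g t)"
proof (rule Bochner_Integration.integrable_bound)
  show "integrable unit_measure (\<lambda>t. C * cmod (f t))" using f by auto
  have [measurable]: "f \<in> borel_measurable unit_measure" using f by auto
  have [measurable]: "g \<in> borel_measurable unit_measure" by (rule borel_measurable_unit[OF g(1)])
  show "(\<lambda>t. f t * g t) \<in> borel_measurable unit_measure" by measurable
  show "AE t in unit_measure. norm (f t * g t) \<le> norm (C * cmod (f t))"
  proof (rule AE_I2)
    fix t assume "t \<in> space unit_measure"
    then have "cmod (g t) \<le> C" using g(2) by (simp add: space_unit)
    then have "cmod (g t) * cmod (f t) \<le> \<bar>C\<bar> * cmod (f t)" by (intro mult_right_mono) auto
    then show "norm (f t * g t) \<le> norm (C * cmod (f t))" by (simp add: norm_mult abs_mult mult.commute)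
  qed
qed

lemma L2_integrable: "f \<in> elems L2 \<Longrightarrow> integrable unit_measure f"
  by (rule Lp_unit_integrable) auto

lemma moments_integrable:
  assumes "f \<in> elems L2"
  shows "integrable unit_measure (\<lambda>t. f t * of_real t ^ n)"
  by (rule integrable_times_bounded[OF L2_integrable[OF assms], where C = 1])
     (auto simp: norm_power power_le_one)

lemma L2_norm_MS_le: "f \<in> elems L2 \<Longrightarrow> snorm L2 (MS_Lp f) \<le> pi * snorm L2 f"
  using MS_Lp_bound(2)[of 2 f] by simp

lemma L2_MS_in: "f \<in> elems L2 \<Longrightarrow> MS_Lp f \<in> elems L2"
  using MS_Lp_bound(1)[of 2 f] by simp

text \<open>Passing to |f| makes every term nonnegative. With \<open>m n\<close> the moments of |f|,
  the sum of \<open>m n * y ^ n\<close> is at most S|f|(y), so the squares of \<open>m n\<close> sum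
  to at most the inner product of |f| with S|f|, which the Schur bound at p = 2 controls.\<close>

lemma sum_moments_le:
  assumes f: "f \<in> elems L2"
  shows "(\<Sum>n<N. (cmod (moments f n))\<^sup>2) \<le> pi * (snorm L2 f)\<^sup>2"
proof -
  define h where "h t = complex_of_real (cmod (f t))" for t
  have h: "h \<in> elems L2" "snorm L2 h = snorm L2 f"
    unfolding h_def using Lp_space_norm_of_real[OF f] by auto
  define m where "m n = (LINT t|unit_measure. cmod (f t) * t ^ n)" for n
  have int: "integrable unit_measure (\<lambda>t. cmod (f t) * t ^ n)" for n
  proof -
    have "integrable unit_measure (\<lambda>t. Re (h t * of_real t ^ n))"
      using moments_integrable[OF h(1), of n] by (rule integrable_Re)
    then show ?thesis by (simp add: h_def flip: of_real_power of_real_mult)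
  qed
  have m0: "0 \<le> m n" for n
    unfolding m_def by (rule Bochner_Integration.integral_nonneg_AE) (auto simp: space_unit)
  have le: "cmod (moments f n) \<le> m n" for n
  proof -
    have "cmod (moments f n) \<le> (LINT t|unit_measure. cmod (f t * of_real t ^ n))"
      unfolding moments_def by (rule integral_norm_bound)
    also have "\<dots> = m n"
      unfolding m_def by (intro Bochner_Integration.integral_cong refl) (auto simp: norm_mult norm_power space_unit)
    finally show ?thesis .
  qed
  have MSh: "MS_Lp h y = of_real (LINT t|unit_measure. cmod (f t) / (1 - t * y))" for y
    unfolding MS_Lp_def markov_stieltjes_def h_def
    by (subst integral_complex_of_real[symmetric]) simp
  have inth: "integrable unit_measure (\<lambda>t. cmod (f t) / (1 - t * y))" if "y < 1" for y
  proof -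
    have "integrable unit_measure (\<lambda>t. Re (h t / (1 - of_real t * of_real y)))"
      using markov_stieltjes_integrable_real[OF L2_integrable[OF h(1)] that] by (rule integrable_Re)
    moreover have "Re (h t / (1 - of_real t * of_real y)) = cmod (f t) / (1 - t * y)" for t
    proof -
      have "h t / (1 - of_real t * of_real y) = complex_of_real (cmod (f t) / (1 - t * y))"
        by (simp add: h_def)
      then show ?thesis by (simp only: Re_complex_of_real)
    qed
    ultimately show ?thesis by simp
  qed
  let ?g = "\<lambda>y. complex_of_real (cmod (MS_Lp h y))"
  have g: "?g \<in> elems L2" "snorm L2 ?g = snorm L2 (MS_Lp h)"
    using Lp_space_norm_of_real[OF L2_MS_in[OF h(1)]] by auto
  have pt: "(\<Sum>n<N. m n * y ^ n) \<le> cmod (MS_Lp h y)" if y: "0 < y" "y < 1" for y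
  proof -
    have "(\<Sum>n<N. m n * y ^ n) = (LINT t|unit_measure. (\<Sum>n<N. cmod (f t) * t ^ n * y ^ n))"
      unfolding m_def using int by (subst Bochner_Integration.integral_sum) auto
    also have "\<dots> \<le> (LINT t|unit_measure. cmod (f t) / (1 - t * y))"
    proof (rule integral_mono)
      show "integrable unit_measure (\<lambda>t. \<Sum>n<N. cmod (f t) * t ^ n * y ^ n)" using int by auto
      show "integrable unit_measure (\<lambda>t. cmod (f t) / (1 - t * y))" using inth[OF y(2)] .
      fix t assume "t \<in> space unit_measure"
      then have t: "0 < t" "t < 1" by (auto simp: space_unit)
      then have ty: "0 \<le> t * y" "t * y < 1" using y one_minus_mult_pos[OF t y] by auto
      have "(\<Sum>n<N. (t * y) ^ n) \<le> (\<Sum>n. (t * y) ^ n)"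
        using ty by (intro sum_le_suminf summable_geometric) auto
      also have "\<dots> = 1 / (1 - t * y)" using ty by (intro suminf_geometric) auto
      finally have "cmod (f t) * (\<Sum>n<N. (t * y) ^ n) \<le> cmod (f t) * (1 / (1 - t * y))"
        by (intro mult_left_mono) auto
      then show "(\<Sum>n<N. cmod (f t) * t ^ n * y ^ n) \<le> cmod (f t) / (1 - t * y)"
        by (simp add: sum_distrib_left power_mult_distrib mult.assoc)
    qed
    also have "\<dots> \<le> cmod (MS_Lp h y)" unfolding MSh by simp
    finally show ?thesis .
  qed
  have "(\<Sum>n<N. (cmod (moments f n))\<^sup>2) \<le> (\<Sum>n<N. m n * m n)"
    using le m0 by (intro sum_mono) (simp add: power2_eq_square mult_mono)
  \<comment> \<open>One of the two factors \<open>m n\<close> is written out as an integral over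
    \<open>y\<close>.\<close>
  also have "\<dots> = (LINT y|unit_measure. cmod (f y) * (\<Sum>n<N. m n * y ^ n))"
  proof -
    have "m n * m n = (LINT y|unit_measure. m n * (cmod (f y) * y ^ n))" for n
      by (subst Bochner_Integration.integral_mult_right_zero) (simp add: m_def)
    then have "(\<Sum>n<N. m n * m n) = (\<Sum>n<N. LINT y|unit_measure. m n * (cmod (f y) * y ^ n))"
      by (intro sum.cong refl)
    also have "\<dots> = (LINT y|unit_measure. (\<Sum>n<N. m n * (cmod (f y) * y ^ n)))"
      using int by (intro Bochner_Integration.integral_sum[symmetric]) auto
    finally have "(\<Sum>n<N. m n * m n) = (LINT y|unit_measure. (\<Sum>n<N. m n * (cmod (f y) * y ^ n)))" .
    then show ?thesis by (simp add: sum_distrib_left mult.left_commute)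
  qed
  also have "\<dots> \<le> (LINT y|unit_measure. cmod (f y) * cmod (MS_Lp h y))"
  proof (rule integral_mono)
    have "integrable unit_measure (\<lambda>y. \<Sum>n<N. m n * (cmod (f y) * y ^ n))" using int by auto
    then show "integrable unit_measure (\<lambda>y. cmod (f y) * (\<Sum>n<N. m n * y ^ n))"
      by (simp add: sum_distrib_left mult.left_commute)
    have "integrable unit_measure (\<lambda>y. cmod (h y * ?g y))"
      by (rule integrable_norm[OF L2_integrable_mult[OF h(1) g(1)]])
    then show "integrable unit_measure (\<lambda>y. cmod (f y) * cmod (MS_Lp h y))"
      by (simp add: h_def norm_mult)
  qed (auto intro!: mult_left_mono pt simp: space_unit)
  also have "\<dots> = Re (L2_ip unit_measure h ?g)"
  proof -
    have "L2_ip unit_measure h ?g = (LINT y|unit_measure. complex_of_real (cmod (f y) * cmod (MS_Lp h y)))"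
      unfolding L2_ip_def h_def by simp
    then show ?thesis by (simp only: integral_complex_of_real Re_complex_of_real)
  qed
  also have "\<dots> \<le> snorm L2 h * snorm L2 ?g"
    using L2.Cauchy_Schwarz[OF h(1) g(1)] complex_Re_le_cmod[of "L2_ip unit_measure h ?g"] by linarith
  also have "\<dots> \<le> snorm L2 f * (pi * snorm L2 f)"
    using L2_norm_MS_le[OF h(1)] h(2) g(2) Lp_space_nonneg by (intro mult_mono) auto
  finally show ?thesis by (simp add: power2_eq_square mult_ac)
qed

lemma moments_in: "f \<in> elems L2 \<Longrightarrow> moments f \<in> elems l2"
  unfolding l2_mem using sum_moments_le[of f] by (intro summableI_nonneg_bounded) auto

lemma moments_norm_sq: "f \<in> elems L2 \<Longrightarrow> (snorm l2 (moments f))\<^sup>2 \<le> pi * (snorm L2 f)\<^sup>2"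
  unfolding l2_norm_sq[OF moments_in] using sum_moments_le[of f] moments_in[of f]
  by (intro suminf_le_const) (auto simp: l2_mem)

lemma moments_exact_linear: "exact_linear L2 l2 moments"
proof (rule exact_linearI)
  show "moments (\<lambda>x. f x + g x) = (\<lambda>n. moments f n + moments g n)" if "f \<in> elems L2" "g \<in> elems L2" for f g
    using moments_integrable[OF that(1)] moments_integrable[OF that(2)]
    by (simp add: moments_def distrib_right fun_eq_iff)
  show "moments (\<lambda>x. c * f x) = (\<lambda>n. c * moments f n)" for c f
    by (simp add: moments_def mult.assoc fun_eq_iff)
qed (rule moments_in)

section \<open>Power series with square-summable coefficients\<close>

lemma l2_summable_power:
  assumes a: "a \<in> elems l2" and z: "cmod z < 1"
  shows "summable (\<lambda>n. cmod (a n * z ^ n))"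
proof (rule summable_comparison_test')
  have "(cmod z)\<^sup>2 < 1" using z by (simp add: abs_square_less_1)
  then show "summable (\<lambda>n. (cmod (a n))\<^sup>2 + ((cmod z)\<^sup>2) ^ n)"
    using a by (intro summable_add summable_geometric) (auto simp: l2_mem)
  fix n
  have "2 * (cmod (a n) * cmod z ^ n) \<le> (cmod (a n))\<^sup>2 + (cmod z ^ n)\<^sup>2"
    using sum_squares_bound[of "cmod (a n)" "cmod z ^ n"] by (simp add: mult.assoc)
  moreover have "0 \<le> cmod (a n) * cmod z ^ n" by simp
  ultimately have "cmod (a n) * cmod z ^ n \<le> (cmod (a n))\<^sup>2 + (cmod z ^ n)\<^sup>2" by linarith
  then show "norm (cmod (a n * z ^ n)) \<le> (cmod (a n))\<^sup>2 + ((cmod z)\<^sup>2) ^ n"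
    by (simp add: norm_mult norm_power power_mult[symmetric] mult.commute)
qed

lemma series_unit_sums:
  assumes "a \<in> elems l2" "0 < t" "t < 1"
  shows "(\<lambda>n. a n * of_real t ^ n) sums series_unit a t"
  using summable_norm_cancel[OF l2_summable_power[OF assms(1), of "of_real t"]] assms
  by (simp add: series_unit_def summable_sums)

definition partial_series :: "(nat \<Rightarrow> complex) \<Rightarrow> nat \<Rightarrow> real \<Rightarrow> complex" where
  "partial_series a N t = (\<Sum>n<N. a n * of_real t ^ n)"

lemma partial_series_in: "partial_series a N \<in> elems L2"
proof -
  have "(\<lambda>t. of_real t ^ n) \<in> elems L2" for n
  proof -
    show ?thesis
    proof (rule Lp_space_snorm_mono(1))
      show "(\<lambda>t :: real. of_real t ^ n :: complex) \<in> borel_measurable unit_measure"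
        by (rule borel_measurable_unit) measurable
      show "(\<lambda>t. 1 :: complex) \<in> elems L2" by (simp add: Lp_space_mem)
      show "AE t in unit_measure. cmod (of_real t ^ n) \<le> cmod 1"
        by (rule AE_I2) (auto simp: norm_power power_le_one space_unit)
    qed simp
  qed
  then show ?thesis unfolding partial_series_def by (intro L2.sum_in L2.scale_in)
qed

lemma ip_partial_series:
  assumes f: "f \<in> elems L2"
  shows "L2_ip unit_measure f (partial_series a N) = (\<Sum>n<N. moments f n * cnj (a n))"
proof -
  have "L2_ip unit_measure f (partial_series a N) = (LINT t|unit_measure. (\<Sum>n<N. (f t * of_real t ^ n) * cnj (a n)))"
    unfolding L2_ip_def partial_series_def by (simp add: sum_distrib_left mult_ac)
  also have "\<dots> = (\<Sum>n<N. moments f n * cnj (a n))"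
    unfolding moments_def using moments_integrable[OF f]
    by (subst Bochner_Integration.integral_sum) auto
  finally show ?thesis .
qed

text \<open>Duality: the squared norm of the polynomial pairs its moments with its coefficients, so
  Cauchy-Schwarz and the bound on moments leave one factor of the norm to cancel.\<close>

lemma partial_series_norm:
  assumes a: "a \<in> elems l2"
  shows "snorm L2 (partial_series a N) \<le> sqrt pi * snorm l2 a"
proof -
  let ?p = "partial_series a N" and ?b = "\<lambda>n. if n < N then a n else 0"
  note p = partial_series_in[of a N]
  have b: "?b \<in> elems l2" unfolding l2_mem by (rule summable_finite[of "{..<N}"]) auto
  have ba: "snorm l2 ?b \<le> snorm l2 a"
    using Lp_space_snorm_mono(2)[of 2 ?b "count_space UNIV" a] a by auto
  have "(snorm L2 ?p)\<^sup>2 = Re (L2_ip unit_measure ?p ?p)" using p by (simp add: L2.Re_ip_self)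
  also have "L2_ip unit_measure ?p ?p = L2_ip (count_space UNIV) (moments ?p) ?b"
  proof -
    have "(\<lambda>n. moments ?p n * cnj (?b n)) sums (\<Sum>n<N. moments ?p n * cnj (?b n))"
      by (rule sums_finite) auto
    then show ?thesis
      using l2_ip_sums[OF moments_in[OF p] b] sums_unique2 by (fastforce simp: ip_partial_series[OF p])
  qed
  also have "Re (L2_ip (count_space UNIV) (moments ?p) ?b) \<le> snorm l2 (moments ?p) * snorm l2 ?b"
    by (rule order_trans[OF complex_Re_le_cmod l2.Cauchy_Schwarz[OF moments_in[OF p] b]])
  also have "\<dots> \<le> (sqrt pi * snorm L2 ?p) * snorm l2 a"
  proof (rule mult_mono)
    show nn: "0 \<le> sqrt pi * snorm L2 ?p"
      using Lp_space_nonneg by (intro mult_nonneg_nonneg) auto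
    have sq: "(snorm l2 (moments ?p))\<^sup>2 \<le> (sqrt pi * snorm L2 ?p)\<^sup>2"
      using moments_norm_sq[OF p] by (simp add: power_mult_distrib)
    show "snorm l2 (moments ?p) \<le> sqrt pi * snorm L2 ?p"
      by (rule power2_le_imp_le[OF sq nn])
  qed (use ba Lp_space_nonneg in auto)
  finally have "snorm L2 ?p * snorm L2 ?p \<le> snorm L2 ?p * (sqrt pi * snorm l2 a)"
    by (simp add: power2_eq_square mult_ac)
  then show ?thesis
    using Lp_space_nonneg[of unit_measure 2 ?p] Lp_space_nonneg[of "count_space UNIV" 2 a]
    by (cases "snorm L2 ?p = 0") (auto simp: mult_le_cancel_left)
qed

lemma partial_series_lim:
  assumes "a \<in> elems l2" "0 < t" "t < 1"
  shows "(\<lambda>N. partial_series a N t) \<longlonglongrightarrow> series_unit a t"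
  using series_unit_sums[OF assms] by (simp add: sums_def partial_series_def)

lemma series_unit_measurable:
  assumes a: "a \<in> elems l2"
  shows "series_unit a \<in> borel_measurable unit_measure"
  by (rule borel_measurable_LIMSEQ_metric[where f = "\<lambda>N. partial_series a N"])
     (use partial_series_in partial_series_lim[OF a] in \<open>auto simp: space_unit Lp_space_mem\<close>)

text \<open>The uniform bound on the partial sums passes to the pointwise limit by Fatou's
  lemma.\<close>

lemma series_unit_in:
  assumes a: "a \<in> elems l2"
  shows "series_unit a \<in> elems L2"
proof (rule Lp_spaceI(1)[where C = "sqrt pi * snorm l2 a"])
  have [measurable]: "partial_series a N \<in> borel_measurable unit_measure" for N
    using partial_series_in by (auto simp: Lp_space_mem)
  have "(\<integral>\<^sup>+t. ennreal (cmod (series_unit a t) powr 2) \<partial>unit_measure) =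
      (\<integral>\<^sup>+t. liminf (\<lambda>N. ennreal (cmod (partial_series a N t) powr 2)) \<partial>unit_measure)"
  proof (rule nn_integral_cong)
    fix t assume "t \<in> space unit_measure"
    then have "(\<lambda>N. (cmod (partial_series a N t))\<^sup>2) \<longlonglongrightarrow> (cmod (series_unit a t))\<^sup>2"
      by (intro tendsto_intros partial_series_lim[OF a]) (auto simp: space_unit)
    then show "ennreal (cmod (series_unit a t) powr 2) =
        liminf (\<lambda>N. ennreal (cmod (partial_series a N t) powr 2))"
      by (intro lim_imp_Liminf[symmetric] tendsto_ennrealI) auto
  qed
  also have "\<dots> \<le> liminf (\<lambda>N. \<integral>\<^sup>+t. ennreal (cmod (partial_series a N t) powr 2) \<partial>unit_measure)"
    by (rule nn_integral_liminf) measurable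
  also have "\<dots> \<le> ennreal ((sqrt pi * snorm l2 a) powr 2)"
  proof -
    have "(\<integral>\<^sup>+t. ennreal (cmod (partial_series a N t) powr 2) \<partial>unit_measure) \<le> ennreal ((sqrt pi * snorm l2 a) powr 2)" for N
      unfolding Lp_space_nn_integral[OF zero_less_numeral partial_series_in]
      using partial_series_norm[OF a] Lp_space_nonneg by (intro ennreal_leI powr_mono2) auto
    then show ?thesis
      using Liminf_mono[of "\<lambda>N. \<integral>\<^sup>+t. ennreal (cmod (partial_series a N t) powr 2) \<partial>unit_measure"
          "\<lambda>_. ennreal ((sqrt pi * snorm l2 a) powr 2)" sequentially] by (simp add: Liminf_const)
  qed
  finally show "(\<integral>\<^sup>+t. ennreal (cmod (series_unit a t) powr 2) \<partial>unit_measure) \<le> ennreal ((sqrt pi * snorm l2 a) powr 2)" .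
  show "0 \<le> sqrt pi * snorm l2 a" by (intro mult_nonneg_nonneg Lp_space_nonneg) auto
qed (use series_unit_measurable[OF a] in auto)

lemma series_unit_exact_linear: "exact_linear l2 L2 series_unit"
proof (rule exact_linearI)
  fix a b assume ab: "a \<in> elems l2" "b \<in> elems l2"
  show "series_unit (\<lambda>n. a n + b n) = (\<lambda>t. series_unit a t + series_unit b t)"
  proof
    fix t :: real
    show "series_unit (\<lambda>n. a n + b n) t = series_unit a t + series_unit b t"
    proof (cases "t \<in> {0<..<1}")
      case True
      then have t: "0 < t" "t < 1" by auto
      have "(\<lambda>n. a n * of_real t ^ n + b n * of_real t ^ n) sums (series_unit a t + series_unit b t)"
        by (intro sums_add series_unit_sums ab t)
      then show ?thesis
        using sums_unique2[OF series_unit_sums[OF l2.add_in[OF ab] t]] by (simp add: distrib_right)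
    qed (auto simp: series_unit_def)
  qed
next
  fix a c assume a: "a \<in> elems l2"
  show "series_unit (\<lambda>n. c * a n) = (\<lambda>t. c * series_unit a t)"
  proof
    fix t :: real
    show "series_unit (\<lambda>n. c * a n) t = c * series_unit a t"
    proof (cases "t \<in> {0<..<1}")
      case True
      then have t: "0 < t" "t < 1" by auto
      have "(\<lambda>n. c * (a n * of_real t ^ n)) sums (c * series_unit a t)"
        by (intro sums_mult series_unit_sums a t)
      then show ?thesis
        using sums_unique2[OF series_unit_sums[OF l2.scale_in[OF a] t]] by (simp add: mult.assoc)
    qed (auto simp: series_unit_def)
  qed
qed (rule series_unit_in)

text \<open>True for polynomials by linearity. The limit is dominated by |f| times the series with
  coefficients \<open>cmod (a n)\<close>, which is again in L^2.\<close>

lemma moments_adjoint: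
  assumes f: "f \<in> elems L2" and a: "a \<in> elems l2"
  shows "L2_ip (count_space UNIV) (moments f) a = L2_ip unit_measure f (series_unit a)"
proof -
  let ?b = "\<lambda>n. complex_of_real (cmod (a n))"
  have b: "?b \<in> elems l2" using a by (simp add: l2_mem)
  have "(\<lambda>N. L2_ip unit_measure f (partial_series a N)) \<longlonglongrightarrow> L2_ip (count_space UNIV) (moments f) a"
    using l2_ip_sums[OF moments_in[OF f] a] by (simp add: sums_def ip_partial_series[OF f])
  moreover have "(\<lambda>N. L2_ip unit_measure f (partial_series a N)) \<longlonglongrightarrow> L2_ip unit_measure f (series_unit a)"
    unfolding L2_ip_def
  proof (rule integral_dominated_convergence)
    show "integrable unit_measure (\<lambda>t. cmod (f t * series_unit ?b t))"
      by (rule integrable_norm[OF L2_integrable_mult[OF f series_unit_in[OF b]]])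
    show "(\<lambda>t. f t * cnj (series_unit a t)) \<in> borel_measurable unit_measure"
      using L2_integrable_mult[OF f Lp_space_cnj[OF series_unit_in[OF a]]] by auto
    show "(\<lambda>t. f t * cnj (partial_series a N t)) \<in> borel_measurable unit_measure" for N
      using L2_integrable_mult[OF f Lp_space_cnj[OF partial_series_in]] by auto
    show "AE t in unit_measure. (\<lambda>N. f t * cnj (partial_series a N t)) \<longlonglongrightarrow> f t * cnj (series_unit a t)"
      by (rule AE_I2) (auto intro!: tendsto_intros tendsto_cnj partial_series_lim[OF a] simp: space_unit)
    show "AE t in unit_measure. norm (f t * cnj (partial_series a N t)) \<le> cmod (f t * series_unit ?b t)" for N
    proof (rule AE_I2)
      fix t assume "t \<in> space unit_measure"
      then have t: "0 < t" "t < 1" by (auto simp: space_unit)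
      have s: "(\<lambda>n. cmod (a n) * t ^ n) sums Re (series_unit ?b t)"
        using sums_Re[OF series_unit_sums[OF b t]] by (simp flip: of_real_power of_real_mult)
      have "cmod (partial_series a N t) \<le> (\<Sum>n<N. cmod (a n) * t ^ n)"
        unfolding partial_series_def using t by (intro order_trans[OF norm_sum]) (simp add: norm_mult norm_power)
      also have "\<dots> \<le> Re (series_unit ?b t)"
        using t sums_unique[OF s] by (auto intro!: sum_le_suminf sums_summable[OF s])
      also have "\<dots> \<le> cmod (series_unit ?b t)" by (rule complex_Re_le_cmod)
      finally show "norm (f t * cnj (partial_series a N t)) \<le> cmod (f t * series_unit ?b t)"
        by (simp add: norm_mult mult_left_mono)
    qed
  qed
  ultimately show ?thesis using LIMSEQ_unique by blast
qed

text \<open>Expand the kernel in a geometric series. Read on (0, 1) this is S = A V; read on the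
  disc it identifies the Taylor coefficients of the transform as moments.\<close>

lemma markov_stieltjes_sums:
  assumes f: "f \<in> elems L2" and z: "cmod z < 1"
  shows "(\<lambda>n. moments f n * z ^ n) sums markov_stieltjes f z"
proof -
  have tz: "cmod (of_real t * z) \<le> cmod z" if "0 < t" "t < 1" for t :: real
    using that by (simp add: norm_mult mult_left_le_one_le)
  have [measurable]: "f \<in> borel_measurable unit_measure" using f by (simp add: Lp_space_mem)
  note [measurable] = measurable_ident_unit
  have "(\<lambda>N. LINT t|unit_measure. (\<Sum>n<N. (f t * of_real t ^ n) * z ^ n)) \<longlonglongrightarrow> markov_stieltjes f z"
    unfolding markov_stieltjes_def
  proof (rule integral_dominated_convergence)
    show "integrable unit_measure (\<lambda>t. cmod (f t) * (1 / (1 - cmod z)))"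
      using L2_integrable[OF f] by auto
    show "(\<lambda>t. f t / (1 - of_real t * z)) \<in> borel_measurable unit_measure" by measurable
    show "(\<lambda>t. \<Sum>n<N. (f t * of_real t ^ n) * z ^ n) \<in> borel_measurable unit_measure" for N
      by measurable
    have eq: "(\<Sum>n<N. (f t * of_real t ^ n) * z ^ n) = f t * (\<Sum>n<N. (of_real t * z) ^ n)" for t N
      by (simp add: sum_distrib_left power_mult_distrib mult.assoc)
    show "AE t in unit_measure. (\<lambda>N. \<Sum>n<N. (f t * of_real t ^ n) * z ^ n) \<longlonglongrightarrow> f t / (1 - of_real t * z)"
    proof (rule AE_I2)
      fix t assume "t \<in> space unit_measure"
      then have "cmod (of_real t * z) < 1" using tz[of t] z by (simp add: space_unit)
      then have "(\<lambda>n. (of_real t * z) ^ n) sums (1 / (1 - of_real t * z))" by (rule geometric_sums)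
      then have "(\<lambda>N. \<Sum>n<N. (of_real t * z) ^ n) \<longlonglongrightarrow> 1 / (1 - of_real t * z)" by (simp add: sums_def)
      from tendsto_mult_left[OF this, of "f t"]
      show "(\<lambda>N. \<Sum>n<N. (f t * of_real t ^ n) * z ^ n) \<longlonglongrightarrow> f t / (1 - of_real t * z)"
        unfolding eq by simp
    qed
    show "AE t in unit_measure. norm (\<Sum>n<N. (f t * of_real t ^ n) * z ^ n) \<le> cmod (f t) * (1 / (1 - cmod z))" for N
    proof (rule AE_I2)
      fix t assume "t \<in> space unit_measure"
      then have t: "cmod (of_real t * z) \<le> cmod z" using tz[of t] by (simp add: space_unit)
      have "cmod (\<Sum>n<N. (of_real t * z) ^ n) \<le> (\<Sum>n<N. cmod z ^ n)"
        using t by (intro order_trans[OF norm_sum] sum_mono) (simp add: norm_power power_mono)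
      also have "\<dots> \<le> (\<Sum>n. cmod z ^ n)" using z by (intro sum_le_suminf summable_geometric) auto
      also have "\<dots> = 1 / (1 - cmod z)" using z by (intro suminf_geometric) auto
      finally show "norm (\<Sum>n<N. (f t * of_real t ^ n) * z ^ n) \<le> cmod (f t) * (1 / (1 - cmod z))"
        unfolding eq norm_mult by (intro mult_left_mono) auto
    qed
  qed
  moreover have "(LINT t|unit_measure. (\<Sum>n<N. (f t * of_real t ^ n) * z ^ n)) = (\<Sum>n<N. moments f n * z ^ n)" for N
    unfolding moments_def using moments_integrable[OF f]
    by (subst Bochner_Integration.integral_sum) auto
  ultimately show ?thesis by (simp add: sums_def)
qed

lemma series_moments:
  assumes f: "f \<in> elems L2" and t: "0 < t" "t < 1"
  shows "series_unit (moments f) t = MS_Lp f t"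
  using sums_unique2[OF series_unit_sums[OF moments_in[OF f] t] markov_stieltjes_sums[OF f, of "of_real t"]] t
  by (simp add: MS_Lp_def)

text \<open>Vanishing moments give \<open>\<integral> f g = 0\<close> for \<open>g\<close> a polynomial, then for \<open>g\<close> continuous (Weierstrass), then for
  \<open>g\<close> bounded measurable (a limit of continuous functions almost everywhere), and finally for \<open>g = cnj (sgn f)\<close>.\<close>

lemma moments_zero_imp_continuous:
  assumes f: "f \<in> elems L2" and m: "\<And>n. moments f n = 0" and g: "continuous_on UNIV (g :: real \<Rightarrow> real)"
  shows "(LINT t|unit_measure. f t * of_real (g t)) = 0"
proof -
  have [measurable]: "g \<in> borel_measurable borel" using g by (rule borel_measurable_continuous_onI)
  define I where "I = (LINT t|unit_measure. cmod (f t))"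
  have I: "I \<ge> 0" unfolding I_def by (rule Bochner_Integration.integral_nonneg_AE) auto
  have fint: "integrable unit_measure f" by (rule L2_integrable[OF f])
  obtain B where B: "\<And>t. t \<in> {0..1} \<Longrightarrow> \<bar>g t\<bar> \<le> B"
  proof -
    have "bounded (g ` {0..1})"
      by (intro compact_imp_bounded compact_continuous_image continuous_on_subset[OF g] compact_Icc) auto
    then obtain B where "\<forall>x\<in>g ` {0..1}. norm x \<le> B" by (auto simp: bounded_iff)
    then show thesis using that[of B] by auto
  qed
  have fg: "integrable unit_measure (\<lambda>t. f t * of_real (g t))"
    by (rule integrable_times_bounded[OF fint, where C = B]) (use B in auto)
  have le: "cmod (LINT t|unit_measure. f t * of_real (g t)) \<le> e * I" if e: "e > 0" for e
  proof -
    obtain q where q: "real_polynomial_function q" "\<And>x. x \<in> {0..1} \<Longrightarrow> \<bar>g x - q x\<bar> < e"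
      using Stone_Weierstrass_real_polynomial_function[OF compact_Icc continuous_on_subset[OF g subset_UNIV] e] by blast
    then obtain c N where qs: "q = (\<lambda>x. \<Sum>i\<le>N. c i * x ^ i)"
      by (auto simp: real_polynomial_function_iff_sum)
    have eq: "f t * of_real (q t) = (\<Sum>i\<le>N. of_real (c i) * (f t * of_real t ^ i))" for t
      by (simp add: qs sum_distrib_left mult_ac)
    have fq: "integrable unit_measure (\<lambda>t. f t * of_real (q t))"
      unfolding eq using moments_integrable[OF f] by auto
    have "(LINT t|unit_measure. f t * of_real (q t)) = (\<Sum>i\<le>N. of_real (c i) * moments f i)"
      unfolding eq moments_def using moments_integrable[OF f] by (subst Bochner_Integration.integral_sum) auto
    then have "(LINT t|unit_measure. f t * of_real (q t)) = 0" using m by simp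
    then have "(LINT t|unit_measure. f t * of_real (g t)) = (LINT t|unit_measure. f t * of_real (g t) - f t * of_real (q t))"
      using fg fq by (subst Bochner_Integration.integral_diff) auto
    also have "cmod \<dots> \<le> (LINT t|unit_measure. cmod (f t * of_real (g t) - f t * of_real (q t)))"
      by (rule integral_norm_bound)
    also have "\<dots> \<le> (LINT t|unit_measure. e * cmod (f t))"
    proof (rule integral_mono)
      fix t assume "t \<in> space unit_measure"
      then have "\<bar>g t - q t\<bar> \<le> e" using q(2)[of t] by (simp add: space_unit)
      then have "cmod (f t) * \<bar>g t - q t\<bar> \<le> cmod (f t) * e" by (intro mult_left_mono) auto
      moreover have "cmod (f t * of_real (g t) - f t * of_real (q t)) = cmod (f t) * \<bar>g t - q t\<bar>"
        by (metis norm_mult norm_of_real of_real_diff right_diff_distrib)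
      ultimately show "cmod (f t * of_real (g t) - f t * of_real (q t)) \<le> e * cmod (f t)"
        by (simp add: mult.commute)
    qed (use fg fq fint in auto)
    also have "\<dots> = e * I" by (simp add: I_def)
    finally show ?thesis .
  qed
  have "cmod (LINT t|unit_measure. f t * of_real (g t)) \<le> 0 + e" if "e > 0" for e
  proof -
    have "e / (I + 1) * I \<le> e"
      using mult_left_mono[of "I / (I + 1)" 1 e] that I by simp
    then show ?thesis using le[of "e / (I + 1)"] that I by simp
  qed
  then have "cmod (LINT t|unit_measure. f t * of_real (g t)) \<le> 0" by (rule field_le_epsilon)
  then show ?thesis by simp
qed

lemma moments_zero_imp_bounded:
  assumes f: "f \<in> elems L2" and m: "\<And>n. moments f n = 0"
    and u: "u \<in> borel_measurable unit_measure" "\<And>t. \<bar>u t\<bar> \<le> (1 :: real)"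
  shows "(LINT t|unit_measure. f t * of_real (u t)) = 0"
proof -
  have "(\<lambda>t. if t \<in> {0<..<1} then u t else 0) \<in> borel_measurable lebesgue"
    by (rule borel_measurable_if_I[OF u(1)]) simp
  then have "(\<lambda>t. if t \<in> {0<..<1} then u t else 0) measurable_on UNIV"
    by (rule lebesgue_measurable_imp_measurable_on_real) simp
  then obtain N g where N: "negligible N" and g: "\<And>n. continuous_on UNIV (g n)"
    "\<And>t. t \<notin> N \<Longrightarrow> (\<lambda>n. g n t) \<longlonglongrightarrow> (if t \<in> {0<..<1} then u t else 0)"
    by (auto simp: measurable_on_def)
  \<comment> \<open>Clipping keeps continuity and the limit \<open>u\<close>, whose modulus is at
    most 1, and makes |f| a majorant.\<close>
  define h where "h n t = max (-1) (min 1 (g n t))" for n :: nat and t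
  have h: "continuous_on UNIV (h n)" for n
    unfolding h_def by (intro continuous_intros g)
  have hb: "\<bar>h n t\<bar> \<le> 1" for n t by (auto simp: h_def)
  have AEN: "AE t in unit_measure. t \<notin> N"
  proof -
    have "N \<in> null_sets lebesgue" using N by (simp add: negligible_iff_null_sets)
    then have "AE t in lebesgue. t \<notin> N" by (rule AE_not_in)
    then show ?thesis by (subst AE_restrict_space_iff) auto
  qed
  have fint: "integrable unit_measure f" by (rule L2_integrable[OF f])
  have [measurable]: "f \<in> borel_measurable unit_measure" "u \<in> borel_measurable unit_measure"
    using fint u by auto
  have [measurable]: "h n \<in> borel_measurable unit_measure" for n
    by (rule borel_measurable_unit) (rule borel_measurable_continuous_onI[OF h])
  have "(\<lambda>n. LINT t|unit_measure. f t * of_real (h n t)) \<longlonglongrightarrow> (LINT t|unit_measure. f t * of_real (u t))"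
  proof (rule integral_dominated_convergence)
    show "integrable unit_measure (\<lambda>t. cmod (f t))" using fint by auto
    show "AE t in unit_measure. (\<lambda>n. f t * of_real (h n t)) \<longlonglongrightarrow> f t * of_real (u t)"
    proof (rule AE_mp[OF AEN AE_I2], intro impI)
      fix t assume t: "t \<in> space unit_measure" "t \<notin> N"
      then have "(\<lambda>n. g n t) \<longlonglongrightarrow> u t" using g(2)[of t] by (simp add: space_unit)
      then have "(\<lambda>n. h n t) \<longlonglongrightarrow> max (-1) (min 1 (u t))"
        unfolding h_def by (intro tendsto_intros)
      moreover have "max (-1) (min 1 (u t)) = u t" using u(2)[of t] by auto
      ultimately show "(\<lambda>n. f t * of_real (h n t)) \<longlonglongrightarrow> f t * of_real (u t)"
        by (intro tendsto_intros) simp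
    qed
    show "AE t in unit_measure. norm (f t * of_real (h n t)) \<le> cmod (f t)" for n
      using hb by (intro AE_I2) (simp add: norm_mult mult_left_le)
  qed measurable
  moreover have "(LINT t|unit_measure. f t * of_real (h n t)) = 0" for n
    by (rule moments_zero_imp_continuous[OF f m h])
  ultimately show ?thesis using LIMSEQ_unique[OF _ tendsto_const] by fastforce
qed

lemma moments_inj:
  assumes f: "f \<in> elems L2" and 0: "snorm l2 (moments f) = 0"
  shows "snorm L2 f = 0"
proof -
  have "AE n in count_space UNIV. moments f n = 0"
    using Lp_space_snorm_eq_0[OF _ moments_in[OF f]] 0 by simp
  then have m: "moments f n = 0" for n by (simp add: AE_count_space)
  have fint: "integrable unit_measure f" by (rule L2_integrable[OF f])
  have [measurable]: "f \<in> borel_measurable unit_measure" using fint by auto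
  define s where "s t = sgn (f t)" for t
  have [measurable]: "s \<in> borel_measurable unit_measure"
    unfolding s_def sgn_div_norm by measurable
  have s1: "\<bar>Re (s t)\<bar> \<le> 1" "\<bar>Im (s t)\<bar> \<le> 1" for t
    using order_trans[OF abs_Re_le_cmod, of "s t" 1] order_trans[OF abs_Im_le_cmod, of "s t" 1]
    by (auto simp: s_def norm_sgn)
  have u: "(LINT t|unit_measure. f t * of_real (Re (s t))) = 0"
    and v: "(LINT t|unit_measure. f t * of_real (Im (s t))) = 0"
    by (intro moments_zero_imp_bounded[OF f m] s1; measurable)+
  have iu: "integrable unit_measure (\<lambda>t. f t * of_real (Re (s t)))"
    "integrable unit_measure (\<lambda>t. f t * of_real (Im (s t)))"
    using s1 by (auto intro!: Bochner_Integration.integrable_bound[OF integrable_norm[OF fint]] mult_left_le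
        AE_I2 simp: norm_mult)
  \<comment> \<open>The test function \<open>cnj (sgn f)\<close> is split into real and imaginary
    parts, because \<open>moments_zero_imp_bounded\<close> concerns real test functions.\<close>
  have eq: "complex_of_real (cmod (f t)) = f t * of_real (Re (s t)) - \<i> * (f t * of_real (Im (s t)))" for t
  proof -
    have "complex_of_real (cmod (f t)) = f t * cnj (s t)"
    proof (cases "f t = 0")
      case False
      have "f t * cnj (s t) = f t * cnj (f t) / of_real (cmod (f t))"
        by (simp add: s_def sgn_eq)
      also have "\<dots> = of_real (cmod (f t))"
        using False complex_norm_square[of "f t"] by (simp add: power2_eq_square field_simps)
      finally show ?thesis by simp
    qed auto
    also have "cnj (s t) = of_real (Re (s t)) - \<i> * of_real (Im (s t))"
      by (simp add: complex_eq_iff)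
    finally show ?thesis by (simp add: right_diff_distrib mult.left_commute)
  qed
  have "complex_of_real (LINT t|unit_measure. cmod (f t)) = (LINT t|unit_measure. complex_of_real (cmod (f t)))"
    by (rule integral_complex_of_real[symmetric])
  also have "\<dots> = 0" unfolding eq using iu u v by simp
  finally have "(LINT t|unit_measure. cmod (f t)) = 0" by simp
  then have "AE t in unit_measure. cmod (f t) = 0"
    using integral_nonneg_eq_0_iff_AE[OF integrable_norm[OF fint]] by simp
  then show ?thesis using Lp_space_snorm_eq_0[OF _ f] by simp
qed

section \<open>The Hardy space\<close>

lemma integral_cis_nat_diff:
  fixes m n :: nat
  shows "(LINT t|lebesgue_on {0..2 * pi}. cis (real m * t) * cnj (cis (real n * t))) = (if m = n then of_real (2 * pi) else 0)"
proof (cases "m = n")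
  case True
  have "cis (real n * t) * cnj (cis (real n * t)) = 1" for t
    by (simp add: cis_cnj cis_mult)
  then show ?thesis using True by (simp add: measure_restrict_space scaleR_conv_of_real)
next
  case False
  define k where "k = real m - real n"
  have k: "k \<noteq> 0" using False by (simp add: k_def)
  have eq: "cis (real m * t) * cnj (cis (real n * t)) = cis (k * t)" for t
    by (simp add: cis_cnj cis_mult k_def algebra_simps)
  have cont: "continuous_on {0..2 * pi} (\<lambda>t. cis (k * t))" by (intro continuous_intros)
  have "((\<lambda>t. cis (k * t)) has_integral (cis (k * (2 * pi)) / (\<i> * k) - cis (k * 0) / (\<i> * k))) {0..2 * pi}"
  proof (rule fundamental_theorem_of_calculus)
    fix t assume "t \<in> {0..2 * pi}"
    have "((\<lambda>t. exp (\<i> * of_real k * of_real t) / (\<i> * k)) has_vector_derivative cis (k * t)) (at t within {0..2 * pi})"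
    proof (rule has_vector_derivative_real_field)
      show "((\<lambda>z. exp (\<i> * of_real k * z) / (\<i> * k)) has_field_derivative cis (k * t)) (at (of_real t))"
        using k by (auto intro!: derivative_eq_intros simp: cis_conv_exp mult_ac)
    qed
    then show "((\<lambda>t. cis (k * t) / (\<i> * k)) has_vector_derivative cis (k * t)) (at t within {0..2 * pi})"
      by (simp add: cis_conv_exp mult_ac)
  qed simp
  moreover have "cis (k * (2 * pi)) = 1"
  proof -
    have "k * (2 * pi) = 2 * pi * of_int (int m - int n)" by (simp add: k_def)
    moreover have "cis (2 * pi * of_int (int m - int n)) = 1" by (rule cis_multiple_2pi) simp
    ultimately show ?thesis by (simp only:)
  qed
  ultimately have "integral {0..2 * pi} (\<lambda>t. cis (k * t)) = 0" by (simp add: integral_unique)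
  moreover have "integrable (lebesgue_on {0..2 * pi}) (\<lambda>t. cis (k * t))"
    using continuous_imp_integrable_real[OF cont] .
  ultimately show ?thesis using False by (simp add: eq lebesgue_integral_eq_integral)
qed

text \<open>For partial sums this is orthogonality of the exponentials. Absolute convergence at
  \<open>r\<close> bounds all partial sums by one constant on the circle, so bounded convergence
  applies.\<close>

lemma circle_mean:
  assumes r: "0 \<le> r" and sm: "summable (\<lambda>n. cmod (a n) * r ^ n)"
  shows "(\<lambda>n. (cmod (a n))\<^sup>2 * r ^ (2 * n)) sums
    ((LINT t|lebesgue_on {0..2 * pi}. (cmod (\<Sum>n. a n * rcis r t ^ n))\<^sup>2) / (2 * pi))"
proof -
  let ?M = "lebesgue_on {0..2 * pi}"
  define P where "P N t = (\<Sum>n<N. a n * rcis r t ^ n)" for N t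
  define B where "B = (\<Sum>n. cmod (a n) * r ^ n)"
  have pw: "rcis r t ^ n = of_real (r ^ n) * cis (real n * t)" for n t
    by (simp add: rcis_def power_mult_distrib Complex.DeMoivre)
  have nt: "cmod (a n * rcis r t ^ n) = cmod (a n) * r ^ n" for n t
    using r by (simp add: norm_mult norm_power)
  have [measurable]: "(\<lambda>t. cis (real n * t)) \<in> borel_measurable ?M" for n
    by (intro measurable_restrict_space1 measurable_completion)
       (simp, intro borel_measurable_continuous_onI continuous_intros)
  have [measurable]: "P N \<in> borel_measurable ?M" for N
    unfolding P_def pw by measurable
  have PB: "cmod (P N t) \<le> B" for N t
    unfolding P_def B_def
    by (rule order_trans[OF norm_sum]) (use r sm in \<open>auto simp: nt intro!: sum_le_suminf\<close>)
  have lim: "(\<lambda>N. P N t) \<longlonglongrightarrow> (\<Sum>n. a n * rcis r t ^ n)" for t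
  proof -
    have "summable (\<lambda>n. cmod (a n * rcis r t ^ n))" using sm by (simp add: nt)
    then have "summable (\<lambda>n. a n * rcis r t ^ n)" by (rule summable_norm_cancel)
    then show ?thesis unfolding P_def by (rule summable_LIMSEQ)
  qed
  have sq_le: "(cmod (P N t))\<^sup>2 \<le> B\<^sup>2" for N t
    using PB by (intro power_mono) auto
  have conv: "(\<lambda>N. LINT t|?M. (cmod (P N t))\<^sup>2) \<longlonglongrightarrow> (LINT t|?M. (cmod (\<Sum>n. a n * rcis r t ^ n))\<^sup>2)"
  proof (rule integral_dominated_convergence[where w = "\<lambda>t. B\<^sup>2"])
    show "(\<lambda>t. (cmod (\<Sum>n. a n * rcis r t ^ n))\<^sup>2) \<in> borel_measurable ?M"
      unfolding pw by measurable
    show "AE t in ?M. (\<lambda>N. (cmod (P N t))\<^sup>2) \<longlonglongrightarrow> (cmod (\<Sum>n. a n * rcis r t ^ n))\<^sup>2"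
      by (intro AE_I2 tendsto_intros lim)
  qed (use sq_le in auto)
  have fin: "(LINT t|?M. (cmod (P N t))\<^sup>2) = 2 * pi * (\<Sum>n<N. (cmod (a n))\<^sup>2 * r ^ (2 * n))" for N
  proof -
    let ?c = "\<lambda>n. a n * of_real (r ^ n)"
    have int: "integrable ?M (\<lambda>t. cis (real m * t) * cnj (cis (real n * t)))" for m n
      by (intro continuous_imp_integrable_real continuous_intros)
    have "complex_of_real (LINT t|?M. (cmod (P N t))\<^sup>2) = (LINT t|?M. P N t * cnj (P N t))"
      by (subst integral_complex_of_real[symmetric]) (simp only: complex_norm_square)
    also have "\<dots> = (LINT t|?M. (\<Sum>m<N. \<Sum>n<N. (?c m * cnj (?c n)) * (cis (real m * t) * cnj (cis (real n * t)))))"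
      unfolding P_def pw by (simp add: sum_product mult_ac)
    also have "\<dots> = (\<Sum>m<N. LINT t|?M. (\<Sum>n<N. (?c m * cnj (?c n)) * (cis (real m * t) * cnj (cis (real n * t)))))"
      by (intro Bochner_Integration.integral_sum Bochner_Integration.integrable_sum integrable_mult_right int)
    also have "\<dots> = (\<Sum>m<N. \<Sum>n<N. LINT t|?M. (?c m * cnj (?c n)) * (cis (real m * t) * cnj (cis (real n * t))))"
      by (intro sum.cong refl Bochner_Integration.integral_sum integrable_mult_right int)
    also have "\<dots> = (\<Sum>m<N. \<Sum>n<N. (?c m * cnj (?c n)) * (if m = n then of_real (2 * pi) else 0))"
      by (simp only: integral_mult_right_zero integral_cis_nat_diff)
    also have "\<dots> = (\<Sum>m<N. (?c m * cnj (?c m)) * of_real (2 * pi))"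
      by (intro sum.cong refl) (simp add: if_distrib sum.delta cong: if_cong)
    also have "\<dots> = of_real (2 * pi * (\<Sum>n<N. (cmod (a n))\<^sup>2 * r ^ (2 * n)))"
    proof -
      have "(cmod (?c m))\<^sup>2 = (cmod (a m))\<^sup>2 * r ^ (2 * m)" for m
        by (simp only: norm_mult norm_of_real power_mult_distrib power2_abs power_mult[symmetric] mult.commute[of m 2])
      then have "?c m * cnj (?c m) = of_real ((cmod (a m))\<^sup>2 * r ^ (2 * m))" for m
        by (metis complex_norm_square)
      then show ?thesis by (simp add: sum_distrib_left mult.commute)
    qed
    finally show ?thesis by (simp only: of_real_eq_iff)
  qed
  have "(\<lambda>N. (LINT t|?M. (cmod (P N t))\<^sup>2) / (2 * pi)) \<longlonglongrightarrow> (LINT t|?M. (cmod (\<Sum>n. a n * rcis r t ^ n))\<^sup>2) / (2 * pi)"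
    by (intro tendsto_divide conv tendsto_const) simp
  then show ?thesis unfolding fin sums_def by simp
qed

text \<open>Parseval on the circle of radius 1/2; convergence at 3/4 provides the absolute
  convergence needed there.\<close>

lemma power_series_coeffs_zero:
  assumes "\<And>z. cmod z < 1 \<Longrightarrow> (\<lambda>n. a n * z ^ n) sums 0"
  shows "a n = (0 :: complex)"
proof -
  have "summable (\<lambda>n. a n * (of_real (3 / 4)) ^ n)"
    using sums_summable[OF assms[of "of_real (3 / 4)"]] by simp
  from powser_insidea[OF this, of "1 / 2"]
  have sm: "summable (\<lambda>n. cmod (a n) * (1 / 2) ^ n)"
    by (simp add: norm_mult norm_power norm_divide)
  have "(\<Sum>n. a n * rcis (1 / 2) t ^ n) = 0" for t
    using assms[of "rcis (1 / 2) t"] by (simp add: sums_iff)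
  then have "(\<lambda>n. (cmod (a n))\<^sup>2 * (1 / 2) ^ (2 * n)) sums 0"
    using circle_mean[OF _ sm] by simp
  then have "(cmod (a n))\<^sup>2 * (1 / 2) ^ (2 * n) = 0"
    using suminf_eq_zero_iff[of "\<lambda>n. (cmod (a n))\<^sup>2 * (1 / 2) ^ (2 * n)"] by (simp add: sums_iff)
  then show ?thesis by simp
qed

section \<open>Hardy functions and their Taylor coefficients\<close>

definition taylor :: "(complex \<Rightarrow> complex) \<Rightarrow> nat \<Rightarrow> complex" where
  "taylor h n = (deriv ^^ n) h 0 / fact n"

text \<open>Cut off outside the disc, so that sums, differences and multiples of coefficients
  correspond to those of functions at every point.\<close>

definition disc_series :: "(nat \<Rightarrow> complex) \<Rightarrow> complex \<Rightarrow> complex" where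
  "disc_series a z = (if cmod z < 1 then \<Sum>n. a n * z ^ n else 0)"

lemma taylor_sums:
  assumes "h holomorphic_on ball 0 1" "cmod z < 1"
  shows "(\<lambda>n. taylor h n * z ^ n) sums h z"
  using holomorphic_power_series[OF assms(1), of z] assms(2) by (simp add: taylor_def)

lemma disc_series_sums:
  assumes "a \<in> elems l2" "cmod z < 1"
  shows "(\<lambda>n. a n * z ^ n) sums disc_series a z"
  using summable_norm_cancel[OF l2_summable_power[OF assms]] assms(2)
  by (simp add: disc_series_def summable_sums)

lemma disc_series_holomorphic:
  assumes "a \<in> elems l2"
  shows "disc_series a holomorphic_on ball 0 1"
  using disc_series_sums[OF assms] by (intro power_series_holomorphic[of 0 1 a]) auto

lemma hardy2_mean_taylor:
  assumes h: "h holomorphic_on ball 0 1" and r: "0 \<le> r" "r < 1"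
  shows "(\<lambda>n. (cmod (taylor h n))\<^sup>2 * r ^ (2 * n)) sums hardy2_mean h r"
proof -
  define s where "s = (1 + r) / 2"
  have s: "r < s" "s < 1" using r by (auto simp: s_def)
  have "summable (\<lambda>n. taylor h n * of_real s ^ n)"
    using taylor_sums[OF h, of "of_real s"] s r by (simp add: sums_iff)
  from powser_insidea[OF this, of "of_real r"]
  have sm: "summable (\<lambda>n. cmod (taylor h n) * r ^ n)"
    using s r by (simp add: norm_mult norm_power)
  have "(\<Sum>n. taylor h n * rcis r t ^ n) = h (rcis r t)" for t
    using taylor_sums[OF h, of "rcis r t"] r by (simp add: sums_iff)
  then show ?thesis using circle_mean[OF r(1) sm] by (simp add: hardy2_mean_def)
qed

text \<open>The radius tends to 1 within a finite sum, so bounds on the means over smaller circles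
  pass to the partial sums of the squared coefficients.\<close>

lemma radial_limit_le:
  fixes c :: "nat \<Rightarrow> real"
  assumes "\<And>r. 0 \<le> r \<Longrightarrow> r < 1 \<Longrightarrow> (\<Sum>n<N. c n * r ^ (2 * n)) \<le> B"
  shows "(\<Sum>n<N. c n) \<le> B"
proof (rule tendsto_upperbound)
  have "(\<lambda>k. 1 - inverse (real (Suc k))) \<longlonglongrightarrow> 1 - 0"
    by (intro tendsto_intros LIMSEQ_inverse_real_of_nat)
  then have "(\<lambda>k. \<Sum>n<N. c n * (1 - inverse (real (Suc k))) ^ (2 * n)) \<longlonglongrightarrow> (\<Sum>n<N. c n * (1 - 0) ^ (2 * n))"
    by (intro tendsto_sum tendsto_mult tendsto_const tendsto_power)
  then show "(\<lambda>k. \<Sum>n<N. c n * (1 - inverse (real (Suc k))) ^ (2 * n)) \<longlonglongrightarrow> (\<Sum>n<N. c n)" by simp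
  show "\<forall>\<^sub>F k in sequentially. (\<Sum>n<N. c n * (1 - inverse (real (Suc k))) ^ (2 * n)) \<le> B"
    by (intro always_eventually allI assms) (simp_all add: inverse_le_1_iff)
qed simp

lemma H2_mem_taylor:
  assumes h: "h \<in> elems H2"
  shows "taylor h \<in> elems l2"
proof -
  have hol: "h holomorphic_on ball 0 1" using h by (simp add: H2_def)
  have "bdd_above (hardy2_mean h ` {0..<1})" using h by (simp add: H2_def)
  then obtain B where "\<And>x. x \<in> hardy2_mean h ` {0..<1} \<Longrightarrow> x \<le> B"
    unfolding bdd_above_def by blast
  then have B: "hardy2_mean h r \<le> B" if "0 \<le> r" "r < 1" for r using that by simp
  have "(\<Sum>n<N. (cmod (taylor h n))\<^sup>2) \<le> B" for N
  proof (rule radial_limit_le)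
    fix r :: real assume r: "0 \<le> r" "r < 1"
    note s = hardy2_mean_taylor[OF hol r]
    have "(\<Sum>n<N. (cmod (taylor h n))\<^sup>2 * r ^ (2 * n)) \<le> hardy2_mean h r"
      unfolding sums_unique[OF s] using r by (intro sum_le_suminf sums_summable[OF s]) auto
    then show "(\<Sum>n<N. (cmod (taylor h n))\<^sup>2 * r ^ (2 * n)) \<le> B" using B[OF r] by simp
  qed
  then show ?thesis unfolding l2_mem by (intro summableI_nonneg_bounded) auto
qed

text \<open>Each mean is a sum of \<open>(cmod (taylor h n))\<^sup>2 * r ^ (2 * n)\<close>, at most
  the full sum of squares; the converse inequality holds for every partial sum by the radial
  limit.\<close>

lemma H2_norm_taylor:
  assumes hol: "h holomorphic_on ball 0 1" and a: "taylor h \<in> elems l2"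
  shows "h \<in> elems H2" "snorm H2 h = snorm l2 (taylor h)"
proof -
  have le: "hardy2_mean h r \<le> (snorm l2 (taylor h))\<^sup>2" if r: "0 \<le> r" "r < 1" for r
  proof -
    note s = hardy2_mean_taylor[OF hol r]
    have "(cmod (taylor h n))\<^sup>2 * r ^ (2 * n) \<le> (cmod (taylor h n))\<^sup>2 * 1" for n
      using r by (intro mult_left_mono power_le_one) auto
    then show ?thesis
      unfolding sums_unique[OF s] l2_norm_sq[OF a]
      using a by (intro suminf_le sums_summable[OF s]) (auto simp: l2_mem)
  qed
  then have bdd: "bdd_above (hardy2_mean h ` {0..<1})"
    by (intro bdd_aboveI2[of _ _ "(snorm l2 (taylor h))\<^sup>2"]) auto
  then show "h \<in> elems H2" using hol by (simp add: H2_def)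
  have "(SUP r\<in>{0..<1}. hardy2_mean h r) = (snorm l2 (taylor h))\<^sup>2"
  proof (rule antisym)
    show "(SUP r\<in>{0..<1}. hardy2_mean h r) \<le> (snorm l2 (taylor h))\<^sup>2"
      using le by (intro cSUP_least) auto
    show "(snorm l2 (taylor h))\<^sup>2 \<le> (SUP r\<in>{0..<1}. hardy2_mean h r)"
      unfolding l2_norm_sq[OF a]
    proof (rule suminf_le_const)
      show "summable (\<lambda>n. (cmod (taylor h n))\<^sup>2)" using a by (simp add: l2_mem)
      show "(\<Sum>n<N. (cmod (taylor h n))\<^sup>2) \<le> (SUP r\<in>{0..<1}. hardy2_mean h r)" for N
      proof (rule radial_limit_le)
        fix r :: real assume r: "0 \<le> r" "r < 1"
        note s = hardy2_mean_taylor[OF hol r]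
        have "(\<Sum>n<N. (cmod (taylor h n))\<^sup>2 * r ^ (2 * n)) \<le> hardy2_mean h r"
          unfolding sums_unique[OF s] using r by (intro sum_le_suminf sums_summable[OF s]) auto
        also have "\<dots> \<le> (SUP r\<in>{0..<1}. hardy2_mean h r)" using r bdd by (intro cSUP_upper) auto
        finally show "(\<Sum>n<N. (cmod (taylor h n))\<^sup>2 * r ^ (2 * n)) \<le> (SUP r\<in>{0..<1}. hardy2_mean h r)" .
      qed
    qed
  qed
  then show "snorm H2 h = snorm l2 (taylor h)"
    using Lp_space_nonneg[of "count_space UNIV" 2 "taylor h"] by (simp add: H2_def)
qed

lemma taylor_disc_series:
  assumes a: "a \<in> elems l2"
  shows "taylor (disc_series a) = a"
proof
  fix n
  have "taylor (disc_series a) n - a n = 0"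
  proof (rule power_series_coeffs_zero[where a = "\<lambda>n. taylor (disc_series a) n - a n"])
    fix z :: complex assume z: "cmod z < 1"
    show "(\<lambda>n. (taylor (disc_series a) n - a n) * z ^ n) sums 0"
      using sums_diff[OF taylor_sums[OF disc_series_holomorphic[OF a] z] disc_series_sums[OF a z]]
      by (simp add: left_diff_distrib)
  qed
  then show "taylor (disc_series a) n = a n" by simp
qed

lemma disc_series_H2:
  assumes "a \<in> elems l2"
  shows "disc_series a \<in> elems H2" "snorm H2 (disc_series a) = snorm l2 a"
  using H2_norm_taylor[OF disc_series_holomorphic[OF assms]] assms by (simp_all add: taylor_disc_series)

lemma disc_series_taylor: "h \<in> elems H2 \<Longrightarrow> cmod z < 1 \<Longrightarrow> disc_series (taylor h) z = h z"
  using taylor_sums[of h z] by (simp add: disc_series_def H2_def sums_iff)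

lemma disc_series_diff:
  assumes "a \<in> elems l2" "b \<in> elems l2"
  shows "disc_series (\<lambda>n. a n - b n) = (\<lambda>z. disc_series a z - disc_series b z)"
proof
  fix z :: complex
  show "disc_series (\<lambda>n. a n - b n) z = disc_series a z - disc_series b z"
  proof (cases "cmod z < 1")
    case True
    then show ?thesis
      using sums_unique2[OF disc_series_sums[OF l2.diff_in[OF assms] True]
          sums_diff[OF disc_series_sums[OF assms(1) True] disc_series_sums[OF assms(2) True], unfolded left_diff_distrib[symmetric]]]
      by simp
  qed (simp add: disc_series_def)
qed

lemma disc_series_add:
  assumes "a \<in> elems l2" "b \<in> elems l2"
  shows "disc_series (\<lambda>n. a n + b n) = (\<lambda>z. disc_series a z + disc_series b z)"
  using disc_series_diff[OF l2.add_in[OF assms] assms(2)] by (simp add: fun_eq_iff)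

lemma disc_series_scale:
  assumes "a \<in> elems l2"
  shows "disc_series (\<lambda>n. c * a n) = (\<lambda>z. c * disc_series a z)"
proof
  fix z :: complex
  show "disc_series (\<lambda>n. c * a n) z = c * disc_series a z"
  proof (cases "cmod z < 1")
    case True
    then show ?thesis
      using sums_unique2[OF disc_series_sums[OF l2.scale_in[OF assms] True]
          sums_mult[OF disc_series_sums[OF assms True], of c, folded mult.assoc]]
      by simp
  qed (simp add: disc_series_def)
qed

lemma H2_snorm_cong:
  assumes "\<And>z. cmod z < 1 \<Longrightarrow> f z = g z"
  shows "snorm H2 f = snorm H2 g" "f \<in> elems H2 \<longleftrightarrow> g \<in> elems H2"
proof -
  have m: "hardy2_mean f r = hardy2_mean g r" if "r \<in> {0..<1}" for r
    using that assms by (simp add: hardy2_mean_def)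
  then show "snorm H2 f = snorm H2 g" by (simp add: H2_def)
  have "f holomorphic_on ball 0 1 \<longleftrightarrow> g holomorphic_on ball 0 1"
    by (intro holomorphic_cong refl) (use assms in auto)
  moreover have "hardy2_mean f ` {0..<1} = hardy2_mean g ` {0..<1}"
    by (intro image_cong refl m)
  ultimately show "f \<in> elems H2 \<longleftrightarrow> g \<in> elems H2" by (simp add: H2_def)
qed

lemma eq_in_H2_disc_series:
  assumes ab: "a \<in> elems l2" "b \<in> elems l2" and eq: "eq_in l2 a b"
    and fg: "\<And>z. cmod z < 1 \<Longrightarrow> f z = disc_series a z" "\<And>z. cmod z < 1 \<Longrightarrow> g z = disc_series b z"
  shows "eq_in H2 f g"
proof -
  have "snorm H2 (\<lambda>z. f z - g z) = snorm H2 (disc_series (\<lambda>n. a n - b n))"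
    unfolding disc_series_diff[OF ab] by (rule H2_snorm_cong(1)) (simp add: fg)
  also have "\<dots> = snorm l2 (\<lambda>n. a n - b n)"
    by (rule disc_series_H2(2)[OF l2.diff_in[OF ab]])
  finally show ?thesis using eq by (simp add: eq_in_def)
qed

lemma eq_in_H2I:
  assumes "\<And>z. cmod z < 1 \<Longrightarrow> f z = g z"
  shows "eq_in H2 f g"
proof -
  have "(\<lambda>n. 0) \<in> elems l2" by simp
  moreover have "disc_series (\<lambda>n. 0) = (\<lambda>z. 0)" by (simp add: disc_series_def fun_eq_iff)
  ultimately have "snorm H2 (\<lambda>z. 0) = snorm l2 (\<lambda>n. 0)" using disc_series_H2(2) by metis
  moreover have "snorm H2 (\<lambda>z. f z - g z) = snorm H2 (\<lambda>z. 0)"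
    by (rule H2_snorm_cong(1)) (simp add: assms)
  ultimately show ?thesis by (simp add: eq_in_def)
qed

text \<open>A function vanishing almost everywhere on (0, 1) has zeros accumulating at 1/2, since
  intervals have positive measure. The identity theorem makes the holomorphic extension vanish on
  the disc, and with it the coefficients.\<close>

lemma series_unit_inj:
  assumes a: "a \<in> elems l2" and 0: "snorm L2 (series_unit a) = 0"
  shows "snorm l2 a = 0"
proof -
  have ae: "AE t in unit_measure. series_unit a t = 0"
    using Lp_space_snorm_eq_0[OF _ series_unit_in[OF a]] 0 by simp
  have ds: "disc_series a (of_real t) = series_unit a t" if "0 < t" "t < 1" for t
    using that by (simp add: disc_series_def series_unit_def)
  let ?Z = "complex_of_real ` {t \<in> {0<..<1}. series_unit a t = 0}"
  have lp: "complex_of_real (1 / 2) islimpt ?Z"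
    unfolding islimpt_approachable
  proof (intro allI impI)
    fix e :: real assume e: "e > 0"
    \<comment> \<open>The bound 1/2 keeps the interval to the right of 1/2 inside (0, 1).\<close>
    define d where "d = min e (1 / 2)"
    have d: "0 < d" "d \<le> 1 / 2" "d \<le> e" using e by (auto simp: d_def)
    have "\<exists>t\<in>{1 / 2<..<1 / 2 + d}. series_unit a t = 0"
    proof (rule ccontr)
      assume "\<not> (\<exists>t\<in>{1 / 2<..<1 / 2 + d}. series_unit a t = 0)"
      then have "AE t in unit_measure. t \<notin> {1 / 2<..<1 / 2 + d}"
        using ae by (auto elim: eventually_mono)
      then have "AE t in lebesgue. t \<in> {0<..<1} \<longrightarrow> t \<notin> {1 / 2<..<1 / 2 + d}"
        by (subst (asm) AE_restrict_space_iff) auto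
      then have "AE t in lebesgue. t \<notin> {1 / 2<..<1 / 2 + d}"
        by (rule eventually_mono) (use d in auto)
      then have "{1 / 2<..<1 / 2 + d} \<in> null_sets lebesgue"
        by (subst (asm) AE_iff_null_sets[symmetric]) auto
      then show False using d by (auto simp: null_sets_def)
    qed
    then obtain t where t: "1 / 2 < t" "t < 1 / 2 + d" "series_unit a t = 0" by auto
    have "dist (complex_of_real t) (complex_of_real (1 / 2)) = t - 1 / 2"
      using t by (simp only: dist_of_real dist_real_def)
    then show "\<exists>x'\<in>?Z. x' \<noteq> complex_of_real (1 / 2) \<and> dist x' (complex_of_real (1 / 2)) < e"
      using t d by (intro bexI[of _ "complex_of_real t"] conjI imageI) (auto simp del: of_real_divide)
  qed
  have zero: "disc_series a z = 0" if "z \<in> ball 0 1" for z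
  proof (rule analytic_continuation[OF disc_series_holomorphic[OF a] open_ball connected_ball _ _ lp _ that])
    show "?Z \<subseteq> ball 0 1" by auto
    show "complex_of_real (1 / 2) \<in> ball 0 1" by simp
    show "disc_series a z = 0" if "z \<in> ?Z" for z using that ds by auto
  qed
  have "a n = 0" for n
    by (rule power_series_coeffs_zero) (use disc_series_sums[OF a] zero in force)
  then have "a = (\<lambda>n. 0)" by auto
  then show ?thesis by simp
qed

text \<open>The constant pi is the Schur bound at p = 2, transferred to moments by
  \<open>sum_moments_le\<close>.\<close>

interpretation ms: adjoint_pair L2 "L2_ip unit_measure" l2 "L2_ip (count_space UNIV)" moments series_unit pi
  by unfold_locales
    (use moments_exact_linear series_unit_exact_linear moments_adjoint moments_norm_sq moments_inj series_unit_inj in auto)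

section \<open>The Markov-Stieltjes transform\<close>

lemma eq_in_unitI:
  assumes "p > 0" "\<And>t. 0 < t \<Longrightarrow> t < 1 \<Longrightarrow> f t = g t"
  shows "eq_in (Lp_space unit_measure p) f g"
proof -
  have "(LINT t|unit_measure. cmod (f t - g t) powr p) = (LINT t|unit_measure. 0)"
    using assms by (intro Bochner_Integration.integral_cong refl) (auto simp: space_unit)
  then show ?thesis using assms(1) by (simp add: eq_in_def Lp_space_snorm)
qed

lemma bounded_MS_Lp:
  assumes p: "p > 1"
  shows "bounded_op (Lp_space unit_measure p) (Lp_space unit_measure p) MS_Lp"
proof -
  have "eq_in (Lp_space unit_measure p) (MS_Lp (\<lambda>x. f x + g x)) (\<lambda>y. MS_Lp f y + MS_Lp g y)"
    if fg: "f \<in> elems (Lp_space unit_measure p)" "g \<in> elems (Lp_space unit_measure p)" for f g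
  proof (rule eq_in_unitI)
    fix y :: real assume y: "0 < y" "y < 1"
    have "integrable unit_measure f" "integrable unit_measure g"
      using Lp_unit_integrable[OF less_imp_le[OF p]] fg by auto
    then show "MS_Lp (\<lambda>x. f x + g x) y = MS_Lp f y + MS_Lp g y"
      unfolding MS_Lp_def markov_stieltjes_def
      using markov_stieltjes_integrable_real[OF _ y(2)] by (simp add: add_divide_distrib)
  qed (use p in simp)
  moreover have "eq_in (Lp_space unit_measure p) (MS_Lp (\<lambda>x. c * f x)) (\<lambda>y. c * MS_Lp f y)" for c f
    using p by (intro eq_in_unitI) (auto simp: MS_Lp_scale)
  ultimately have "linear_op (Lp_space unit_measure p) (Lp_space unit_measure p) MS_Lp"
    unfolding linear_op_def using MS_Lp_bound(1)[OF p] by blast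
  then show ?thesis unfolding bounded_op_def using MS_Lp_bound(2)[OF p] by blast
qed

text \<open>Equality holds on (0, 1) only: \<open>ms.S f\<close> is cut off outside, whereas
  \<open>MS_Lp f\<close> is given by its integral everywhere.\<close>

lemma ms_S_eq_in: "f \<in> elems L2 \<Longrightarrow> eq_in L2 (ms.S f) (MS_Lp f)"
  unfolding ms.S_def by (rule eq_in_unitI) (auto simp: series_moments)

lemma approx_eigenvalue_eigensequence:
  assumes p: "p > 1" and r: "approx_eigenvalue p r"
  obtains F where "separated_eigensequence (Lp_space unit_measure p) MS_Lp r F (2 powr (1 / p))"
proof -
  obtain F where F: "\<And>n. F n \<in> elems (Lp_space unit_measure p)"
    "\<And>n. snorm (Lp_space unit_measure p) (F n) = 1"
    "(\<lambda>n. snorm (Lp_space unit_measure p) (\<lambda>t. MS_Lp (F n) t - r * F n t)) \<longlonglongrightarrow> 0"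
    "\<And>m n. m \<noteq> n \<Longrightarrow> snorm (Lp_space unit_measure p) (\<lambda>t. F m t - F n t) = 2 powr (1 / p)"
    by (rule approx_eigenvalue_sequence[OF p r], rule that) blast+
  interpret complete_fun_space "Lp_space unit_measure p"
    by (rule complete_fun_space_Lp) (use p in simp)
  show thesis
    by (rule that[of F], unfold_locales) (use F bounded_MS_Lp[OF p] in auto)
qed

text \<open>As \<open>sin (pi / p) = sin (pi / q)\<close>, both sides depend on the larger exponent
  alone. With \<open>\<theta> = pi / max p q\<close> the double-angle formulas turn the claim into
  \<open>2 (cos (\<theta> / 2))^2 \<ge> 1\<close>, that is
  \<open>cos \<theta> \<ge> 0\<close>.\<close>

lemma cot_bound:
  assumes p: "p > 1" and pq: "1 / p + 1 / q = 1"
  shows "pi / sin (pi / p) \<le> pi * cot (pi / (2 * max p q))"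
proof -
  have q: "q > 0"
  proof -
    have "1 / p < 1" using p by simp
    then have "1 / q > 0" using pq by linarith
    then show ?thesis by simp
  qed
  define m where "m = max p q"
  define \<theta> where "\<theta> = pi / m"
  \<comment> \<open>Two reciprocals with sum 1 cannot both exceed 1/2, so the larger exponent is at
    least 2 and \<open>\<theta> \<le> pi / 2\<close>.\<close>
  have "1 / m \<le> 1 / 2"
  proof (rule ccontr)
    assume "\<not> 1 / m \<le> 1 / 2"
    moreover have "1 / m \<le> 1 / p" "1 / m \<le> 1 / q" using p q by (auto simp: m_def intro!: divide_left_mono)
    ultimately show False using pq by linarith
  qed
  moreover have m: "m > 0" using p by (simp add: m_def)
  ultimately have \<theta>: "0 < \<theta>" "\<theta> \<le> pi / 2"
    using mult_left_mono[of "1 / m" "1 / 2" pi] by (auto simp: \<theta>_def)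
  have "pi / q = pi - pi / p"
  proof -
    have "pi * (1 / p + 1 / q) = pi" using pq by simp
    then show ?thesis by (simp add: algebra_simps)
  qed
  then have sin: "sin (pi / p) = sin \<theta>" by (auto simp: \<theta>_def m_def max_def)
  have s: "sin (\<theta> / 2) > 0" "cos (\<theta> / 2) > 0" using \<theta> pi_gt_zero by (auto intro!: sin_gt_zero cos_gt_zero)
  have "1 / sin \<theta> \<le> cot (\<theta> / 2)"
  proof -
    have sd: "sin \<theta> = 2 * sin (\<theta> / 2) * cos (\<theta> / 2)" using sin_double[of "\<theta> / 2"] by simp
    have "cos \<theta> = 2 * (cos (\<theta> / 2))\<^sup>2 - 1" using cos_double_cos[of "\<theta> / 2"] by simp
    moreover have "cos \<theta> \<ge> 0" using \<theta> by (intro cos_ge_zero) auto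
    ultimately have "1 \<le> 2 * (cos (\<theta> / 2))\<^sup>2" by simp
    then show ?thesis unfolding sd cot_def using s by (simp add: field_simps power2_eq_square)
  qed
  then have "pi * (1 / sin \<theta>) \<le> pi * cot (\<theta> / 2)" by (intro mult_left_mono) auto
  then show ?thesis unfolding sin by (simp add: \<theta>_def m_def mult.commute)
qed

text \<open>On Taylor coefficients the transform of the Hardy space acts as V A: restrict the power
  series to (0, 1), then take moments.\<close>

lemma MS_H2_disc_series:
  assumes h: "h \<in> elems H2" and z: "cmod z < 1"
  shows "MS_H2 h z = disc_series (moments (series_unit (taylor h))) z"
proof -
  note a = H2_mem_taylor[OF h]
  have "MS_H2 h z = markov_stieltjes (series_unit (taylor h)) z"
    unfolding MS_H2_def markov_stieltjes_def
    using disc_series_taylor[OF h]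
    by (intro Bochner_Integration.integral_cong refl) (auto simp: space_unit series_unit_def disc_series_def)
  then show ?thesis
    using markov_stieltjes_sums[OF series_unit_in[OF a] z] z by (simp add: disc_series_def sums_iff)
qed

lemma MS_H2_disc_series_l2:
  assumes a: "a \<in> elems l2" and z: "cmod z < 1"
  shows "MS_H2 (disc_series a) z = disc_series (moments (series_unit a)) z"
  using MS_H2_disc_series[OF disc_series_H2(1)[OF a] z] by (simp add: taylor_disc_series[OF a])

lemma H2_restriction_integrable:
  assumes h: "h \<in> elems H2"
  shows "integrable unit_measure (\<lambda>t. h (of_real t))"
proof -
  have "integrable unit_measure (series_unit (taylor h))"
    by (rule L2_integrable[OF series_unit_in[OF H2_mem_taylor[OF h]]])
  moreover have "integrable unit_measure (\<lambda>t. h (of_real t)) \<longleftrightarrow> integrable unit_measure (series_unit (taylor h))"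
    using disc_series_taylor[OF h]
    by (intro Bochner_Integration.integrable_cong refl) (auto simp: space_unit series_unit_def disc_series_def)
  ultimately show ?thesis by simp
qed

lemma bounded_MS_H2: "bounded_op H2 H2 MS_H2"
proof -
  have in_H2: "MS_H2 h \<in> elems H2" and norm: "snorm H2 (MS_H2 h) \<le> pi * snorm H2 h" if h: "h \<in> elems H2" for h
  proof -
    let ?a = "taylor h"
    note a = H2_mem_taylor[OF h]
    have VA: "moments (series_unit ?a) \<in> elems l2" using a by simp
    have "MS_H2 h \<in> elems H2 \<longleftrightarrow> disc_series (moments (series_unit ?a)) \<in> elems H2"
      by (rule H2_snorm_cong(2)) (rule MS_H2_disc_series[OF h])
    then show "MS_H2 h \<in> elems H2" using disc_series_H2(1)[OF VA] by blast
    have "snorm H2 (MS_H2 h) = snorm H2 (disc_series (moments (series_unit ?a)))"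
      by (rule H2_snorm_cong(1)) (rule MS_H2_disc_series[OF h])
    then have "snorm H2 (MS_H2 h) = snorm l2 (moments (series_unit ?a))"
      by (simp only: disc_series_H2(2)[OF VA])
    moreover have "(snorm l2 (moments (series_unit ?a)))\<^sup>2 \<le> (pi * snorm l2 ?a)\<^sup>2"
    proof -
      have "(snorm l2 (moments (series_unit ?a)))\<^sup>2 \<le> pi * (snorm L2 (series_unit ?a))\<^sup>2"
        by (rule moments_norm_sq[OF series_unit_in[OF a]])
      also have "\<dots> \<le> pi * (pi * (snorm l2 ?a)\<^sup>2)"
        using ms.A_bound[OF a] by (intro mult_left_mono) auto
      finally show ?thesis by (simp add: power_mult_distrib power2_eq_square mult_ac)
    qed
    then have "snorm l2 (moments (series_unit ?a)) \<le> pi * snorm l2 ?a"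
      by (rule power2_le_imp_le) (intro mult_nonneg_nonneg Lp_space_nonneg, simp)
    moreover have "snorm H2 h = snorm l2 ?a"
      using h a by (intro H2_norm_taylor(2)) (auto simp: H2_def)
    ultimately show "snorm H2 (MS_H2 h) \<le> pi * snorm H2 h" by simp
  qed
  have int: "integrable unit_measure (\<lambda>t. h (of_real t) / (1 - of_real t * z))"
    if "h \<in> elems H2" "cmod z < 1" for h z
  proof (rule markov_stieltjes_integrable[OF H2_restriction_integrable[OF that(1)], where \<delta> = "1 - cmod z"])
    fix t :: real assume "0 < t" "t < 1"
    then have "cmod (of_real t * z) \<le> cmod z" by (simp add: norm_mult mult_left_le_one_le)
    then show "1 - cmod z \<le> cmod (1 - of_real t * z)"
      using norm_triangle_ineq2[of 1 "of_real t * z"] by simp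
  qed (use that in simp)
  have "eq_in H2 (MS_H2 (\<lambda>x. f x + g x)) (\<lambda>y. MS_H2 f y + MS_H2 g y)" if "f \<in> elems H2" "g \<in> elems H2" for f g
    by (rule eq_in_H2I) (simp add: MS_H2_def markov_stieltjes_def add_divide_distrib int that)
  moreover have "eq_in H2 (MS_H2 (\<lambda>x. c * f x)) (\<lambda>y. c * MS_H2 f y)" for c f
    by (rule eq_in_H2I) (simp add: MS_H2_def markov_stieltjes_def flip: times_divide_eq_right)
  ultimately show ?thesis
    using in_H2 norm unfolding bounded_op_def linear_op_def by blast
qed

text \<open>The polar unitary into l^2 carries A V to V A; following it with
  \<open>disc_series\<close> carries the latter to the transform on the Hardy space.\<close>

lemma unitarily_equivalent_MS: "unitarily_equivalent L2 MS_Lp H2 MS_H2"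
proof -
  obtain U where U: "unitary_op L2 l2 U" "bounded_op L2 l2 U"
    "\<And>f. f \<in> elems L2 \<Longrightarrow> eq_in l2 (U (series_unit (moments f))) (moments (series_unit (U f)))"
    using ms.polar_decomposition by blast
  have lin: "linear_op L2 l2 U" using U(1) by (simp add: unitary_op_def)
  note U_in = linear_opD(1)[OF lin]
  define W where "W f = disc_series (U f)" for f
  have "linear_op L2 H2 W"
    unfolding linear_op_def
  proof (intro conjI ballI allI)
    show "W f \<in> elems H2" if "f \<in> elems L2" for f
      unfolding W_def by (rule disc_series_H2(1)[OF U_in[OF that]])
    show "eq_in H2 (W (\<lambda>x. f x + g x)) (\<lambda>y. W f y + W g y)" if fg: "f \<in> elems L2" "g \<in> elems L2" for f g
      unfolding W_def disc_series_add[OF U_in[OF fg(1)] U_in[OF fg(2)], symmetric]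
      by (rule eq_in_H2_disc_series[OF U_in[OF L2.add_in[OF fg]] l2.add_in[OF U_in[OF fg(1)] U_in[OF fg(2)]]
            linear_opD(2)[OF lin fg]]) simp_all
    show "eq_in H2 (W (\<lambda>x. c * f x)) (\<lambda>y. c * W f y)" if f: "f \<in> elems L2" for c f
      unfolding W_def disc_series_scale[OF U_in[OF f], symmetric]
      by (rule eq_in_H2_disc_series[OF U_in[OF L2.scale_in[OF f]] l2.scale_in[OF U_in[OF f]]
            linear_opD(3)[OF lin f]]) simp_all
  qed
  moreover have "snorm H2 (W f) = snorm L2 f" if "f \<in> elems L2" for f
    using U(1) that U_in[OF that] by (simp add: W_def disc_series_H2(2) unitary_op_def)
  moreover have "\<exists>f\<in>elems L2. eq_in H2 (W f) g" if g: "g \<in> elems H2" for g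
  proof -
    obtain f where f: "f \<in> elems L2" "eq_in l2 (U f) (taylor g)"
      using U(1) H2_mem_taylor[OF g] by (auto simp: unitary_op_def)
    have "eq_in H2 (W f) g"
      unfolding W_def
      by (rule eq_in_H2_disc_series[OF U_in[OF f(1)] H2_mem_taylor[OF g] f(2)])
         (simp_all add: disc_series_taylor[OF g])
    with f(1) show ?thesis by blast
  qed
  ultimately have W: "unitary_op L2 H2 W" by (auto simp: unitary_op_def)
  have "eq_in H2 (W (MS_Lp f)) (MS_H2 (W f))" if f: "f \<in> elems L2" for f
  proof (rule eq_in_H2_disc_series)
    show Mf: "U (MS_Lp f) \<in> elems l2" by (rule U_in[OF L2_MS_in[OF f]])
    have Sf: "U (ms.S f) \<in> elems l2" by (rule U_in[OF ms.S_in[OF f]])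
    show Vf: "moments (series_unit (U f)) \<in> elems l2"
      by (rule moments_in[OF series_unit_in[OF U_in[OF f]]])
    have "eq_in l2 (U (ms.S f)) (U (MS_Lp f))"
      by (rule bounded_op_cong[OF L2.complete_fun_space_axioms l2.complete_fun_space_axioms U(2)
            ms.S_in[OF f] L2_MS_in[OF f] ms_S_eq_in[OF f]])
    then have "eq_in l2 (U (MS_Lp f)) (U (ms.S f))" by (rule l2.eq_in_sym[OF Sf Mf])
    moreover have "eq_in l2 (U (ms.S f)) (moments (series_unit (U f)))"
      using U(3)[OF f] by (simp only: ms.S_def)
    ultimately show "eq_in l2 (U (MS_Lp f)) (moments (series_unit (U f)))"
      by (rule l2.eq_in_trans[OF Mf Sf Vf])
    show "W (MS_Lp f) z = disc_series (U (MS_Lp f)) z" for z by (simp add: W_def)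
    show "MS_H2 (W f) z = disc_series (moments (series_unit (U f))) z" if "cmod z < 1" for z
      unfolding W_def by (rule MS_H2_disc_series_l2[OF U_in[OF f] that])
  qed
  then show ?thesis
    unfolding unitarily_equivalent_def using W bounded_MS_Lp[of 2] bounded_MS_H2 by auto
qed

text \<open>The approximate eigenvalue with \<open>\<xi> = 0\<close> equals the Schur constant, so
  the norm is exactly \<open>pi / sin (pi / p)\<close>.\<close>

lemma MS_Lp_general:
  fixes p q :: real
  assumes p: "1 < p" and pq: "1 / p + 1 / q = 1"
  defines "X \<equiv> Lp_space unit_measure p"
  shows "bounded_op X X MS_Lp" "\<not> compact_op X X MS_Lp"
    "pi / sin (pi / p) \<le> op_norm X X MS_Lp" "op_norm X X MS_Lp \<le> pi / sin (pi / p)"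
proof -
  have C: "pi / sin (pi / p) > 0"
    using p by (intro divide_pos_pos sin_gt_zero) (auto simp: field_simps)
  have X: "complete_fun_space X"
    unfolding X_def by (rule complete_fun_space_Lp) (use p in simp)
  have sym: "mellin_symbol (1 / p) 0 = complex_of_real (pi / sin (pi / p))"
    using mellin_symbol_0[of "1 / p"] p by simp
  obtain F where "separated_eigensequence X MS_Lp (mellin_symbol (1 / p) 0) F (2 powr (1 / p))"
    unfolding X_def
    by (rule approx_eigenvalue_eigensequence[OF p approx_eigenvalue_mellin_symbol[OF p]])
  then interpret separated_eigensequence X MS_Lp "complex_of_real (pi / sin (pi / p))" F "2 powr (1 / p)"
    unfolding sym .
  show "bounded_op X X MS_Lp" unfolding X_def by (rule bounded_MS_Lp[OF p])
  have "complex_of_real (pi / sin (pi / p)) \<noteq> 0"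
    unfolding of_real_eq_0_iff using C by (rule less_imp_neq[symmetric])
  then show "\<not> compact_op X X MS_Lp" by (rule not_compact)
  show "pi / sin (pi / p) \<le> op_norm X X MS_Lp"
    using norm_le_op_norm C by (simp only: norm_of_real abs_of_pos)
  show "op_norm X X MS_Lp \<le> pi / sin (pi / p)"
    using op_norm_le[OF X less_imp_le[OF C], of X MS_Lp] MS_Lp_bound(2)[OF p] by (simp add: X_def)
qed

lemma approx_eigenvalue_in_ess_spectrum:
  assumes "approx_eigenvalue 2 r"
  shows "r \<in> ess_spectrum_op L2 MS_Lp"
proof -
  obtain F where "separated_eigensequence L2 MS_Lp r F (2 powr (1 / 2))"
    using approx_eigenvalue_eigensequence[OF _ assms] by auto
  then interpret separated_eigensequence L2 MS_Lp r F "2 powr (1 / 2)" .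
  show ?thesis by (rule in_ess_spectrum)
qed

lemma spectrum_MS_Lp:
  "spectrum_op L2 MS_Lp = complex_of_real ` {0..pi}"
  "ess_spectrum_op L2 MS_Lp = complex_of_real ` {0..pi}"
proof -
  have bdd: "bounded_op L2 L2 MS_Lp" by (rule bounded_MS_Lp) simp
  have sub: "ess_spectrum_op L2 MS_Lp \<subseteq> spectrum_op L2 MS_Lp"
    by (rule ess_spectrum_subset_spectrum[OF L2.complete_fun_space_axioms bdd])
  have sp: "spectrum_op L2 MS_Lp \<subseteq> complex_of_real ` {0..pi}"
    by (rule ms.spectrum_subset) (simp_all add: L2_MS_in ms_S_eq_in)
  have approx: "approx_eigenvalue 2 (mellin_symbol (1 / 2) \<xi>)" for \<xi>
    using approx_eigenvalue_mellin_symbol[of 2 \<xi>] by simp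
  \<comment> \<open>Every symbol value is an approximate eigenvalue, hence in the essential
    spectrum, hence in the spectrum of an operator with 0 <= S <= pi.\<close>
  have real: "mellin_symbol (1 / 2) \<xi> \<in> complex_of_real ` {0..pi}" for \<xi>
    using approx_eigenvalue_in_ess_spectrum[OF approx] sub sp by blast
  have "complex_of_real r \<in> ess_spectrum_op L2 MS_Lp" if "0 \<le> r" "r \<le> pi" for r
    using mellin_symbol_dense[OF real that] approx
    by (intro approx_eigenvalue_in_ess_spectrum approx_eigenvalue_limit) auto
  then have "complex_of_real ` {0..pi} \<subseteq> ess_spectrum_op L2 MS_Lp" by auto
  with sub sp show "spectrum_op L2 MS_Lp = complex_of_real ` {0..pi}"
    "ess_spectrum_op L2 MS_Lp = complex_of_real ` {0..pi}" by blast+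
qed

lemma ess_norm_MS_Lp: "ess_norm L2 MS_Lp = pi"
proof -
  have sym: "mellin_symbol (1 / 2) 0 = complex_of_real pi"
    using mellin_symbol_0[of "1 / 2"] by simp
  obtain F where "separated_eigensequence L2 MS_Lp (complex_of_real pi) F (2 powr (1 / 2))"
    using approx_eigenvalue_eigensequence[OF _ approx_eigenvalue_mellin_symbol[of 2 0]] sym by auto
  then interpret separated_eigensequence L2 MS_Lp "complex_of_real pi" F "2 powr (1 / 2)" .
  show ?thesis using ess_norm_eq MS_Lp_general(4)[of 2 2] by simp
qed

theorem theorem5p1:
  shows "(\<forall>p q :: real. 1 < p \<longrightarrow> 1 / p + 1 / q = 1 \<longrightarrow>
            bounded_op (Lp01 p) (Lp01 p) MS_Lp \<and>
            \<not> compact_op (Lp01 p) (Lp01 p) MS_Lp \<and>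
            pi / sin (pi / p) \<le> op_norm (Lp01 p) (Lp01 p) MS_Lp \<and>
            op_norm (Lp01 p) (Lp01 p) MS_Lp \<le> pi * cot (pi / (2 * max p q)))
       \<and> unitarily_equivalent (Lp01 2) MS_Lp H2 MS_H2
       \<and> op_norm (Lp01 2) (Lp01 2) MS_Lp = pi
       \<and> ess_norm (Lp01 2) MS_Lp = pi
       \<and> spectrum_op (Lp01 2) MS_Lp = complex_of_real ` {0..pi}
       \<and> ess_spectrum_op (Lp01 2) MS_Lp = complex_of_real ` {0..pi}"
proof (intro conjI allI impI)
  fix p q :: real assume p: "1 < p" and pq: "1 / p + 1 / q = 1"
  note MS = MS_Lp_general[OF p pq, folded Lp01_eq_Lp_space]
  show "bounded_op (Lp01 p) (Lp01 p) MS_Lp" "\<not> compact_op (Lp01 p) (Lp01 p) MS_Lp"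
    "pi / sin (pi / p) \<le> op_norm (Lp01 p) (Lp01 p) MS_Lp"
    by (fact MS)+
  show "op_norm (Lp01 p) (Lp01 p) MS_Lp \<le> pi * cot (pi / (2 * max p q))"
    by (rule order_trans[OF MS(4) cot_bound[OF p pq]])
next
  show "op_norm (Lp01 2) (Lp01 2) MS_Lp = pi"
    using MS_Lp_general(3,4)[of 2 2] unfolding Lp01_eq_Lp_space by simp
qed (unfold Lp01_eq_Lp_space,
     fact unitarily_equivalent_MS, fact ess_norm_MS_Lp, fact spectrum_MS_Lp(1), fact spectrum_MS_Lp(2))

end
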